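(* Let $g\ge 1$ be an integer, let $m$ be a symmetric positive-definite half-integral $g\times g$ matrix, and let $n\in\mathbb{N}$, $r\in\mathbb{Z}^g$ (a row vector) with $4n>m^{-1}[r^t]$. Put $D=\det\begin{pmatrix}2n & r\\ r^t & 2m\end{pmatrix}$ and, for an integer weight $k$, $k'=k-\frac g2-1$. Assume that $k$ is even whenever $2r\equiv 0 \pmod{\mathbb{Z}^g\cdot 2m}$. Then there exist an integer $k_0$ (depending only on $g$) and a constant $B>3\log 2$ such that for all $k\ge k_0$ the Jacobi Poincaré series $P^{k,m}_{n,r}$ does not vanish identically whenever \[ k'\le \frac{\pi D}{\det(2m)}\le {k'}^{\,1+\alpha(g)}\exp\left\{-\frac{B\log k'}{\log\log k'}\right\},\] where $\alpha(g)=\frac{2}{3(g+2)}$ if $1\le g\le 4$ and $\alpha(g)=\frac{2}{3g}$ if $g\ge 5$.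
   Context: Notation: $e(z)=e^{2\pi i z}$; $\mathcal H$ is the upper half plane; for matrices $A[B]=B^tAB$. A symmetric matrix $m$ is half-integral if $2m$ has integer entries and even diagonal entries. The Jacobi group $\Gamma^J_g=SL(2,\mathbb{Z})\ltimes(\mathbb{Z}^g\times\mathbb{Z}^g)$ acts on $\mathcal H\times\mathbb{C}^g$ by $\left(\begin{pmatrix}a&b\\c&d\end{pmatrix},(\lambda,\mu)\right)\circ(\tau,z)=\left(\frac{a\tau+b}{c\tau+d},(c\tau+d)^{-1}(z+\lambda\tau+\mu)\right)$, and on functions $\phi:\mathcal H\times\mathbb{C}^g\to\mathbb{C}$ by $\phi|_{k,m}\gamma(\tau,z)=(c\tau+d)^{-k}e\big(-c(c\tau+d)^{-1}m[z+\lambda\tau+\mu]+m[\lambda]+2\lambda^tmz\big)\phi(\gamma\circ(\tau,z))$. The space $J^{cusp}_{k,m,g}$ of Jacobi cusp forms consists of holomorphic $\phi$ with $\phi|_{k,m}\gamma=\phi$ for all $\gamma\in\Gamma^J_g$ and a Fourier expansion $\phi(\tau,z)=\sum_{n\in\mathbb{N},r\in\mathbb{Z}^g,4n>m^{-1}[r^t]}c_\phi(n,r)e(n\tau+rz)$. For $k>g+2$ the Poincaré series is $P^{k,m}_{n,r}(\tau,z)=\sum_{\gamma\in\Gamma^J_{g,\infty}\backslash\Gamma^J_g} e(n\tau+rz)|_{k,m}\gamma(\tau,z)$, where $\Gamma^J_{g,\infty}=\{(\begin{pmatrix}1&n\\0&1\end{pmatrix},(0,\mu)):n\in\mathbb{Z},\mu\in\mathbb{Z}^g\}$;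 it lies in $J^{cusp}_{k,m,g}$. The congruence $2r\equiv0\pmod{\mathbb{Z}^g\cdot 2m}$ means $2r=\lambda\cdot 2m$ for some $\lambda\in\mathbb{Z}^g$.
   Formalization: In the slash action defining the Poincaré series, the printed exponent term m[λ] is corrected to the standard m[λ]τ; with the printed term it is not a group action and the sum over λ (already for c=0) diverges, so the series is undefined. *)

theory Defs
  imports
    "HOL-Analysis.Infinite_Sum"
    "HOL-Algebra.Coset"
    "Jordan_Normal_Form.Determinant"
    "Jordan_Normal_Form.Gauss_Jordan_Elimination"
begin

text \<open>
  The rank \<open>g\<close> is an ordinary natural number, so that a constant can be chosen before it. Vectors
  and matrices are therefore those of \<open>Jordan_Normal_Form\<close>, with explicit dimensions; row and
  column vectors are both elements of \<^typ>\<open>'a vec\<close>.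
\<close>

definition e2pi :: "complex \<Rightarrow> complex" where
  "e2pi w = exp (2 * complex_of_real pi * \<i> * w)"

text \<open>The form \<open>A[v] = v\<^sup>t A v\<close>; it is bilinear (no conjugation), also over the complex numbers.\<close>

definition qform :: "'a::comm_semiring_0 mat \<Rightarrow> 'a vec \<Rightarrow> 'a" where
  "qform A v = v \<bullet> (A *\<^sub>v v)"

abbreviation cvec_of_int :: "int vec \<Rightarrow> complex vec" where
  "cvec_of_int v \<equiv> map_vec of_int v"

abbreviation rvec_of_int :: "int vec \<Rightarrow> real vec" where
  "rvec_of_int v \<equiv> map_vec of_int v"

abbreviation cmat_of_real :: "real mat \<Rightarrow> complex mat" where
  "cmat_of_real A \<equiv> map_mat complex_of_real A"

definition symmetric_mat :: "nat \<Rightarrow> real mat \<Rightarrow> bool" where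
  "symmetric_mat g m \<longleftrightarrow> m \<in> carrier_mat g g \<and> transpose_mat m = m"

definition positive_definite_mat :: "nat \<Rightarrow> real mat \<Rightarrow> bool" where
  "positive_definite_mat g m \<longleftrightarrow> (\<forall>v \<in> carrier_vec g. v \<noteq> 0\<^sub>v g \<longrightarrow> qform m v > 0)"

definition half_integral_mat :: "nat \<Rightarrow> real mat \<Rightarrow> bool" where
  "half_integral_mat g m \<longleftrightarrow>
     (\<forall>i<g. \<forall>j<g. 2 * m $$ (i, j) \<in> \<int>) \<and>
     (\<forall>i<g. \<exists>l::int. even l \<and> 2 * m $$ (i, i) = of_int l)"

definition inverse_mat :: "real mat \<Rightarrow> real mat" where
  "inverse_mat m = the (mat_inverse m)"

definition discriminant_det :: "real mat \<Rightarrow> nat \<Rightarrow> int vec \<Rightarrow> real" where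
  "discriminant_det m n r =
     det (four_block_mat
       (mat 1 1 (\<lambda>_. 2 * real n)) (mat_of_rows (dim_vec r) [rvec_of_int r])
       (mat_of_cols (dim_vec r) [rvec_of_int r]) (2 \<cdot>\<^sub>m m))"

definition index_det :: "real mat \<Rightarrow> real" where
  "index_det m = det (2 \<cdot>\<^sub>m m)"

text \<open>The congruence \<open>2r \<equiv> 0 (mod \<int>\<^sup>g \<cdot> 2m)\<close>. The row vector \<open>l \<cdot> 2m\<close> is written as the transpose
  of \<open>2m\<close> applied to \<open>l\<close>.\<close>

definition two_r_cong_0 :: "nat \<Rightarrow> real mat \<Rightarrow> int vec \<Rightarrow> bool" where
  "two_r_cong_0 g m r \<longleftrightarrow>
     (\<exists>l \<in> carrier_vec g. 2 \<cdot>\<^sub>v rvec_of_int r = transpose_mat (2 \<cdot>\<^sub>m m) *\<^sub>v rvec_of_int l)"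

text \<open>
  The group law of \<open>SL(2,\<int>) \<ltimes> (\<int>\<^sup>g \<times> \<int>\<^sup>g)\<close> is \<open>(M, X)(M', X') = (MM', XM' + X')\<close>, where
  \<open>X = (\<lambda>, \<mu>)\<close> is acted on from the right; it is the law for which the action below is a left
  action.
\<close>

type_synonym jacobi = "int mat \<times> int vec \<times> int vec"

definition jacobi_group :: "nat \<Rightarrow> jacobi monoid" where
  "jacobi_group g = \<lparr>
     carrier = {M \<in> carrier_mat 2 2. det M = 1} \<times> carrier_vec g \<times> carrier_vec g,
     mult = (\<lambda>(M, l, u) (M', l', u').
       (M * M',
        (M' $$ (0,0) \<cdot>\<^sub>v l + M' $$ (1,0) \<cdot>\<^sub>v u) + l',
        (M' $$ (0,1) \<cdot>\<^sub>v l + M' $$ (1,1) \<cdot>\<^sub>v u) + u')),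
     one = (1\<^sub>m 2, 0\<^sub>v g, 0\<^sub>v g)\<rparr>"

definition jacobi_group_inf :: "nat \<Rightarrow> jacobi set" where
  "jacobi_group_inf g =
     {(mat_of_rows_list 2 [[1, b], [0, 1]], 0\<^sub>v g, u) | (b::int) u. u \<in> carrier_vec g}"

definition jacobi_act :: "jacobi \<Rightarrow> complex \<times> complex vec \<Rightarrow> complex \<times> complex vec" where
  "jacobi_act = (\<lambda>(M, l, u) (t, z).
     let a = of_int (M $$ (0,0)); b = of_int (M $$ (0,1));
         c = of_int (M $$ (1,0)); d = of_int (M $$ (1,1))
     in ((a * t + b) / (c * t + d),
         inverse (c * t + d) \<cdot>\<^sub>v (z + t \<cdot>\<^sub>v cvec_of_int l + cvec_of_int u)))"

text \<open>
  The exponent contains \<open>m[\<lambda>]\<tau>\<close> (not just the integer \<open>m[\<lambda>]\<close>): only with the factor \<open>\<tau>\<close> is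
  this an action of the group, and only then does the Poincare series below converge.
\<close>

definition jacobi_slash ::
    "int \<Rightarrow> real mat \<Rightarrow> (complex \<times> complex vec \<Rightarrow> complex) \<Rightarrow> jacobi \<Rightarrow>
     complex \<times> complex vec \<Rightarrow> complex" where
  "jacobi_slash k m f = (\<lambda>(M, l, u) (t, z).
     let c = of_int (M $$ (1,0)); d = of_int (M $$ (1,1));
         mc = cmat_of_real m; lc = cvec_of_int l; uc = cvec_of_int u
     in (c * t + d) powi (- k)
        * e2pi (- c * inverse (c * t + d) * qform mc (z + t \<cdot>\<^sub>v lc + uc)
             + qform mc lc * t + 2 * (lc \<bullet> (mc *\<^sub>v z)))
        * f (jacobi_act (M, l, u) (t, z)))"

definition jacobi_seed :: "nat \<Rightarrow> int vec \<Rightarrow> complex \<times> complex vec \<Rightarrow> complex" where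
  "jacobi_seed n r = (\<lambda>(t, z). e2pi (of_nat n * t + cvec_of_int r \<bullet> z))"

text \<open>
  The sum runs over the right cosets \<open>\<Gamma>\<^sub>\<infinity> \<gamma>\<close>. On each of them the summand does not depend on the
  representative, so the one picked by \<open>SOME\<close> is immaterial.
\<close>

definition jacobi_poincare ::
    "nat \<Rightarrow> int \<Rightarrow> real mat \<Rightarrow> nat \<Rightarrow> int vec \<Rightarrow> complex \<Rightarrow> complex vec \<Rightarrow> complex" where
  "jacobi_poincare g k m n r t z =
     (\<Sum>\<^sub>\<infinity>C \<in> rcosets\<^bsub>jacobi_group g\<^esub> (jacobi_group_inf g).
        jacobi_slash k m (jacobi_seed n r) (SOME \<gamma>. \<gamma> \<in> C) (t, z))"

definition alpha_exp :: "nat \<Rightarrow> real" where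
  "alpha_exp g = (if g \<le> 4 then 2 / (3 * (real g + 2)) else 2 / (3 * real g))"

end

theory Submission
  imports "HOL-Probability.Distributions" "HOL-Analysis.Infinite_Set_Sum" "HOL-Real_Asymp.Real_Asymp" Defs
begin

unbundle no vec_syntax
unbundle no inner_syntax
hide_type (open) Finite_Cartesian_Product.vec

text \<open>
  Fix a height \<open>y\<close> and write \<open>z = p\<tau> + q\<close> with real \<open>p, q\<close>. The cosets with the same bottom row \<open>(c, d)\<close>
  add up to a transform of a theta series \<open>\<Theta>\<close> at \<open>(a\<tau> + b)/(c\<tau> + d)\<close>, and the \<open>L\<^sup>2\<close> norm of
  \<open>\<Theta>\<close> over the torus of all \<open>(p, q)\<close> mod 1 is invariant under \<open>SL(2, \<int>)\<close> and explicit. If the Poincare series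
  vanished on the torus, pairing it with \<open>\<Theta>\<close> and applying Cauchy-Schwarz to every row with \<open>c \<noteq> 0\<close> would give
  \<open>1 \<le> \<Sum> s\<^bsup>-(\<nu>+1)/2\<^esup> exp (\<nu>/2 (1 - 1/s))\<close> with \<open>s = |c\<tau> + d|\<^sup>2\<close>, \<open>\<nu> = k'\<close>, provided that
  \<open>y = k'/(2X)\<close>; the rows \<open>(0, \<plusminus>1)\<close> cannot cancel each other because of the parity assumption.
  This choice of \<open>y\<close> puts the maximum of every summand at \<open>s = 1\<close>, where the decay is Gaussian of width
  \<open>\<nu>\<^bsup>-1/2\<^esup>\<close>. As \<open>\<alpha>(g) \<le> 2/9\<close> gives \<open>1/y \<le> 2\<nu>\<^bsup>2/9\<^esup>\<close>, the real parts \<open>u\<close> for which some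
  \<open>s\<close> is within \<open>\<nu>\<^bsup>-12/25\<^esup>\<close> of 1 do not fill \<open>[0, 1]\<close>, and for any other \<open>u\<close> the sum tends to 0.
\<close>

section \<open>Integration over the unit cube and lattice translates\<close>

text \<open>At \<open>z = p\<tau> + q\<close> all summands share the modulus factor exp (2 pi y
  m[p]). Divided out, the row \<open>(c, d)\<close> leaves s^(-k/2) times \<Theta> at a point of
  height y/s. The squared norm of \<Theta> is a constant times exp (-4 pi \<Delta> y) y^(-g/2), with
  \<Delta> = n - m^(-1)[r]/4 and X = 2 pi \<Delta>. The constant cancels between the two sides, a
  factor s^(g/4) turns s^(-k/2) into s^(-(\<nu>+1)/2), and the choice of y means 4 pi \<Delta> y =
  \<nu>. The obstacle is that a single row with s close to 1 already contributes about 1. Such rows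
  must be avoided altogether, and with y fixed only u is free. The rows at stake have c up to about
  1/y. For one row the u with |s - 1| < \<delta> can fill a length of order sqrt \<delta> / c,
  because the line of height y may be tangent to the circle |c\<tau> + d| = 1; with about c values
  of d the total is of order sqrt \<delta> / y. Decay needs \<delta> above \<nu>^(-1/2), so 1/y has
  to stay below \<nu>^(1/4), and 2/9 < 1/4 leaves room.\<close>

definition Leb :: "nat \<Rightarrow> (nat \<Rightarrow> real) measure" where
  "Leb g = PiM {..<g} (\<lambda>_. lborel)"

text \<open>Points of \<open>Leb g\<close> are \<open>undefined\<close> from coordinate
  \<open>g\<close> on, whereas their translates and multiples are not. A function with this property
  can be evaluated at such points without restricting them first.\<close>

definition local_fun :: "nat \<Rightarrow> ((nat \<Rightarrow> real) \<Rightarrow> 'a) \<Rightarrow> bool" where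
  "local_fun g F \<longleftrightarrow> (\<forall>x y. (\<forall>i<g. x i = y i) \<longrightarrow> F x = F y)"

abbreviation (input) lat :: "nat \<Rightarrow> int vec set" where
  "lat g \<equiv> carrier_vec g"

definition shift :: "(nat \<Rightarrow> real) \<Rightarrow> int vec \<Rightarrow> nat \<Rightarrow> real" where
  "shift x v = (\<lambda>i. x i + of_int (v $ i))"

text \<open>Half open, so that the integer translates tile the space without overlap.\<close>

definition cube :: "nat \<Rightarrow> (nat \<Rightarrow> real) set" where
  "cube g = {x. \<forall>i<g. 0 \<le> x i \<and> x i < 1}"

interpretation lborel_product: product_sigma_finite "\<lambda>_::nat. lborel :: real measure"
  by (intro product_sigma_finite.intro) (rule sigma_finite_lborel)

lemma local_funD: "local_fun g F \<Longrightarrow> (\<And>i. i < g \<Longrightarrow> x i = y i) \<Longrightarrow> F x = F y"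
  unfolding local_fun_def by blast

lemma local_fun_mult:
  "local_fun g F \<Longrightarrow> local_fun g G \<Longrightarrow> local_fun g (\<lambda>x. F x * G x)"
  unfolding local_fun_def by metis

lemma local_fun_comp:
  assumes "local_fun g F" "\<And>i x y. i < g \<Longrightarrow> \<forall>j<g. x j = y j \<Longrightarrow> f x i = f y i"
  shows "local_fun g (\<lambda>x. F (f x))"
  unfolding local_fun_def by (intro allI impI local_funD[OF assms(1)] assms(2)) auto

lemma local_fun_cube: "local_fun g (\<lambda>x. indicator (cube g) x)"
  unfolding local_fun_def cube_def by (auto simp: indicator_def)

lemma sigma_finite_Leb: "sigma_finite_measure (Leb g)"
  unfolding Leb_def by (rule lborel_product.sigma_finite) auto

lemma measurable_component_Leb [measurable]: "i < g \<Longrightarrow> (\<lambda>x. x i) \<in> borel_measurable (Leb g)"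
  unfolding Leb_def using measurable_component_singleton[of i "{..<g}" "\<lambda>_. lborel"] by simp

lemma measurable_local_fun:
  assumes F: "F \<in> borel_measurable (Leb g)" "local_fun g F"
    and f: "\<And>i. i < g \<Longrightarrow> (\<lambda>x. f x i) \<in> borel_measurable M"
  shows "(\<lambda>x. F (f x)) \<in> borel_measurable M"
proof -
  have "(\<lambda>x. F (restrict (f x) {..<g})) \<in> borel_measurable M"
    using F(1) by (rule measurable_compose_rev)
      (auto simp: Leb_def intro!: measurable_restrict f)
  also have "(\<lambda>x. F (restrict (f x) {..<g})) = (\<lambda>x. F (f x))"
    by (intro ext local_funD[OF F(2)]) auto
  finally show ?thesis .
qed

lemma measurable_cube [measurable]: "(\<lambda>x. indicator (cube g) x :: ennreal) \<in> borel_measurable (Leb g)"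
proof -
  have "(\<lambda>x. indicator (cube g) x) = (\<lambda>x. \<Prod>i<g. indicator {0..<1} (x i) :: ennreal)"
    by (auto simp: cube_def indicator_def fun_eq_iff)
  also have "\<dots> \<in> borel_measurable (Leb g)"
    by (intro borel_measurable_prod_ennreal measurable_compose[OF measurable_component_Leb])
       auto
  finally show ?thesis .
qed

text \<open>The Haar probability measure of the torus, realised on the fundamental domain
  \<open>cube g\<close>.\<close>

definition box :: "nat \<Rightarrow> (nat \<Rightarrow> real) measure" where
  "box g = density (Leb g) (indicator (cube g))"

lemma sets_box [measurable_cong, simp]: "sets (box g) = sets (Leb g)"
  by (simp add: box_def)

lemma nn_integral_box:
  "F \<in> borel_measurable (Leb g) \<Longrightarrow>
    (\<integral>\<^sup>+x. F x \<partial>box g) = (\<integral>\<^sup>+x. F x * indicator (cube g) x \<partial>Leb g)"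
  unfolding box_def by (subst nn_integral_density) (simp_all add: mult.commute)

lemma Leb_Suc: "Leb (Suc g) = PiM (insert g {..<g}) (\<lambda>_. lborel)"
  unfolding Leb_def by (simp add: lessThan_Suc)

text \<open>Induction on the dimension: the last coordinate is split off and treated by the
  one-dimensional substitution.\<close>

lemma nn_integral_Leb_affine:
  assumes "F \<in> borel_measurable (Leb g)" "local_fun g F" and t: "t \<noteq> 0"
  shows "(\<integral>\<^sup>+x. F x \<partial>Leb g) = ennreal (\<bar>t\<bar> ^ g) * (\<integral>\<^sup>+x. F (\<lambda>i. b i + t * x i) \<partial>Leb g)"
  using assms(1,2)
proof (induction g arbitrary: F)
  case 0
  have "F (\<lambda>i. b i + t * x i) = F x" for x
    by (rule local_funD[OF 0(2)]) simp
  then show ?case by simp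
next
  case (Suc g)
  note [measurable] = Suc.prems(1)
  have loc: "local_fun g (\<lambda>x. F (x(g := y)))" for y
    unfolding local_fun_def by (intro allI impI local_funD[OF Suc.prems(2)]) (auto simp: less_Suc_eq)
  have upd: "(\<lambda>(y, x). x(g := y)) \<in> measurable (lborel \<Otimes>\<^sub>M Leb g) (Leb (Suc g))"
    unfolding Leb_Suc Leb_def case_prod_unfold
    by (intro measurable_fun_upd[where J = "{..<g}"]) auto
  have meas2: "(\<lambda>(y, x). F (x(g := y))) \<in> borel_measurable (lborel \<Otimes>\<^sub>M Leb g)"
    using measurable_compose[OF upd Suc.prems(1)] by (simp add: case_prod_unfold fun_upd_def)
  have meas1: "(\<lambda>x. F (x(g := y))) \<in> borel_measurable (Leb g)" for y
    using measurable_compose[OF measurable_Pair1' meas2, of y] by (simp add: fun_upd_def)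
  \<comment> \<open>\<open>H\<close> already contains the affine change in the first
    \<open>g\<close> coordinates, so only the last one remains to be substituted.\<close>
  define H where "H y = (\<integral>\<^sup>+x. F ((\<lambda>i. b i + t * x i)(g := y)) \<partial>Leb g)" for y
  have H: "H \<in> borel_measurable borel"
  proof -
    have "(\<lambda>(y, x). F ((\<lambda>i. b i + t * x i)(g := y))) \<in> borel_measurable (borel \<Otimes>\<^sub>M Leb g)"
      unfolding case_prod_unfold
      by (rule measurable_local_fun[OF Suc.prems]) (auto simp: less_Suc_eq)
    then show ?thesis
      unfolding H_def by (rule sigma_finite_measure.borel_measurable_nn_integral[OF sigma_finite_Leb])
  qed
  have upd_affine: "(\<lambda>i. b i + t * (x(g := y)) i) = (\<lambda>i. b i + t * x i)(g := b g + t * y)" for x y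
    by auto
  have "(\<integral>\<^sup>+x. F x \<partial>Leb (Suc g)) = (\<integral>\<^sup>+y. (\<integral>\<^sup>+x. F (x(g := y)) \<partial>Leb g) \<partial>lborel)"
    using lborel_product.product_nn_integral_insert_rev[of "{..<g}" g F] Suc.prems(1)
    by (simp add: Leb_def lessThan_Suc)
  also have "\<dots> = (\<integral>\<^sup>+y. ennreal (\<bar>t\<bar> ^ g) * H y \<partial>lborel)"
    unfolding H_def by (intro nn_integral_cong Suc.IH meas1 loc)
  also have "\<dots> = ennreal (\<bar>t\<bar> ^ g) * (\<integral>\<^sup>+y. H y \<partial>lborel)"
    using H by (intro nn_integral_cmult) auto
  also have "(\<integral>\<^sup>+y. H y \<partial>lborel) = ennreal \<bar>t\<bar> * (\<integral>\<^sup>+y. H (b g + t * y) \<partial>lborel)"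
    by (rule nn_integral_real_affine[OF H t])
  also have "(\<integral>\<^sup>+y. H (b g + t * y) \<partial>lborel) = (\<integral>\<^sup>+x. F (\<lambda>i. b i + t * x i) \<partial>Leb (Suc g))"
    unfolding H_def upd_affine[symmetric]
    using lborel_product.product_nn_integral_insert_rev[of "{..<g}" g "\<lambda>x. F (\<lambda>i. b i + t * x i)"]
      measurable_local_fun[OF Suc.prems, of "\<lambda>x i. b i + t * x i" "Leb (Suc g)"]
    by (simp add: Leb_Suc[symmetric] Leb_def[of g, symmetric] less_Suc_eq)
  finally show ?case
    by (simp add: ennreal_mult' mult_ac)
qed

lemma bij_betw_uminus_lat: "bij_betw uminus (lat g) (lat g)"
  by (rule bij_betw_byWitness[where f' = uminus]) auto

lemma countable_lat: "countable (lat g)"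
proof -
  have "lat g \<subseteq> range vec_of_list"
  proof
    fix v :: "int vec" assume "v \<in> lat g"
    then show "v \<in> range vec_of_list" by (metis rangeI vec_list)
  qed
  then show ?thesis by (rule countable_subset) simp
qed

text \<open>In each coordinate exactly one integer, given by a floor, leads into the half-open
  interval. The case \<open>t = -1\<close> serves reflections of the torus.\<close>

lemma sum_lat_cube_translates:
  assumes "t = 1 \<or> t = -1"
  shows "(\<integral>\<^sup>+v. indicator (cube g) (\<lambda>i. b i + t * shift x v i) \<partial>count_space (lat g)) = 1"
proof -
  define w :: "int vec" where
    "w = vec g (\<lambda>i. if t = 1 then - \<lfloor>x i + b i\<rfloor> else \<lfloor>b i - x i\<rfloor>)"
  have "(\<lambda>i. b i + t * shift x v i) \<in> cube g \<longleftrightarrow> v = w" if "v \<in> lat g" for v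
  proof -
    have "(0 \<le> b i + t * shift x v i \<and> b i + t * shift x v i < 1) \<longleftrightarrow> v $ i = w $ i" if "i < g" for i
      using assms that unfolding w_def shift_def
      by (auto simp: floor_eq_iff minus_equation_iff) linarith+
    then show ?thesis
      using that by (auto simp: cube_def vec_eq_iff w_def)
  qed
  then have "(\<integral>\<^sup>+v. indicator (cube g) (\<lambda>i. b i + t * shift x v i) \<partial>count_space (lat g))
      = (\<integral>\<^sup>+v. indicator {w} v \<partial>count_space (lat g))"
    by (intro nn_integral_cong) (auto simp: indicator_def)
  also have "\<dots> = 1"
    by (subst nn_integral_indicator) (auto simp: w_def)
  finally show ?thesis .
qed

text \<open>Inserts the partition of unity given by the translated cubes and moves each piece back
  to the base cube. The substitution reverses the sign of \<open>v\<close>, which the bijection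
  \<open>uminus\<close> undoes.\<close>

lemma nn_integral_Leb_tile:
  assumes F: "F \<in> borel_measurable (Leb g)" "local_fun g F"
  shows "(\<integral>\<^sup>+x. F x \<partial>Leb g) = (\<integral>\<^sup>+v. (\<integral>\<^sup>+x. F (shift x v) \<partial>box g) \<partial>count_space (lat g))"
proof -
  have [measurable]: "(\<lambda>x. F (shift x v)) \<in> borel_measurable (Leb g)" for v
    by (rule measurable_local_fun[OF F]) (auto simp: shift_def)
  have [measurable]: "(\<lambda>x. indicator (cube g) (shift x v) :: ennreal) \<in> borel_measurable (Leb g)" for v
    by (rule measurable_local_fun[OF measurable_cube local_fun_cube]) (auto simp: shift_def)
  note [measurable] = F(1)
  have loc: "local_fun g (\<lambda>x. F x * indicator (cube g) (shift x v))" for v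
    by (intro local_fun_mult F local_fun_comp[OF local_fun_cube]) (auto simp: shift_def)
  have one: "(\<integral>\<^sup>+v. indicator (cube g) (shift x v) \<partial>count_space (lat g)) = 1" for x
    using sum_lat_cube_translates[of 1 g "\<lambda>_. 0" x] by simp
  have "(\<integral>\<^sup>+x. F x \<partial>Leb g) = (\<integral>\<^sup>+x. (\<integral>\<^sup>+v. F x * indicator (cube g) (shift x v) \<partial>count_space (lat g)) \<partial>Leb g)"
    by (simp add: nn_integral_cmult one)
  also have "\<dots> = (\<integral>\<^sup>+v. (\<integral>\<^sup>+x. F x * indicator (cube g) (shift x v) \<partial>Leb g) \<partial>count_space (lat g))"
    by (intro nn_integral_count_space_nn_integral countable_lat) measurable
  also have "\<dots> = (\<integral>\<^sup>+v. (\<integral>\<^sup>+x. F (shift x (- v)) * indicator (cube g) x \<partial>Leb g) \<partial>count_space (lat g))"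
  proof (rule nn_integral_cong)
    fix v :: "int vec" assume v: "v \<in> space (count_space (lat g))"
    have "(\<integral>\<^sup>+x. F x * indicator (cube g) (shift x v) \<partial>Leb g) =
      ennreal (\<bar>1\<bar> ^ g) * (\<integral>\<^sup>+x. F (\<lambda>i. real_of_int ((- v) $ i) + 1 * x i) *
        indicator (cube g) (shift (\<lambda>i. real_of_int ((- v) $ i) + 1 * x i) v) \<partial>Leb g)"
      by (rule nn_integral_Leb_affine[OF _ loc]) auto
    also have "\<dots> = (\<integral>\<^sup>+x. F (shift x (- v)) * indicator (cube g) x \<partial>Leb g)"
    proof -
      have "F (\<lambda>i. real_of_int ((- v) $ i) + 1 * x i) = F (shift x (- v))" for x
        by (simp add: shift_def add_ac)
      moreover have "indicator (cube g) (shift (\<lambda>i. real_of_int ((- v) $ i) + 1 * x i) v)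
          = (indicator (cube g) x :: ennreal)" for x
        using v by (intro local_funD[OF local_fun_cube]) (auto simp: shift_def)
      ultimately show ?thesis by simp
    qed
    finally show "(\<integral>\<^sup>+x. F x * indicator (cube g) (shift x v) \<partial>Leb g) =
      (\<integral>\<^sup>+x. F (shift x (- v)) * indicator (cube g) x \<partial>Leb g)" .
  qed
  also have "\<dots> = (\<integral>\<^sup>+v. (\<integral>\<^sup>+x. F (shift x v) * indicator (cube g) x \<partial>Leb g) \<partial>count_space (lat g))"
    by (rule nn_integral_bij_count_space[OF bij_betw_uminus_lat])
  finally show ?thesis by (simp add: nn_integral_box)
qed

text \<open>The image of the cube is another fundamental domain, and periodicity allows its pieces
  to be moved back into the cube.\<close>

lemma nn_integral_box_affine:
  assumes H: "H \<in> borel_measurable (Leb g)" "local_fun g H"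
    and per: "\<And>x v. v \<in> lat g \<Longrightarrow> H (shift x v) = H x"
    and t: "t = 1 \<or> t = -1"
  shows "(\<integral>\<^sup>+x. H (\<lambda>i. b i + t * x i) \<partial>box g) = (\<integral>\<^sup>+x. H x \<partial>box g)"
proof -
  have [measurable]: "(\<lambda>x. H (\<lambda>i. b i + t * x i)) \<in> borel_measurable (Leb g)"
    by (rule measurable_local_fun[OF H]) auto
  note [measurable] = H(1)
  \<comment> \<open>The indicator selects the image of the cube under x -> b + t x. The inverse map
    is x -> -t b + t x because t^2 = 1.\<close>
  define F where "F x = H x * indicator (cube g) (\<lambda>i. - t * b i + t * x i)" for x
  have [measurable]: "F \<in> borel_measurable (Leb g)"
    unfolding F_def by (intro borel_measurable_times_ennreal H measurable_local_fun[OF measurable_cube local_fun_cube]) auto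
  have locF: "local_fun g F"
    unfolding F_def by (intro local_fun_mult H local_fun_comp[OF local_fun_cube]) auto
  have ind_meas: "(\<lambda>x. indicator (cube g) (\<lambda>i. - t * b i + t * shift x v i) :: ennreal) \<in> borel_measurable (Leb g)" for v
    by (rule measurable_local_fun[OF measurable_cube local_fun_cube]) (auto simp: shift_def)
  have "(\<integral>\<^sup>+x. H (\<lambda>i. b i + t * x i) \<partial>box g) = (\<integral>\<^sup>+x. F (\<lambda>i. b i + t * x i) \<partial>Leb g)"
    using t by (subst nn_integral_box, measurable) (auto intro!: nn_integral_cong simp: F_def algebra_simps)
  also have "\<dots> = (\<integral>\<^sup>+x. F x \<partial>Leb g)"
    using nn_integral_Leb_affine[of F g t b] locF t by auto
  also have "\<dots> = (\<integral>\<^sup>+v. (\<integral>\<^sup>+x. F (shift x v) \<partial>box g) \<partial>count_space (lat g))"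
    by (rule nn_integral_Leb_tile[OF _ locF]) measurable
  also have "\<dots> = (\<integral>\<^sup>+v. (\<integral>\<^sup>+x. (H x * indicator (cube g) x) *
      indicator (cube g) (\<lambda>i. - t * b i + t * shift x v i) \<partial>Leb g) \<partial>count_space (lat g))"
  proof (rule nn_integral_cong)
    fix v :: "int vec" assume v: "v \<in> space (count_space (lat g))"
    have "(\<lambda>x. F (shift x v)) \<in> borel_measurable (Leb g)"
      by (rule measurable_local_fun[OF _ locF]) (auto simp: shift_def)
    then show "(\<integral>\<^sup>+x. F (shift x v) \<partial>box g) = (\<integral>\<^sup>+x. (H x * indicator (cube g) x) *
      indicator (cube g) (\<lambda>i. - t * b i + t * shift x v i) \<partial>Leb g)"
      using v by (simp add: nn_integral_box F_def per mult_ac)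
  qed
  also have "\<dots> = (\<integral>\<^sup>+x. (\<integral>\<^sup>+v. (H x * indicator (cube g) x) *
      indicator (cube g) (\<lambda>i. - t * b i + t * shift x v i) \<partial>count_space (lat g)) \<partial>Leb g)"
    by (intro nn_integral_count_space_nn_integral[symmetric] countable_lat
      borel_measurable_times_ennreal ind_meas H measurable_cube)
  also have "\<dots> = (\<integral>\<^sup>+x. H x * indicator (cube g) x \<partial>Leb g)"
    by (simp add: nn_integral_cmult sum_lat_cube_translates[OF t, of g "\<lambda>i. - t * b i", simplified])
  finally show ?thesis by (simp add: nn_integral_box)
qed

lemma indicator_cube_prod:
  "indicator (cube g) x = (\<Prod>i<g. indicator {0..<1} (x i) :: 'a::comm_semiring_1)"
proof (cases "x \<in> cube g")
  case True
  then show ?thesis by (simp add: cube_def)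
next
  case False
  then obtain i where "i < g" "x i \<notin> {0..<1}" by (auto simp: cube_def)
  then have "(\<Prod>i<g. indicator {0..<1} (x i) :: 'a) = 0"
    by (intro prod_zero) (auto simp: indicator_def)
  then show ?thesis using False by simp
qed

lemma prob_space_box: "prob_space (box g)"
proof
  have "emeasure (box g) (space (box g)) = (\<integral>\<^sup>+x. 1 \<partial>box g)"
    by simp
  also have "\<dots> = (\<integral>\<^sup>+x. indicator (cube g) x \<partial>Leb g)"
    by (subst nn_integral_box) auto
  also have "\<dots> = (\<integral>\<^sup>+x. (\<Prod>i<g. indicator {0..<1::real} (x i)) \<partial>PiM {..<g} (\<lambda>_. lborel))"
    unfolding Leb_def by (intro nn_integral_cong) (rule indicator_cube_prod)
  also have "\<dots> = (\<Prod>i<g. \<integral>\<^sup>+y. indicator {0..<1::real} y \<partial>lborel)"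
    by (rule lborel_product.product_nn_integral_prod) auto
  also have "\<dots> = 1" by simp
  finally show "emeasure (box g) (space (box g)) = 1" .
qed

interpretation box: prob_space "box g" for g by (rule prob_space_box)
interpretation box2: pair_prob_space "box g" "box g" for g ..

section \<open>Invariance of integrals over pairs of torus points under SL(2,Z)\<close>

locale torus_function =
  fixes g :: nat and G :: "(nat \<Rightarrow> real) \<Rightarrow> (nat \<Rightarrow> real) \<Rightarrow> ennreal"
  assumes measurable_G: "(\<lambda>(p, q). G p q) \<in> borel_measurable (Leb g \<Otimes>\<^sub>M Leb g)"
    and local_left: "\<And>q. local_fun g (\<lambda>p. G p q)"
    and local_right: "\<And>p. local_fun g (G p)"
    and periodic_left: "\<And>p q v. v \<in> lat g \<Longrightarrow> G (shift p v) q = G p q"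
    and periodic_right: "\<And>p q v. v \<in> lat g \<Longrightarrow> G p (shift q v) = G p q"
begin

definition twist :: "int \<Rightarrow> int \<Rightarrow> int \<Rightarrow> int \<Rightarrow> (nat \<Rightarrow> real) \<Rightarrow> (nat \<Rightarrow> real) \<Rightarrow> ennreal" where
  "twist a b c d p q = G (\<lambda>i. a * p i + b * q i) (\<lambda>i. c * p i + d * q i)"

lemma G_cong: "(\<And>i. i < g \<Longrightarrow> p i = p' i) \<Longrightarrow> (\<And>i. i < g \<Longrightarrow> q i = q' i) \<Longrightarrow> G p q = G p' q'"
  using local_funD[OF local_left] local_funD[OF local_right] by metis

lemma measurable_G_comp:
  assumes "\<And>i. i < g \<Longrightarrow> (\<lambda>x. f x i) \<in> borel_measurable M" "\<And>i. i < g \<Longrightarrow> (\<lambda>x. h x i) \<in> borel_measurable M"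
  shows "(\<lambda>x. G (f x) (h x)) \<in> borel_measurable M"
proof -
  have "(\<lambda>x. (restrict (f x) {..<g}, restrict (h x) {..<g})) \<in> measurable M (Leb g \<Otimes>\<^sub>M Leb g)"
    by (intro measurable_Pair) (auto simp: Leb_def intro!: measurable_restrict assms)
  from measurable_compose[OF this measurable_G]
  have "(\<lambda>x. G (restrict (f x) {..<g}) (restrict (h x) {..<g})) \<in> borel_measurable M" by simp
  also have "(\<lambda>x. G (restrict (f x) {..<g}) (restrict (h x) {..<g})) = (\<lambda>x. G (f x) (h x))"
    by (intro ext G_cong) auto
  finally show ?thesis .
qed

lemma measurable_twist: "(\<lambda>x. twist a b c d (f x) (h x)) \<in> borel_measurable M"
  if "\<And>i. i < g \<Longrightarrow> (\<lambda>x. f x i) \<in> borel_measurable M" "\<And>i. i < g \<Longrightarrow> (\<lambda>x. h x i) \<in> borel_measurable M"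
  unfolding twist_def using that by (intro measurable_G_comp) auto

lemma twist_local: "local_fun g (\<lambda>p. twist a b c d p q)" "local_fun g (twist a b c d p)"
  unfolding local_fun_def twist_def by (auto intro!: G_cong)

lemma twist_periodic:
  assumes v: "v \<in> lat g"
  shows "twist a b c d (shift p v) q = twist a b c d p q" "twist a b c d p (shift q v) = twist a b c d p q"
proof -
  have *: "G (\<lambda>i. P i + of_int l * of_int (v $ i)) (\<lambda>i. Q i + of_int k * of_int (v $ i)) = G P Q" for P Q k l
  proof -
    have "G (\<lambda>i. P i + of_int l * of_int (v $ i)) (\<lambda>i. Q i + of_int k * of_int (v $ i))
        = G (shift P (l \<cdot>\<^sub>v v)) (shift Q (k \<cdot>\<^sub>v v))"
      using v by (intro G_cong) (auto simp: shift_def)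
    then show ?thesis using v by (simp add: periodic_left periodic_right)
  qed
  show "twist a b c d (shift p v) q = twist a b c d p q"
    using *[of "\<lambda>i. a * p i + b * q i" a "\<lambda>i. c * p i + d * q i" c]
    by (simp add: twist_def shift_def algebra_simps)
  show "twist a b c d p (shift q v) = twist a b c d p q"
    using *[of "\<lambda>i. a * p i + b * q i" b "\<lambda>i. c * p i + d * q i" d]
    by (simp add: twist_def shift_def algebra_simps)
qed

definition twint :: "int \<Rightarrow> int \<Rightarrow> int \<Rightarrow> int \<Rightarrow> ennreal" where
  "twint a b c d = (\<integral>\<^sup>+p. (\<integral>\<^sup>+q. twist a b c d p q \<partial>box g) \<partial>box g)"

text \<open>For fixed \<open>p\<close> the shear translates \<open>q\<close> by the torus point
  \<open>j p\<close>, which the inner integral does not see.\<close>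

lemma twint_shear: "twint (a + j * b) b (c + j * d) d = twint a b c d"
proof -
  have "(\<integral>\<^sup>+q. twist (a + j * b) b (c + j * d) d p q \<partial>box g) = (\<integral>\<^sup>+q. twist a b c d p q \<partial>box g)" for p
  proof -
    have "(\<integral>\<^sup>+q. twist a b c d p (\<lambda>i. of_int j * p i + 1 * q i) \<partial>box g) = (\<integral>\<^sup>+q. twist a b c d p q \<partial>box g)"
      by (intro nn_integral_box_affine twist_local twist_periodic measurable_twist) auto
    moreover have "twist a b c d p (\<lambda>i. of_int j * p i + 1 * q i) = twist (a + j * b) b (c + j * d) d p q" for q
      by (simp add: twist_def algebra_simps)
    ultimately show ?thesis by simp
  qed
  then show ?thesis by (simp add: twint_def)
qed

lemma twint_swap: "twint b a d c = twint a b c d"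
proof -
  have "twist b a d c p q = twist a b c d q p" for p q
    by (simp add: twist_def add.commute)
  then have "twint b a d c = (\<integral>\<^sup>+p. (\<integral>\<^sup>+q. twist a b c d q p \<partial>box g) \<partial>box g)"
    by (simp add: twint_def)
  also have "\<dots> = twint a b c d"
    unfolding twint_def
    by (rule box2.Fubini') (auto intro!: measurable_twist simp: case_prod_unfold)
  finally show ?thesis .
qed

lemma twint_neg: "twint a (- b) c (- d) = twint a b c d"
proof -
  have "(\<integral>\<^sup>+q. twist a b c d p (\<lambda>i. 0 + (- 1) * q i) \<partial>box g) = (\<integral>\<^sup>+q. twist a b c d p q \<partial>box g)" for p
    by (intro nn_integral_box_affine twist_local twist_periodic measurable_twist) auto
  moreover have "twist a b c d p (\<lambda>i. 0 + (- 1) * q i) = twist a (- b) c (- d) p q" for p q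
    by (simp add: twist_def)
  ultimately show ?thesis by (simp add: twint_def)
qed

text \<open>Euclid's algorithm on the first row, each step being a shear or a swap.\<close>

lemma twint_det_one:
  assumes "a * d - b * c = 1 \<or> a * d - b * c = -1"
  shows "twint a b c d = twint 1 0 0 1"
  using assms
proof (induction "nat \<bar>b\<bar>" arbitrary: a b c d rule: less_induct)
  case less
  show ?case
  proof (cases "b = 0")
    case True
    with less.prems have ad: "a * d = 1 \<or> a * d = -1" by simp
    then have "a = 1 \<or> a = -1" "d = 1 \<or> d = -1"
      by (auto simp: zmult_eq_1_iff) (metis zmult_eq_1_iff minus_mult_left minus_equation_iff mult.commute)+
    moreover have "twint a 0 c d = twint a 0 (c + (- c * d) * d) d"
      using twint_shear[of a "- c * d" 0 c d] by simp
    moreover have "d * d = 1" using calculation(2) by auto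
    ultimately have "twint a b c d = twint a 0 0 d"
      using True by (simp add: mult.assoc)
    also have "\<dots> = twint a 0 0 1"
      using \<open>d = 1 \<or> d = -1\<close> twint_neg[of a 0 0 1] by auto
    also have "\<dots> = twint 1 0 0 1"
      using \<open>a = 1 \<or> a = -1\<close> twint_swap[of 0 a 1 0] twint_swap[of 0 1 1 0] twint_neg[of 0 1 1 0] by auto
    finally show ?thesis .
  next
    case False
    define j where "j = - (a div b)"
    have a: "a + j * b = a mod b" by (simp add: j_def minus_div_mult_eq_mod[symmetric])
    have "twint a b c d = twint b (a + j * b) d (c + j * d)"
      using twint_shear[of a j b c d] twint_swap[of b "a + j * b" d "c + j * d"] by simp
    also have "\<dots> = twint 1 0 0 1"
    proof (rule less.hyps)
      show "nat \<bar>a + j * b\<bar> < nat \<bar>b\<bar>"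
        unfolding a using False by (simp add: abs_mod_less)
      show "b * (c + j * d) - (a + j * b) * d = 1 \<or> b * (c + j * d) - (a + j * b) * d = - 1"
        using less.prems by (auto simp: algebra_simps)
    qed
    finally show ?thesis .
  qed
qed

lemma nn_integral_torus_SL2:
  fixes a b c d :: int
  assumes "a * d - b * c = 1"
  shows "(\<integral>\<^sup>+p. (\<integral>\<^sup>+q. G (\<lambda>i. a * p i + b * q i) (\<lambda>i. c * p i + d * q i) \<partial>box g) \<partial>box g) =
    (\<integral>\<^sup>+p. (\<integral>\<^sup>+q. G p q \<partial>box g) \<partial>box g)"
  using twint_det_one[of a d b c] assms by (simp add: twint_def twist_def)

end

section \<open>Characters of the torus and Gaussian integrals\<close>

lemma integral_character_box:
  assumes N: "\<And>i. i < g \<Longrightarrow> N i \<in> \<int>" and nz: "\<exists>i<g. N i \<noteq> 0"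
  shows "(\<integral>x. e2pi (of_real (\<Sum>i<g. N i * x i)) \<partial>box g) = 0"
proof -
  have one: "(\<integral>x. indicator {0..<1} x *\<^sub>R e2pi (of_real (k * x)) \<partial>lborel) = 0"
    if k: "k \<in> \<int>" "k \<noteq> 0" for k :: real
  proof -
    define F where "F x = exp (2 * complex_of_real pi * \<i> * of_real k * of_real x) / (2 * complex_of_real pi * \<i> * of_real k)" for x :: real
    \<comment> \<open>Closing the interval changes only a null set and permits the fundamental
      theorem of calculus. The antiderivative has equal values at 0 and 1 because \<open>k\<close>
      is an integer.\<close>
    have "(\<integral>x. indicator {0..<1} x *\<^sub>R e2pi (of_real (k * x)) \<partial>lborel) =
      (\<integral>x. indicator {0..1} x *\<^sub>R e2pi (of_real (k * x)) \<partial>lborel)"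
      using AE_lborel_singleton[of 1]
      by (intro integral_cong_AE) (auto simp: indicator_def e2pi_def elim!: eventually_mono)
    also have "\<dots> = F 1 - F 0"
    proof (rule integral_FTC_Icc)
      show "continuous_on {0..1} (\<lambda>x. e2pi (of_real (k * x)))"
        unfolding e2pi_def by (intro continuous_intros)
      show "(F has_vector_derivative e2pi (of_real (k * x))) (at x within {0..1})" for x
        unfolding F_def e2pi_def using k
        by (auto intro!: derivative_eq_intros has_vector_derivative_real_field simp: field_simps)
    qed auto
    also have "\<dots> = 0"
    proof -
      obtain m :: int where "k = of_int m" using k by (auto elim: Ints_cases)
      then have "exp (2 * complex_of_real pi * \<i> * of_real k) = 1"
        by (simp add: exp_integer_2pi mult_ac)
      then show ?thesis by (simp add: F_def)
    qed
    finally show ?thesis .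
  qed
  have int: "integrable lborel (\<lambda>x. indicator {0..<1::real} x *\<^sub>R e2pi (of_real (k * x)))" for k :: real
  proof (rule Bochner_Integration.integrable_bound[where f = "indicator {0..<1::real} :: real \<Rightarrow> real"])
    show "(\<lambda>x. indicator {0..<1::real} x *\<^sub>R e2pi (of_real (k * x))) \<in> borel_measurable lborel"
      unfolding e2pi_def
      by (intro borel_measurable_scaleR borel_measurable_indicator measurable_lborel2 borel_measurable_continuous_onI continuous_intros) auto
  qed (auto simp: e2pi_def norm_exp_eq_Re indicator_def)
  have "(\<integral>x. e2pi (of_real (\<Sum>i<g. N i * x i)) \<partial>box g) =
    (\<integral>x. indicator (cube g) x *\<^sub>R e2pi (of_real (\<Sum>i<g. N i * x i)) \<partial>Leb g)"
  proof -
    have "(\<lambda>x. indicator (cube g) x :: real) \<in> borel_measurable (Leb g)"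
      unfolding indicator_cube_prod[where 'a = real]
      by (intro borel_measurable_prod measurable_compose[OF measurable_component_Leb]) auto
    moreover have "(\<lambda>x. e2pi (of_real (\<Sum>i<g. N i * x i))) \<in> borel_measurable (Leb g)"
      unfolding e2pi_def by measurable
    ultimately show ?thesis
      unfolding box_def using integral_density[of _ "Leb g" "\<lambda>x. indicator (cube g) x :: real"]
      by (simp add: ennreal_indicator)
  qed
  also have "\<dots> = (\<integral>x. (\<Prod>i<g. indicator {0..<1::real} (x i) *\<^sub>R e2pi (of_real (N i * x i)))
      \<partial>PiM {..<g} (\<lambda>_. lborel))"
    unfolding Leb_def
    by (intro Bochner_Integration.integral_cong refl)
      (simp add: indicator_cube_prod[where 'a = real] e2pi_def exp_sum sum_distrib_left scaleR_conv_of_real prod.distrib)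
  also have "\<dots> = (\<Prod>i<g. \<integral>x. indicator {0..<1} x *\<^sub>R e2pi (of_real (N i * x)) \<partial>lborel)"
    by (intro lborel_product.product_integral_prod finite_lessThan int)
  also have "\<dots> = 0"
    using nz one N by (auto intro!: prod_zero)
  finally show ?thesis .
qed

lemma gaussian_lborel_finite:
  assumes "t > 0"
  shows "(\<integral>\<^sup>+x. ennreal (exp (- t * x\<^sup>2)) \<partial>lborel) < \<infinity>"
proof -
  define s where "s = sqrt (1 / (2 * t))"
  have "s > 0" using assms by (simp add: s_def)
  have s: "s\<^sup>2 = 1 / (2 * t)" using assms by (simp add: s_def)
  have "(\<lambda>x. exp (- t * x\<^sup>2)) = (\<lambda>x. sqrt (2 * pi * s\<^sup>2) * normal_density 0 s x)"
    using assms by (auto simp: normal_density_def s field_simps real_sqrt_mult real_sqrt_divide)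
  then have "integrable lborel (\<lambda>x. exp (- t * x\<^sup>2))"
    using integrable_normal_density[OF \<open>s > 0\<close>, of 0] by simp
  then show ?thesis
    by (simp add: integrable_iff_bounded)
qed

lemma gaussian_Leb_finite:
  assumes "t > 0"
  shows "(\<integral>\<^sup>+x. ennreal (exp (- t * (\<Sum>i<g. (x i)\<^sup>2))) \<partial>Leb g) < \<infinity>"
proof -
  have "(\<integral>\<^sup>+x. ennreal (exp (- t * (\<Sum>i<g. (x i)\<^sup>2))) \<partial>Leb g) =
    (\<integral>\<^sup>+x. (\<Prod>i<g. ennreal (exp (- t * (x i)\<^sup>2))) \<partial>PiM {..<g} (\<lambda>_. lborel))"
    unfolding Leb_def by (intro nn_integral_cong) (simp add: prod_ennreal exp_sum[symmetric] sum_negf sum_distrib_left)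
  also have "\<dots> = (\<Prod>i<g. \<integral>\<^sup>+x. ennreal (exp (- t * x\<^sup>2)) \<partial>lborel)"
    by (rule lborel_product.product_nn_integral_prod) auto
  also have "\<dots> < \<infinity>"
    using gaussian_lborel_finite[OF assms] by (simp add: power_less_top_ennreal)
  finally show ?thesis .
qed

section \<open>Choice of the real part\<close>

text \<open>With w = s^(-1/2) the inequality ln w <= w - 1 bounds the left side by the negative
  square -(w - 1)^2, for all s > 0 and not merely near 1.\<close>

lemma log_bound_away_from_one:
  fixes s \<delta> :: real
  assumes s: "s > 0" and \<delta>: "0 < \<delta>" "\<delta> \<le> 1" and far: "\<delta> \<le> \<bar>s - 1\<bar>"
  shows "1 - 1 / s - ln s \<le> - (\<delta>\<^sup>2 / 36)"
proof -
  define w where "w = 1 / sqrt s"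
  have w: "w > 0" using s by (simp add: w_def)
  have s_w: "s = 1 / w\<^sup>2" using s by (simp add: w_def power_divide)
  have "ln s = - 2 * ln w" using w by (simp add: s_w ln_div ln_realpow)
  moreover have "ln w \<le> w - 1" using w by (rule ln_le_minus_one)
  moreover have "1 / s = w\<^sup>2" by (simp add: s_w)
  ultimately have "1 - 1 / s - ln s \<le> 1 - w\<^sup>2 + 2 * (w - 1)" by simp
  also have "\<dots> = - ((w - 1)\<^sup>2)" by (simp add: power2_eq_square algebra_simps)
  finally have *: "1 - 1 / s - ln s \<le> - ((w - 1)\<^sup>2)" .
  \<comment> \<open>If |w - 1| < \<delta>/6 <= 1/6, then |s - 1| <= 3.12 |w - 1| < \<delta>; the
    factor 3.12 is (13/6) / (25/36).\<close>
  have "\<delta> / 6 \<le> \<bar>w - 1\<bar>"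
  proof (rule ccontr)
    assume "\<not> ?thesis"
    then have d: "\<bar>w - 1\<bar> < \<delta> / 6" by simp
    then have w1: "5 / 6 \<le> w" "w \<le> 7 / 6" using \<delta> by linarith+
    have "\<bar>s - 1\<bar> = \<bar>w - 1\<bar> * (w + 1) / w\<^sup>2"
    proof -
      have "s - 1 = - ((w - 1) * (w + 1) / w\<^sup>2)" using w by (simp add: s_w field_simps power2_eq_square)
      then have "\<bar>s - 1\<bar> = \<bar>(w - 1) * (w + 1) / w\<^sup>2\<bar>" by simp
      also have "\<dots> = \<bar>w - 1\<bar> * (w + 1) / w\<^sup>2" using w by (simp add: abs_mult)
      finally show ?thesis .
    qed
    also have "\<dots> \<le> \<bar>w - 1\<bar> * (13 / 6) / (25 / 36)"
    proof (intro frac_le mult_left_mono)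
      show "25 / 36 \<le> w\<^sup>2" using power_mono[OF w1(1), of 2] by (simp add: power2_eq_square)
    qed (use w1 in auto)
    also have "\<dots> < \<delta>" using d \<delta> by simp
    finally show False using far by simp
  qed
  then have "(\<delta> / 6)\<^sup>2 \<le> (w - 1)\<^sup>2"
    using \<delta> by (metis abs_le_square_iff abs_of_pos divide_pos_pos zero_less_numeral)
  then show ?thesis using * by (simp add: power_divide)
qed

text \<open>For a row with |c\<tau> + d|^2 = s this is its Cauchy-Schwarz bound divided by the
  squared norm of \<Theta>. It equals 1 at s = 1.\<close>

definition weight :: "real \<Rightarrow> real \<Rightarrow> real" where
  "weight \<nu> s = s powr (- (\<nu> + 1) / 2) * exp (\<nu> / 2 * (1 - 1 / s))"

text \<open>Splits 4 off from \<nu>: the part \<nu> - 4 pays for the decay away from s = 1, and what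
  is left suffices to extract 1/s^2, which makes the sum over the rows converge.\<close>

lemma weight_bound:
  assumes s: "s > 0" and \<delta>: "0 < \<delta>" "\<delta> \<le> 1" and far: "\<delta> \<le> \<bar>s - 1\<bar>" and \<nu>: "\<nu> \<ge> 4"
  shows "weight \<nu> s \<le> exp 2 * exp (- (\<nu> - 4) * \<delta>\<^sup>2 / 72) / s\<^sup>2"
proof -
  have "weight \<nu> s * s\<^sup>2 = exp (- (\<nu> + 1) / 2 * ln s + \<nu> / 2 * (1 - 1 / s) + 2 * ln s)"
  proof -
    have "s\<^sup>2 = exp (2 * ln s)" using s by (simp add: exp_double)
    then show ?thesis using s by (simp only: weight_def powr_def exp_add) simp
  qed
  also have "\<dots> \<le> exp (2 + - (\<nu> - 4) * \<delta>\<^sup>2 / 72)"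
  proof -
    define l where "l = ln s"
    define r where "r = 1 / s"
    have "(\<nu> - 4) / 2 * (1 - r - l) \<le> (\<nu> - 4) / 2 * (- (\<delta>\<^sup>2 / 36))"
      unfolding l_def r_def using log_bound_away_from_one[OF s \<delta> far] \<nu> by (intro mult_left_mono) auto
    then have P: "(\<nu> - 4) / 2 * (1 - r - l) \<le> - (\<nu> - 4) * \<delta>\<^sup>2 / 72" by (simp add: field_simps)
    have l: "- l \<le> r - 1"
      using ln_le_minus_one[of "1 / s"] s by (simp add: ln_div l_def r_def)
    have r: "r > 0" using s by (simp add: r_def)
    have "- (\<nu> + 1) / 2 * l + \<nu> / 2 * (1 - r) + 2 * l =
      (\<nu> - 4) / 2 * (1 - r - l) + (2 - 2 * r + (- l) / 2)"
      by (simp add: field_simps)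
    also have "\<dots> \<le> - (\<nu> - 4) * \<delta>\<^sup>2 / 72 + 2"
      using l r by (intro add_mono P) linarith
    finally have "- (\<nu> + 1) / 2 * ln s + \<nu> / 2 * (1 - 1 / s) + 2 * ln s \<le> 2 + - (\<nu> - 4) * \<delta>\<^sup>2 / 72"
      unfolding l_def r_def by (simp add: add.commute)
    then show ?thesis by simp
  qed
  finally show ?thesis using s by (simp only: exp_add) (simp add: pos_le_divide_eq)
qed

section \<open>Sums over rows and the exclusion of bad real parts\<close>

lemma nn_integral_count_space_int_finite: "(\<integral>\<^sup>+d. ennreal (1 / (1 + (of_int d)\<^sup>2)) \<partial>count_space (UNIV :: int set)) < \<infinity>"
proof -
  let ?f = "\<lambda>d::int. ennreal (1 / (1 + (of_int d)\<^sup>2))"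
  have nat: "(\<integral>\<^sup>+n. ?f (int n) \<partial>count_space UNIV) < \<infinity>"
  proof -
    have "summable (\<lambda>n. 1 / (1 + (real n)\<^sup>2))"
    proof (rule summable_comparison_test')
      show "summable (\<lambda>n. 1 / real n ^ 2)" by (rule inverse_power_summable[of 2, simplified inverse_eq_divide]) simp
      show "norm (1 / (1 + (real n)\<^sup>2)) \<le> 1 / real n ^ 2" if "n \<ge> 1" for n
        using that by (auto intro!: frac_le)
    qed
    then have "(\<Sum>n. ennreal (1 / (1 + (real n)\<^sup>2))) \<noteq> \<infinity>"
      using ennreal_suminf_neq_top by auto
    then show ?thesis by (simp add: nn_integral_count_space_nat top.not_eq_extremum)
  qed
  have "(\<integral>\<^sup>+d. ?f d \<partial>count_space UNIV) \<le> (\<integral>\<^sup>+d. ?f d * indicator (range int) d + ?f d * indicator (uminus ` range int) d \<partial>count_space UNIV)"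
  proof (intro nn_integral_mono)
    fix d :: int
    have "d \<in> range int \<or> d \<in> uminus ` range int"
      by (metis add.inverse_inverse image_eqI int_cases2 rangeI)
    then show "?f d \<le> ?f d * indicator (range int) d + ?f d * indicator (uminus ` range int) d"
      by (auto simp: indicator_def)
  qed
  also have "\<dots> = (\<integral>\<^sup>+d. ?f d \<partial>count_space (range int)) + (\<integral>\<^sup>+d. ?f d \<partial>count_space (uminus ` range int))"
    by (subst nn_integral_add) (auto simp: nn_integral_count_space_indicator)
  also have "(\<integral>\<^sup>+d. ?f d \<partial>count_space (range int)) = (\<integral>\<^sup>+n. ?f (int n) \<partial>count_space UNIV)"
    by (rule nn_integral_bij_count_space[symmetric]) (auto simp: bij_betw_def inj_def)
  also have "(\<integral>\<^sup>+d. ?f d \<partial>count_space (uminus ` range int)) = (\<integral>\<^sup>+n. ?f (- int n) \<partial>count_space UNIV)"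
    by (rule nn_integral_bij_count_space[symmetric]) (auto simp: bij_betw_def inj_def image_image)
  finally show ?thesis by (rule le_less_trans) (use nat in simp)
qed

abbreviation nonzero_row :: "(int \<times> int) set" where
  "nonzero_row \<equiv> {(c, d). c \<noteq> 0}"

text \<open>With \<tau> = u + iv the value at the row \<open>(c, d)\<close> is |c\<tau> +
  d|^2.\<close>

definition height_sq :: "real \<Rightarrow> real \<Rightarrow> int \<times> int \<Rightarrow> real" where
  "height_sq u v = (\<lambda>(c, d). (of_int c * v)\<^sup>2 + (of_int c * u + of_int d)\<^sup>2)"

text \<open>Once \<open>d\<close> is shifted by the integer part of \<open>c u\<close>, the square
  of the height dominates a multiple of v^4 (1 + c^2) (1 + d^2), whose reciprocal can be summed in
  each variable separately. The shift permutes the integers, hence the uniformity in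
  \<open>u\<close>.\<close>

lemma sum_height_sq_bound:
  "\<exists>C\<ge>0. \<forall>u v. 0 < v \<longrightarrow> v \<le> 1 \<longrightarrow>
    (\<integral>\<^sup>+x. ennreal (1 / (height_sq u v x)\<^sup>2) \<partial>count_space nonzero_row) \<le> ennreal (C / v ^ 4)"
proof -
  define S where "S = (\<integral>\<^sup>+d. ennreal (1 / (1 + (of_int d)\<^sup>2)) \<partial>count_space (UNIV :: int set))"
  have S: "S < \<infinity>" unfolding S_def by (rule nn_integral_count_space_int_finite)
  have "(\<integral>\<^sup>+x. ennreal (1 / (height_sq u v x)\<^sup>2) \<partial>count_space nonzero_row) \<le> ennreal (6 * (enn2real S)\<^sup>2 / v ^ 4)"
    if v: "0 < v" "v \<le> 1" for u v :: real
  proof -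
    \<comment> \<open>6 = 2 * 3 comes from 1 + c^2 <= 2 c^2 and 1 + k^2 <= 3 (1 + x^2), with x = c u
      + d and \<open>k\<close> the shifted \<open>d\<close>.\<close>
    define b where "b c d = ennreal (6 / v ^ 4) * (ennreal (1 / (1 + (of_int c)\<^sup>2)) *
      ennreal (1 / (1 + (of_int (d + \<lfloor>of_int c * u\<rfloor>))\<^sup>2)))" for c d :: int
    have pw: "ennreal (1 / (height_sq u v (c, d))\<^sup>2) \<le> b c d" if "c \<noteq> 0" for c d
    proof -
      define x where "x = of_int c * u + of_int d"
      define k where "k = real_of_int (d + \<lfloor>of_int c * u\<rfloor>)"
      have c1: "1 \<le> (real_of_int c)\<^sup>2"
        using that by (metis abs_le_square_iff abs_1 of_int_1_le_iff of_int_abs one_power2 power2_abs zero_less_abs_iff int_one_le_iff_zero_less)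
      have "k\<^sup>2 \<le> 2 * x\<^sup>2 + 2"
      proof -
        have "0 \<le> x - k" "x - k \<le> 1"
          unfolding x_def k_def by linarith+
        then have "(x - k)\<^sup>2 \<le> 1" by (simp add: power_le_one)
        moreover have "2 * x\<^sup>2 + 2 * (x - k)\<^sup>2 - k\<^sup>2 = (2 * x - k)\<^sup>2" by (simp add: power2_eq_square algebra_simps)
        then have "0 \<le> 2 * x\<^sup>2 + 2 * (x - k)\<^sup>2 - k\<^sup>2" by simp
        ultimately show ?thesis by linarith
      qed
      then have k: "1 + k\<^sup>2 \<le> 3 * (1 + x\<^sup>2)"
        by (smt (verit) zero_le_power2)
      have "v\<^sup>2 * ((real_of_int c)\<^sup>2 + x\<^sup>2) \<le> height_sq u v (c, d)"
      proof -
        have "v\<^sup>2 * x\<^sup>2 \<le> 1 * x\<^sup>2" using v by (intro mult_right_mono) (auto simp: power_le_one)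
        then show ?thesis by (simp add: height_sq_def x_def power_mult_distrib algebra_simps)
      qed
      then have "(v\<^sup>2 * ((real_of_int c)\<^sup>2 + x\<^sup>2))\<^sup>2 \<le> (height_sq u v (c, d))\<^sup>2"
        by (intro power_mono) auto
      moreover have "v ^ 4 * ((1 + (real_of_int c)\<^sup>2) * (1 + k\<^sup>2)) \<le> 6 * (v\<^sup>2 * ((real_of_int c)\<^sup>2 + x\<^sup>2))\<^sup>2"
      proof -
        have "(1 + (real_of_int c)\<^sup>2) * (1 + k\<^sup>2) \<le> (2 * (real_of_int c)\<^sup>2) * (3 * (1 + x\<^sup>2))"
          using k c1 by (intro mult_mono) auto
        also have "\<dots> \<le> 6 * (((real_of_int c)\<^sup>2 + x\<^sup>2) * ((real_of_int c)\<^sup>2 + x\<^sup>2))"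
          using mult_mono[of "(real_of_int c)\<^sup>2" "(real_of_int c)\<^sup>2 + x\<^sup>2" "1 + x\<^sup>2" "(real_of_int c)\<^sup>2 + x\<^sup>2"] c1
          by (simp add: algebra_simps)
        finally have "(1 + (real_of_int c)\<^sup>2) * (1 + k\<^sup>2) \<le> 6 * ((real_of_int c)\<^sup>2 + x\<^sup>2)\<^sup>2" by (simp add: power2_eq_square)
        then have "v ^ 4 * ((1 + (real_of_int c)\<^sup>2) * (1 + k\<^sup>2)) \<le> v ^ 4 * (6 * ((real_of_int c)\<^sup>2 + x\<^sup>2)\<^sup>2)"
          by (rule mult_left_mono) simp
        then show ?thesis by (simp add: power_mult_distrib mult_ac flip: power_mult)
      qed
      ultimately have *: "v ^ 4 * ((1 + (real_of_int c)\<^sup>2) * (1 + k\<^sup>2)) \<le> 6 * (height_sq u v (c, d))\<^sup>2" by linarith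
      have "0 < v ^ 4 * ((1 + (real_of_int c)\<^sup>2) * (1 + k\<^sup>2))"
        using v by (intro mult_pos_pos) (auto intro: add_pos_nonneg)
      have inv: "1 / A \<le> 6 / B" if "0 < B" "B \<le> 6 * A" for A B :: real
      proof -
        have "0 < A" using that by linarith
        then show ?thesis using that by (simp add: divide_simps)
      qed
      have "1 / (height_sq u v (c, d))\<^sup>2 \<le> 6 / (v ^ 4 * ((1 + (real_of_int c)\<^sup>2) * (1 + k\<^sup>2)))"
        by (rule inv) fact+
      moreover have "b c d = ennreal (6 / v ^ 4 * (1 / (1 + (of_int c)\<^sup>2) * (1 / (1 + k\<^sup>2))))"
        unfolding b_def k_def using v by (subst ennreal_mult, (simp; fail), (simp; fail))+ simp
      ultimately show ?thesis by (simp add: ennreal_leI)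
    qed
    have "(\<integral>\<^sup>+x. ennreal (1 / (height_sq u v x)\<^sup>2) \<partial>count_space nonzero_row)
      \<le> (\<integral>\<^sup>+x. (\<lambda>(c, d). b c d) x \<partial>count_space nonzero_row)"
      by (intro nn_integral_mono) (auto intro: pw)
    also have "\<dots> \<le> (\<integral>\<^sup>+x. (\<lambda>(c, d). b c d) x \<partial>count_space UNIV)"
      by (subst nn_integral_count_space_indicator) (auto intro!: nn_integral_mono simp: indicator_def)
    also have "\<dots> = (\<integral>\<^sup>+c. (\<integral>\<^sup>+d. b c d \<partial>count_space UNIV) \<partial>count_space UNIV)"
      by (subst nn_integral_fst_count_space[symmetric]) simp
    also have "\<dots> = (\<integral>\<^sup>+c. ennreal (6 / v ^ 4) * (ennreal (1 / (1 + (of_int c)\<^sup>2)) * S) \<partial>count_space (UNIV :: int set))"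
    proof (rule nn_integral_cong)
      fix c :: int
      have "(\<integral>\<^sup>+d. ennreal (1 / (1 + (of_int (d + \<lfloor>of_int c * u\<rfloor>))\<^sup>2)) \<partial>count_space UNIV) = S"
        unfolding S_def by (rule nn_integral_bij_count_space)
          (auto intro!: bij_betw_byWitness[where f' = "\<lambda>d. d - \<lfloor>of_int c * u\<rfloor>"])
      then show "(\<integral>\<^sup>+d. b c d \<partial>count_space UNIV) = ennreal (6 / v ^ 4) * (ennreal (1 / (1 + (of_int c)\<^sup>2)) * S)"
        unfolding b_def by (simp add: nn_integral_cmult)
    qed
    also have "\<dots> = ennreal (6 / v ^ 4) * (S * S)"
      by (simp add: nn_integral_cmult nn_integral_multc flip: S_def)
    also have "\<dots> = ennreal (6 * (enn2real S)\<^sup>2 / v ^ 4)"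
    proof -
      obtain r where "S = ennreal r" "r \<ge> 0" using S by (cases S) auto
      then show ?thesis using v by (simp add: ennreal_mult'[symmetric] power2_eq_square)
    qed
    finally show ?thesis .
  qed
  then show ?thesis by (intro exI[of _ "6 * (enn2real S)\<^sup>2"]) auto
qed

text \<open>Bounds the length of the range of w >= 0 with |w^2 - a| <= e. The order sqrt e is forced
  near a = 0, where the square root is not Lipschitz; there the ends are cut off at 0.\<close>

lemma sqrt_diff_le:
  assumes "0 \<le> (e::real)"
  shows "sqrt (max 0 (a + e)) - sqrt (max 0 (a - e)) \<le> sqrt (2 * e)"
proof -
  define x y where "x = sqrt (max 0 (a + e))" and "y = sqrt (max 0 (a - e))"
  have xy: "0 \<le> y" "y \<le> x" using assms by (auto simp: x_def y_def)
  have "(x - y)\<^sup>2 \<le> x\<^sup>2 - y\<^sup>2"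
  proof -
    have "x\<^sup>2 - y\<^sup>2 - (x - y)\<^sup>2 = 2 * y * (x - y)" by (simp add: power2_eq_square algebra_simps)
    moreover have "0 \<le> 2 * y * (x - y)" using xy by simp
    ultimately show ?thesis by linarith
  qed
  also have "\<dots> = max 0 (a + e) - max 0 (a - e)" by (simp add: x_def y_def)
  also have "\<dots> \<le> 2 * e" using assms by auto
  finally have "(x - y)\<^sup>2 \<le> 2 * e" .
  then have "x - y \<le> sqrt (2 * e)" by (rule real_le_rsqrt)
  then show ?thesis by (simp add: x_def y_def)
qed

text \<open>The bad points \<open>u\<close> for a fixed row \<open>(c, d)\<close> form two intervals of length at most
  \<open>sqrt (2\<delta>) / c\<close>, and only \<open>c + 3\<close> values of \<open>d\<close> matter for \<open>u \<in> [0, 1]\<close>.\<close>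

lemma exists_good_real_part:
  assumes v: "0 < v" "v \<le> 1" and e: "0 < (e::real)" "e \<le> 1" and small: "46 * sqrt e / v < 1"
  shows "\<exists>u::real. \<forall>x \<in> nonzero_row. e \<le> \<bar>height_sq u v x - 1\<bar>"
proof (rule ccontr)
  assume neg: "\<not> ?thesis"
  define a where "a c = 1 - (real_of_int c * v)\<^sup>2" for c :: int
  define lo where "lo c = sqrt (max 0 (a c - e))" for c
  define hi where "hi c = sqrt (max 0 (a c + e))" for c
  define T where "T = (\<lambda>(c :: int, d :: int, pos :: bool).
    if pos then {(lo c - d) / c .. (hi c - d) / c} else {(- hi c - d) / c .. (- lo c - d) / c})"
  \<comment> \<open>In a bad row the squares of c v and c u + d add up to less than 1 + e <= 2, so
    both are below 4. This gives c < 2/v, and |c u + d| < 2 with 0 <= u <= 1 gives the range of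
    \<open>d\<close> in \<open>I\<close>. The Boolean component records the sign of c u + d.\<close>
  define N where "N = \<lfloor>2 / v\<rfloor>"
  define I where "I = (SIGMA c:{1..N}. {- c - 1..1} \<times> (UNIV :: bool set))"
  have lohi: "0 \<le> lo c" "lo c \<le> hi c" "hi c - lo c \<le> sqrt (2 * e)" for c
    using sqrt_diff_le[of e "a c"] e by (auto simp: lo_def hi_def)
  have cover: "{0..1} \<subseteq> (\<Union>i\<in>I. T i)"
  proof
    fix u :: real assume u: "u \<in> {0..1}"
    from neg obtain x where x: "x \<in> nonzero_row" "\<not> e \<le> \<bar>height_sq u v x - 1\<bar>" by blast
    obtain c0 d0 where "x = (c0, d0)" by (cases x)
    with x have cd0: "c0 \<noteq> 0" "\<bar>height_sq u v (c0, d0) - 1\<bar> < e" by auto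
    \<comment> \<open>The rows \<open>(c, d)\<close> and \<open>(-c, -d)\<close> have the same
      height, so \<open>c\<close> may be taken positive.\<close>
    obtain c d where c: "c > 0" and cd: "\<bar>height_sq u v (c, d) - 1\<bar> < e"
    proof (cases "c0 > 0")
      case True with cd0 that show ?thesis by blast
    next
      case False
      have "height_sq u v (- c0, - d0) = height_sq u v (c0, d0)"
        by (simp add: height_sq_def power2_eq_square algebra_simps)
      with False cd0 that[of "- c0" "- d0"] show ?thesis by simp
    qed
    define w where "w = real_of_int c * u + d"
    have w2: "\<bar>w\<^sup>2 - a c\<bar> < e"
      using cd by (simp add: height_sq_def w_def a_def algebra_simps)
    have lw: "lo c \<le> \<bar>w\<bar>" "\<bar>w\<bar> \<le> hi c"
      using w2 by (auto simp: lo_def hi_def intro!: real_le_lsqrt real_le_rsqrt)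
    have lt4: "A < 2\<^sup>2 \<and> B < 2\<^sup>2" if "\<bar>A - (1 - B)\<bar> < e" "0 \<le> A" "0 \<le> B" for A B :: real
      using that e by (simp add: abs_less_iff)
    note lt4 = lt4[OF w2[unfolded a_def] zero_le_power2 zero_le_power2]
    have "(real_of_int c * v)\<^sup>2 < 2\<^sup>2" using lt4 by blast
    then have "real_of_int c * v < 2" by (rule power2_less_imp_less) simp
    then have "real_of_int c \<le> 2 / v" using v by (simp add: field_simps)
    then have cN: "c \<le> N" by (simp add: N_def le_floor_iff)
    have "w\<^sup>2 < 2\<^sup>2" using lt4 by blast
    then have "\<bar>w\<bar>\<^sup>2 < 2\<^sup>2" by (simp only: power2_abs)
    then have "\<bar>w\<bar> < 2" by (rule power2_less_imp_less) simp
    then have "- 2 < w" "w < 2" by auto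
    moreover have "0 \<le> real_of_int c * u" "real_of_int c * u \<le> real_of_int c"
      using u c by (auto simp: mult_left_le)
    ultimately have "- c - 2 < d" "d < 2" unfolding w_def by linarith+
    then have "(c, d, w \<ge> 0) \<in> I" using c cN by (auto simp: I_def)
    moreover have "u \<in> T (c, d, w \<ge> 0)"
    proof (cases "w \<ge> 0")
      case True
      then have "lo c \<le> real_of_int c * u + d" "real_of_int c * u + d \<le> hi c"
        using lw by (simp_all add: w_def)
      then show ?thesis using True c
        by (simp add: T_def pos_divide_le_eq pos_le_divide_eq mult.commute)
    next
      case False
      then have "lo c \<le> - (real_of_int c * u + d)" "- (real_of_int c * u + d) \<le> hi c"
        using lw by (simp_all add: w_def)
      then show ?thesis using False c
        by (simp add: T_def pos_divide_le_eq pos_le_divide_eq mult.commute)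
    qed
    ultimately show "u \<in> (\<Union>i\<in>I. T i)" by blast
  qed
  have finI: "finite I" by (auto simp: I_def)
  have T_meas: "T i \<in> sets lborel" for i by (auto simp: T_def split: prod.split)
  have len: "emeasure lborel (T i) \<le> ennreal (sqrt (2 * e) / fst i)" if "i \<in> I" for i
  proof -
    obtain c d p where i: "i = (c, d, p)" by (cases i)
    then have c: "c \<ge> 1" using that by (simp add: I_def)
    have "emeasure lborel (T i) = ennreal ((hi c - lo c) / c)"
      using lohi[of c] c unfolding i T_def
      by (auto simp: emeasure_lborel_Icc_eq divide_right_mono diff_divide_distrib intro!: arg_cong[where f = ennreal])
    also have "\<dots> \<le> ennreal (sqrt (2 * e) / c)"
      using lohi[of c] c by (intro ennreal_leI divide_right_mono) auto
    finally show ?thesis by (simp add: i)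
  qed
  have "1 = emeasure lborel {0..1::real}" by simp
  also have "\<dots> \<le> emeasure lborel (\<Union>i\<in>I. T i)"
    by (rule emeasure_mono[OF cover]) (use finI T_meas in auto)
  also have "\<dots> \<le> (\<Sum>i\<in>I. emeasure lborel (T i))"
    using finI T_meas by (intro emeasure_subadditive_finite) auto
  also have "\<dots> \<le> (\<Sum>i\<in>I. ennreal (sqrt (2 * e) / fst i))"
    by (intro sum_mono len)
  also have "\<dots> = ennreal (\<Sum>i\<in>I. sqrt (2 * e) / fst i)"
    using e by (intro sum_ennreal) (auto simp: I_def)
  finally have "1 \<le> (\<Sum>i\<in>I. sqrt (2 * e) / fst i)" 
    by (simp add: ennreal_le_iff2 flip: ennreal_1)
  also have "\<dots> = (\<Sum>c\<in>{1..N}. \<Sum>x\<in>{- c - 1..1} \<times> (UNIV :: bool set). sqrt (2 * e) / c)"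
    unfolding I_def by (subst sum.Sigma) (auto simp: case_prod_unfold)
  also have "\<dots> = (\<Sum>c\<in>{1..N}. 2 * (c + 3) * (sqrt (2 * e) / c))"
    by (intro sum.cong) (auto simp: card_cartesian_product)
  \<comment> \<open>2 (c + 3) <= 8 c because c >= 1. The number of intervals grows like c, which
    cancels their length of order 1/c.\<close>
  also have "\<dots> \<le> (\<Sum>c\<in>{1..N}. 8 * sqrt (2 * e))"
  proof (rule sum_mono)
    fix c assume c: "c \<in> {1..N}"
    then have "2 * (real_of_int c + 3) * sqrt (2 * e) \<le> (8 * real_of_int c) * sqrt (2 * e)"
      using e by (intro mult_right_mono) auto
    then show "2 * (c + 3) * (sqrt (2 * e) / c) \<le> 8 * sqrt (2 * e)"
      using c by (simp add: field_simps)
  qed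
  also have "\<dots> = nat N * (8 * sqrt (2 * e))" by simp
  also have "\<dots> \<le> 2 / v * (8 * sqrt (2 * e))"
    using v e by (intro mult_right_mono) (auto simp: N_def)
  \<comment> \<open>16 sqrt 2 is about 22.6, so 46 is a generous constant.\<close>
  also have "\<dots> \<le> 46 * sqrt e / v"
  proof -
    have "sqrt 2 \<le> sqrt ((46 / 16)\<^sup>2)" by (simp add: power2_eq_square del: real_sqrt_abs)
    then have "16 * sqrt 2 \<le> 46" by simp
    then have "16 * sqrt 2 * sqrt e \<le> 46 * sqrt e" using e by (intro mult_right_mono) auto
    then show ?thesis using v by (simp add: real_sqrt_mult field_simps)
  qed
  finally show False using small by simp
qed

text \<open>The threshold is chosen before \<open>v\<close>, which later makes it uniform in
  \<open>m\<close>, \<open>n\<close> and \<open>r\<close>. Away from the bad rows every term is at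
  most 1/s^2 times a stretched exponential in \<nu>, and this beats the loss v^(-4), which is of
  order \<nu>^(8/9) at worst.\<close>

lemma eventually_weight_sum_small:
  "\<exists>\<nu>\<^sub>0. \<forall>\<nu> \<ge> \<nu>\<^sub>0. \<forall>v. 0 < v \<longrightarrow> v \<le> 1 \<longrightarrow> 1 / v \<le> 2 * \<nu> powr (2 / 9) \<longrightarrow>
    (\<exists>u. (\<integral>\<^sup>+x. ennreal (weight \<nu> (height_sq u v x)) \<partial>count_space nonzero_row) < 1)"
proof -
  obtain C where C: "C \<ge> 0" "\<And>u v. 0 < v \<Longrightarrow> v \<le> 1 \<Longrightarrow>
    (\<integral>\<^sup>+x. ennreal (1 / (height_sq u v x)\<^sup>2) \<partial>count_space nonzero_row) \<le> ennreal (C / v ^ 4)"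
    using sum_height_sq_bound by blast
  \<comment> \<open>The exponent 12/25 lies between 4/9 and 1/2. Above 4/9, sqrt e * \<nu>^(2/9)
    tends to 0 and the excluded real parts do not fill the unit interval; below 1/2, \<nu> e^2 tends
    to infinity and the exponential bound is effective.\<close>
  define e where "e \<nu> = \<nu> powr (- (12 / 25))" for \<nu> :: real
  have 1: "eventually (\<lambda>\<nu>. 46 * sqrt (e \<nu>) * (2 * \<nu> powr (2 / 9)) < 1) at_top"
    unfolding e_def by real_asymp
  have "((\<lambda>\<nu>. 16 * \<nu> powr (8 / 9) * (exp 2 * exp (- (\<nu> - 4) * (e \<nu>)\<^sup>2 / 72))) \<longlongrightarrow> 0) at_top"
    unfolding e_def by real_asymp
  then have 2: "eventually (\<lambda>\<nu>. 16 * \<nu> powr (8 / 9) * (exp 2 * exp (- (\<nu> - 4) * (e \<nu>)\<^sup>2 / 72)) < 1 / (C + 1)) at_top"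
    using C(1) by (intro order_tendstoD) auto
  from 1 2 eventually_ge_at_top[of "4::real"] have "eventually (\<lambda>\<nu>. \<nu> \<ge> 4 \<and> 46 * sqrt (e \<nu>) * (2 * \<nu> powr (2 / 9)) < 1 \<and>
      16 * \<nu> powr (8 / 9) * (exp 2 * exp (- (\<nu> - 4) * (e \<nu>)\<^sup>2 / 72)) < 1 / (C + 1)) at_top"
    by eventually_elim auto
  then obtain \<nu>\<^sub>0 where \<nu>\<^sub>0: "\<And>\<nu>. \<nu> \<ge> \<nu>\<^sub>0 \<Longrightarrow> \<nu> \<ge> 4 \<and> 46 * sqrt (e \<nu>) * (2 * \<nu> powr (2 / 9)) < 1 \<and>
      16 * \<nu> powr (8 / 9) * (exp 2 * exp (- (\<nu> - 4) * (e \<nu>)\<^sup>2 / 72)) < 1 / (C + 1)"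
    by (auto simp: eventually_at_top_linorder)
  show ?thesis
  proof (rule exI[of _ \<nu>\<^sub>0], intro allI impI)
    fix \<nu> v :: real
    assume \<nu>: "\<nu> \<ge> \<nu>\<^sub>0" and v: "0 < v" "v \<le> 1" and vQ: "1 / v \<le> 2 * \<nu> powr (2 / 9)"
    note \<nu>' = \<nu>\<^sub>0[OF \<nu>]
    have e: "0 < e \<nu>" "e \<nu> \<le> 1"
      using \<nu>' powr_mono[of "- (12 / 25)" 0 \<nu>] by (auto simp: e_def)
    have "46 * sqrt (e \<nu>) / v \<le> 46 * sqrt (e \<nu>) * (2 * \<nu> powr (2 / 9))"
      using mult_left_mono[OF vQ, of "46 * sqrt (e \<nu>)"] e by simp
    with \<nu>' have "46 * sqrt (e \<nu>) / v < 1" by linarith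
    from exists_good_real_part[OF v e this] obtain u
      where u: "\<And>x. x \<in> nonzero_row \<Longrightarrow> e \<nu> \<le> \<bar>height_sq u v x - 1\<bar>" by blast
    define K where "K = exp 2 * exp (- (\<nu> - 4) * (e \<nu>)\<^sup>2 / 72)"
    have "(\<integral>\<^sup>+x. ennreal (weight \<nu> (height_sq u v x)) \<partial>count_space nonzero_row) \<le>
      (\<integral>\<^sup>+x. ennreal K * ennreal (1 / (height_sq u v x)\<^sup>2) \<partial>count_space nonzero_row)"
    proof (rule nn_integral_mono)
      fix x assume x: "x \<in> space (count_space nonzero_row)"
      have "height_sq u v x > 0"
        using x v by (auto simp: height_sq_def intro!: add_pos_nonneg)
      from weight_bound[OF this e u] x \<nu>' have "weight \<nu> (height_sq u v x) \<le> K * (1 / (height_sq u v x)\<^sup>2)"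
        by (simp add: K_def)
      then show "ennreal (weight \<nu> (height_sq u v x)) \<le> ennreal K * ennreal (1 / (height_sq u v x)\<^sup>2)"
        by (simp add: K_def ennreal_leI flip: ennreal_mult)
    qed
    also have "\<dots> \<le> ennreal K * ennreal (C / v ^ 4)"
      using C(2)[OF v] by (simp add: nn_integral_cmult mult_left_mono)
    also have "\<dots> = ennreal (K * (C / v ^ 4))"
      using C(1) v by (intro ennreal_mult[symmetric]) (auto simp: K_def)
    also have "\<dots> < 1"
    proof -
      have "(1 / v) ^ 4 \<le> (2 * \<nu> powr (2 / 9)) ^ 4"
        using v by (intro power_mono vQ) auto
      also have "\<dots> = 16 * \<nu> powr (8 / 9)"
        using \<nu>' by (simp add: power_mult_distrib powr_power)
      finally have "K * (1 / v) ^ 4 \<le> K * (16 * \<nu> powr (8 / 9))"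
        by (intro mult_left_mono) (auto simp: K_def)
      also have "\<dots> < 1 / (C + 1)" using \<nu>' by (simp add: K_def mult_ac)
      finally have "C * (K * (1 / v) ^ 4) \<le> C * (1 / (C + 1))"
        using C(1) by (intro mult_left_mono) auto
      also have "\<dots> < 1" using C(1) by (simp add: field_simps)
      finally show ?thesis by (simp add: power_divide mult_ac ennreal_less_one_iff)
    qed
    finally have "(\<integral>\<^sup>+x. ennreal (weight \<nu> (height_sq u v x)) \<partial>count_space nonzero_row) < 1" .
    then show "\<exists>u. (\<integral>\<^sup>+x. ennreal (weight \<nu> (height_sq u v x)) \<partial>count_space nonzero_row) < 1"
      by blast
  qed
qed

section \<open>Interchanging lattice sums and integrals\<close>

text \<open>Sums are read as integrals over the counting measure, which makes Fubini and the norm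
  inequality for integrals available for them.\<close>

lemma abs_summable_on_nn_integral:
  fixes f :: "'a \<Rightarrow> complex"
  assumes "(\<integral>\<^sup>+x. ennreal (norm (f x)) \<partial>count_space A) < \<infinity>"
  shows "(\<lambda>x. norm (f x)) summable_on A" "ennreal (norm (infsum f A)) \<le> (\<integral>\<^sup>+x. ennreal (norm (f x)) \<partial>count_space A)"
    "infsum f A = (\<integral>x. f x \<partial>count_space A)"
proof -
  have int: "integrable (count_space A) f"
    using assms by (simp add: integrable_iff_bounded)
  then have *: "Infinite_Set_Sum.abs_summable_on f A" by (simp add: abs_summable_on_def)
  then show "(\<lambda>x. norm (f x)) summable_on A" using abs_summable_equivalent by blast
  show eq: "infsum f A = (\<integral>x. f x \<partial>count_space A)"
    using infsetsum_infsum[OF *] by (simp add: infsetsum_def)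
  show "ennreal (norm (infsum f A)) \<le> (\<integral>\<^sup>+x. ennreal (norm (f x)) \<partial>count_space A)"
    unfolding eq using int by (rule integral_norm_bound_ennreal)
qed

lemma nn_integral_count_space_finite_iff:
  fixes f :: "'a \<Rightarrow> complex"
  shows "(\<integral>\<^sup>+x. ennreal (norm (f x)) \<partial>count_space A) < \<infinity> \<longleftrightarrow> (\<lambda>x. norm (f x)) summable_on A"
  using abs_summable_equivalent[of f A] by (simp add: abs_summable_on_def integrable_iff_bounded)

lemma nn_integral_count_space_infsum:
  fixes f :: "'a \<Rightarrow> real"
  assumes "(\<integral>\<^sup>+x. ennreal (f x) \<partial>count_space A) < \<infinity>" "\<And>x. x \<in> A \<Longrightarrow> 0 \<le> f x"
  shows "f summable_on A" "(\<integral>\<^sup>+x. ennreal (f x) \<partial>count_space A) = ennreal (infsum f A)"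
proof -
  have "(\<integral>\<^sup>+x. ennreal (norm (f x)) \<partial>count_space A) = (\<integral>\<^sup>+x. ennreal (f x) \<partial>count_space A)"
    using assms(2) by (intro nn_integral_cong) auto
  then have int: "integrable (count_space A) f"
    using assms by (simp add: integrable_iff_bounded)
  then have *: "Infinite_Set_Sum.abs_summable_on f A" by (simp add: abs_summable_on_def)
  then show "f summable_on A" using abs_summable_equivalent abs_summable_summable by blast
  show "(\<integral>\<^sup>+x. ennreal (f x) \<partial>count_space A) = ennreal (infsum f A)"
    using nn_integral_eq_integral[OF int] assms(2) infsetsum_infsum[OF *]
    by (simp add: infsetsum_def AE_count_space)
qed

lemma measurable_pair_count_space:
  assumes "countable A" "\<And>x. x \<in> A \<Longrightarrow> f x \<in> borel_measurable M"
  shows "(\<lambda>(q, x). f x q) \<in> borel_measurable (M \<Otimes>\<^sub>M count_space A)"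
  by (rule measurable_pair_swap[where f = "\<lambda>(x, q). f x q", simplified])
    (auto intro!: measurable_pair_measure_countable1 assms)

lemma measurable_infsum:
  fixes f :: "'a \<Rightarrow> 'b \<Rightarrow> complex"
  assumes A: "countable A" and meas: "\<And>x. x \<in> A \<Longrightarrow> f x \<in> borel_measurable M"
    and fin: "\<And>q. q \<in> space M \<Longrightarrow> (\<lambda>x. norm (f x q)) summable_on A"
  shows "(\<lambda>q. \<Sum>\<^sub>\<infinity>x\<in>A. f x q) \<in> borel_measurable M"
proof -
  interpret C: sigma_finite_measure "count_space A" by (rule sigma_finite_measure_count_space_countable[OF A])
  have "(\<lambda>(q, x). f x q) \<in> borel_measurable (M \<Otimes>\<^sub>M count_space A)"
    by (rule measurable_pair_count_space[OF A meas])
  then have "(\<lambda>q. \<integral>x. f x q \<partial>count_space A) \<in> borel_measurable M"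
    by (rule C.borel_measurable_lebesgue_integral)
  moreover have "(\<Sum>\<^sub>\<infinity>x\<in>A. f x q) = (\<integral>x. f x q \<partial>count_space A)" if "q \<in> space M" for q
    using fin[OF that] by (intro abs_summable_on_nn_integral(3)) (simp only: nn_integral_count_space_finite_iff)
  ultimately show ?thesis by (subst measurable_cong) auto
qed

text \<open>Fubini on the product with the counting measure. The majorant is constant in
  \<open>q\<close>, and \<open>M\<close> has total mass one.\<close>

lemma integral_infsum:
  fixes f :: "'a \<Rightarrow> 'b \<Rightarrow> complex"
  assumes M: "prob_space M" and A: "countable A"
    and meas: "\<And>x. x \<in> A \<Longrightarrow> f x \<in> borel_measurable M"
    and bound: "\<And>x q. x \<in> A \<Longrightarrow> q \<in> space M \<Longrightarrow> norm (f x q) \<le> C x"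
    and C: "C summable_on A"
  shows "(\<integral>q. (\<Sum>\<^sub>\<infinity>x\<in>A. f x q) \<partial>M) = (\<Sum>\<^sub>\<infinity>x\<in>A. \<integral>q. f x q \<partial>M)"
proof -
  interpret M: prob_space M by fact
  interpret C: sigma_finite_measure "count_space A" by (rule sigma_finite_measure_count_space_countable[OF A])
  interpret P: pair_sigma_finite M "count_space A" ..
  have nonneg: "0 \<le> C x" if "x \<in> A" for x
  proof -
    obtain q where "q \<in> space M" using M.not_empty by blast
    then show ?thesis using bound[OF that] norm_ge_zero order_trans by blast
  qed
  have fin: "(\<integral>\<^sup>+x. ennreal (C x) \<partial>count_space A) < \<infinity>"
  proof -
    have "Infinite_Set_Sum.abs_summable_on C A"
      using C nonneg by (subst abs_summable_equivalent[symmetric]) (metis (no_types, lifting) abs_of_nonneg real_norm_def summable_on_cong)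
    then have "integrable (count_space A) C" by (simp add: abs_summable_on_def)
    moreover have "(\<integral>\<^sup>+x. ennreal (norm (C x)) \<partial>count_space A) = (\<integral>\<^sup>+x. ennreal (C x) \<partial>count_space A)"
      using nonneg by (intro nn_integral_cong) auto
    ultimately show ?thesis by (simp add: integrable_iff_bounded)
  qed
  have fin_q: "(\<integral>\<^sup>+x. ennreal (norm (f x q)) \<partial>count_space A) < \<infinity>" if "q \<in> space M" for q
    by (rule le_less_trans[OF nn_integral_mono fin]) (auto intro!: ennreal_leI bound that)
  have eq: "(\<Sum>\<^sub>\<infinity>x\<in>A. f x q) = (\<integral>x. f x q \<partial>count_space A)" if "q \<in> space M" for q
    by (rule abs_summable_on_nn_integral(3)[OF fin_q[OF that]])
  have meas2: "(\<lambda>(q, x). f x q) \<in> borel_measurable (M \<Otimes>\<^sub>M count_space A)"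
    by (rule measurable_pair_count_space[OF A meas])
  have int2: "integrable (M \<Otimes>\<^sub>M count_space A) (\<lambda>(q, x). f x q)"
  proof -
    have "(\<integral>\<^sup>+z. ennreal (norm ((\<lambda>(q, x). f x q) z)) \<partial>(M \<Otimes>\<^sub>M count_space A)) =
      (\<integral>\<^sup>+q. (\<integral>\<^sup>+x. ennreal (norm (f x q)) \<partial>count_space A) \<partial>M)"
      using C.nn_integral_fst[of "\<lambda>z. ennreal (norm ((\<lambda>(q, x). f x q) z))"] meas2 by simp
    also have "\<dots> \<le> (\<integral>\<^sup>+q. (\<integral>\<^sup>+x. ennreal (C x) \<partial>count_space A) \<partial>M)"
      by (intro nn_integral_mono) (auto intro!: ennreal_leI bound)
    also have "\<dots> < \<infinity>" using fin by (simp add: M.emeasure_space_1)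
    finally show ?thesis using meas2 by (simp add: integrable_iff_bounded)
  qed
  have "(\<integral>q. (\<Sum>\<^sub>\<infinity>x\<in>A. f x q) \<partial>M) = (\<integral>q. (\<integral>x. f x q \<partial>count_space A) \<partial>M)"
    by (intro Bochner_Integration.integral_cong refl eq)
  also have "\<dots> = (\<integral>x. (\<integral>q. f x q \<partial>M) \<partial>count_space A)"
    using P.Fubini_integral[OF int2] by simp
  also have "\<dots> = (\<Sum>\<^sub>\<infinity>x\<in>A. \<integral>q. f x q \<partial>M)"
  proof (rule abs_summable_on_nn_integral(3)[symmetric])
    have "norm (\<integral>q. f x q \<partial>M) \<le> C x" if "x \<in> A" for x
    proof -
      have "integrable M (f x)"
        by (rule M.integrable_const_bound[where B = "C x"]) (auto intro: meas bound that)
      then have "norm (\<integral>q. f x q \<partial>M) \<le> (\<integral>q. norm (f x q) \<partial>M)" by simp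
      also have "\<dots> \<le> (\<integral>q. C x \<partial>M)"
        using \<open>integrable M (f x)\<close> by (intro integral_mono) (auto intro: bound that)
      finally show ?thesis by (simp add: M.prob_space)
    qed
    then show "(\<integral>\<^sup>+x. ennreal (norm (\<integral>q. f x q \<partial>M)) \<partial>count_space A) < \<infinity>"
      by (intro le_less_trans[OF nn_integral_mono fin]) (auto intro!: ennreal_leI)
  qed
  finally show ?thesis .
qed

section \<open>Gaussian integrals of positive definite forms\<close>

text \<open>The coefficients are real but the arguments lie in an arbitrary real field: the same
  form serves the real torus coordinates and, without conjugation, the complex vector
  \<open>z\<close>.\<close>

definition bil :: "nat \<Rightarrow> (nat \<Rightarrow> nat \<Rightarrow> real) \<Rightarrow> (nat \<Rightarrow> 'a) \<Rightarrow> (nat \<Rightarrow> 'a) \<Rightarrow> 'a::real_field" where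
  "bil g A x y = (\<Sum>i<g. \<Sum>j<g. of_real (A i j) * (x i * y j))"

lemma bil_add_left: "bil g A (\<lambda>i. x i + x' i) y = bil g A x y + bil g A x' y"
  by (simp add: bil_def sum.distrib algebra_simps)

lemma bil_add_right: "bil g A x (\<lambda>i. y i + y' i) = bil g A x y + bil g A x y'"
  by (simp add: bil_def sum.distrib algebra_simps)

lemma bil_scale_left: "bil g A (\<lambda>i. c * x i) y = c * bil g A x y"
  by (simp add: bil_def sum_distrib_left algebra_simps)

lemma bil_scale_right: "bil g A x (\<lambda>i. c * y i) = c * bil g A x y"
  by (simp add: bil_def sum_distrib_left algebra_simps)

lemma bil_minus_left: "bil g A (\<lambda>i. - x i) y = - bil g A x y"
  by (simp add: bil_def sum_negf)

lemma bil_minus_right: "bil g A x (\<lambda>i. - y i) = - bil g A x y"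
  by (simp add: bil_def sum_negf)

lemma bil_of_real: "bil g A (\<lambda>i. of_real (x i)) (\<lambda>i. of_real (y i)) = of_real (bil g A x y)"
  by (simp add: bil_def)

lemma bil_cong: "(\<And>i. i < g \<Longrightarrow> x i = x' i) \<Longrightarrow> (\<And>i. i < g \<Longrightarrow> y i = y' i) \<Longrightarrow> bil g A x y = bil g A x' y'"
  by (simp add: bil_def)

lemma bil_altdef: "bil g A x y = (\<Sum>i<g. (\<Sum>j<g. of_real (A i j) * y j) * x i)"
  unfolding bil_def sum_distrib_right by (intro sum.cong refl) (simp add: mult_ac)

locale symmetric_form =
  fixes g :: nat and A :: "nat \<Rightarrow> nat \<Rightarrow> real"
  assumes sym: "\<And>i j. i < g \<Longrightarrow> j < g \<Longrightarrow> A i j = A j i"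
begin

lemma bil_commute: "bil g A x y = bil g A y x"
proof -
  have "bil g A x y = (\<Sum>j<g. \<Sum>i<g. of_real (A i j) * (x i * y j))"
    unfolding bil_def by (rule sum.swap)
  also have "\<dots> = bil g A y x"
    unfolding bil_def by (intro sum.cong refl) (simp add: sym mult.commute)
  finally show ?thesis .
qed

lemma bil_square_add: "bil g A (\<lambda>i. x i + y i) (\<lambda>i. x i + y i) = bil g A x x + 2 * bil g A x y + bil g A y y"
  by (simp add: bil_add_left bil_add_right bil_commute[of y x])

end

text \<open>\<open>dual\<close> expresses the invertibility of the matrix: the vectors
  \<open>w\<close> are the columns of its inverse.\<close>

locale positive_form = symmetric_form +
  assumes pos: "\<And>x :: nat \<Rightarrow> real. \<exists>i<g. x i \<noteq> 0 \<Longrightarrow> 0 < bil g A x x"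
    and dual: "\<And>i. i < g \<Longrightarrow> \<exists>w. \<forall>j<g. (\<Sum>k<g. A j k * w k) = (if j = i then 1 else 0)"
begin

abbreviation sq :: "(nat \<Rightarrow> real) \<Rightarrow> real" where "sq x \<equiv> bil g A x x"

lemma sq_nonneg: "0 \<le> sq x"
proof (cases "\<exists>i<g. x i \<noteq> 0")
  case False
  then show ?thesis by (simp add: bil_def)
qed (use pos in force)

lemma bil_Cauchy_Schwarz: "(bil g A x y)\<^sup>2 \<le> sq x * sq y" for x y :: "nat \<Rightarrow> real"
proof (cases "sq y = 0")
  case True
  then have "y i = 0" if "i < g" for i using pos that by force
  then show ?thesis by (simp add: bil_def)
next
  case False
  then have "0 < sq y" using sq_nonneg[of y] by simp
  define t where "t = bil g A x y / sq y"
  have "0 \<le> sq (\<lambda>i. x i + (- t) * y i)" by (rule sq_nonneg)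
  also have "\<dots> = sq x - (bil g A x y)\<^sup>2 / sq y"
    unfolding bil_square_add unfolding bil_scale_left bil_scale_right
    using False by (simp add: t_def power2_eq_square field_simps)
  finally show ?thesis using \<open>0 < sq y\<close> by (simp add: field_simps)
qed

text \<open>The coordinates are the pairings with the dual basis, so Cauchy-Schwarz bounds them.\<close>

lemma coercive: "\<exists>e>0. \<forall>x. e * (\<Sum>i<g. (x i)\<^sup>2) \<le> sq x"
proof -
  obtain w where w: "\<And>i j. i < g \<Longrightarrow> j < g \<Longrightarrow> (\<Sum>k<g. A j k * w i k) = (if j = i then 1 else 0)"
    using dual by metis
  define S where "S = (\<Sum>i<g. sq (w i))"
  have S: "0 \<le> S" unfolding S_def by (intro sum_nonneg sq_nonneg)
  have le: "(\<Sum>i<g. (x i)\<^sup>2) \<le> S * sq x" for x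
  proof -
    have "(x i)\<^sup>2 \<le> sq (w i) * sq x" if "i < g" for i
    proof -
      have "bil g A x (w i) = (\<Sum>j<g. if j = i then x j else 0)"
        unfolding bil_altdef by (intro sum.cong refl) (simp add: w[OF that])
      also have "\<dots> = x i" using that by simp
      finally show ?thesis using bil_Cauchy_Schwarz[of x "w i"] by (simp add: mult.commute)
    qed
    then show ?thesis unfolding S_def sum_distrib_right by (intro sum_mono) auto
  qed
  have "1 / (S + 1) * (\<Sum>i<g. (x i)\<^sup>2) \<le> sq x" for x
  proof -
    have "(\<Sum>i<g. (x i)\<^sup>2) \<le> S * sq x + sq x" using le[of x] sq_nonneg[of x] by simp
    also have "\<dots> = sq x * (S + 1)" by (simp add: algebra_simps)
    finally show ?thesis using S by (simp add: pos_divide_le_eq)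
  qed
  then show ?thesis using S by (intro exI[of _ "1 / (S + 1)"]) auto
qed

definition form_bound :: real where "form_bound = (\<Sum>i<g. \<Sum>j<g. \<bar>A i j\<bar>)"

lemma sq_cube_le: "x \<in> cube g \<Longrightarrow> sq x \<le> form_bound"
  unfolding bil_def form_bound_def
proof (intro sum_mono)
  fix i j assume x: "x \<in> cube g" and ij: "i \<in> {..<g}" "j \<in> {..<g}"
  have "\<bar>x i * x j\<bar> \<le> 1"
    using x ij by (auto simp: cube_def abs_mult intro!: mult_le_one)
  then have "\<bar>A i j\<bar> * \<bar>x i * x j\<bar> \<le> \<bar>A i j\<bar>" by (intro mult_left_le) auto
  moreover have "A i j * (x i * x j) \<le> \<bar>A i j\<bar> * \<bar>x i * x j\<bar>"
    unfolding abs_mult[symmetric] by (rule abs_ge_self)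
  ultimately show "of_real (A i j) * (x i * x j) \<le> \<bar>A i j\<bar>" by simp
qed

text \<open>The value is (pi/t)^(g/2) / sqrt (det A), but only finiteness, positivity and the
  scaling in \<open>t\<close> enter, since the constant cancels in the end.\<close>

definition gauss :: "real \<Rightarrow> ennreal" where
  "gauss t = (\<integral>\<^sup>+x. ennreal (exp (- t * sq x)) \<partial>Leb g)"

lemma measurable_bil [measurable]:
  assumes "\<And>i. i < g \<Longrightarrow> (\<lambda>w. x w i) \<in> borel_measurable M" "\<And>i. i < g \<Longrightarrow> (\<lambda>w. y w i) \<in> borel_measurable M"
  shows "(\<lambda>w. bil g A (x w) (y w) :: real) \<in> borel_measurable M"
  unfolding bil_def using assms by (intro borel_measurable_sum borel_measurable_times) auto

lemma gauss_measurable: "(\<lambda>x. ennreal (exp (- t * sq x))) \<in> borel_measurable (Leb g)"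
  by measurable

lemma gauss_local: "local_fun g (\<lambda>x. ennreal (exp (- t * sq x)))"
  unfolding local_fun_def by (auto intro!: arg_cong[where f = ennreal] bil_cong)

lemma gauss_finite: "t > 0 \<Longrightarrow> gauss t < \<infinity>"
proof -
  assume t: "t > 0"
  obtain e where e: "e > 0" "\<And>x. e * (\<Sum>i<g. (x i)\<^sup>2) \<le> sq x" using coercive by blast
  have "gauss t \<le> (\<integral>\<^sup>+x. ennreal (exp (- (t * e) * (\<Sum>i<g. (x i)\<^sup>2))) \<partial>Leb g)"
    unfolding gauss_def using t e by (intro nn_integral_mono ennreal_leI) (simp add: mult.assoc)
  also have "\<dots> < \<infinity>" using t e by (intro gaussian_Leb_finite) auto
  finally show ?thesis .
qed

lemma gauss_pos: "0 < gauss 1"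
proof -
  have "0 < ennreal (exp (- form_bound)) * 1" by simp
  also have "\<dots> = ennreal (exp (- form_bound)) * (\<integral>\<^sup>+x. indicator (cube g) x \<partial>Leb g)"
    using nn_integral_box[of "\<lambda>_. 1" g] box.emeasure_space_1 by simp
  also have "\<dots> = (\<integral>\<^sup>+x. ennreal (exp (- form_bound)) * indicator (cube g) x \<partial>Leb g)"
    by (simp add: nn_integral_cmult)
  also have "\<dots> \<le> gauss 1"
    unfolding gauss_def by (intro nn_integral_mono) (auto simp: indicator_def intro!: ennreal_leI dest: sq_cube_le)
  finally show ?thesis .
qed

lemma gauss_scale: "t > 0 \<Longrightarrow> gauss t = ennreal (enn2real (gauss 1) * t powr (- real g / 2))"
proof -
  assume t: "t > 0"
  have "gauss 1 = ennreal (\<bar>sqrt t\<bar> ^ g) * (\<integral>\<^sup>+x. ennreal (exp (- 1 * sq (\<lambda>i. 0 + sqrt t * x i))) \<partial>Leb g)"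
    unfolding gauss_def using t by (intro nn_integral_Leb_affine gauss_measurable gauss_local) auto
  also have "\<dots> = ennreal (sqrt t ^ g) * gauss t"
    unfolding gauss_def using t by (simp add: bil_scale_left bil_scale_right flip: mult.assoc)
  finally have eq: "gauss 1 = ennreal (sqrt t ^ g) * gauss t" .
  obtain a where a: "gauss t = ennreal a" "a \<ge> 0" using gauss_finite[OF t] by (cases "gauss t") auto
  have "enn2real (gauss 1) = sqrt t ^ g * a"
    using t a by (simp add: eq ennreal_mult[symmetric])
  also have "sqrt t ^ g = t powr (real g / 2)"
    using t by (simp add: powr_half_sqrt[symmetric] powr_powr flip: powr_realpow)
  finally show ?thesis using t a by (simp add: powr_minus field_simps)
qed

lemma gauss_translate: "(\<integral>\<^sup>+x. ennreal (exp (- t * sq (\<lambda>i. b i + x i))) \<partial>Leb g) = gauss t"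
  using nn_integral_Leb_affine[OF gauss_measurable gauss_local, of 1 t b] by (simp add: gauss_def)

text \<open>Averaging \<open>sq (x + h) \<le> 2 sq x + 2 sq h\<close> over \<open>h\<close> in the unit cube turns the lattice sum into an
  integral, uniformly in the translation \<open>y\<close>.\<close>

lemma lattice_gauss_bound:
  assumes t: "t > 0"
  shows "(\<integral>\<^sup>+v. ennreal (exp (- t * sq (shift y v))) \<partial>count_space (lat g)) \<le>
    ennreal (exp (t * form_bound)) * gauss (t / 2)"
proof -
  define F where "F x = ennreal (exp (- (t / 2) * sq (\<lambda>i. y i + x i)))" for x
  have F: "F \<in> borel_measurable (Leb g)" "local_fun g F"
    unfolding F_def by measurable (auto simp: local_fun_def intro!: arg_cong[where f = ennreal] bil_cong)
  have pw: "ennreal (exp (- t * sq (shift y v))) \<le> ennreal (exp (t * form_bound)) * F (shift h v)"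
    if "h \<in> cube g" for h v
  proof -
    define x where "x = shift y v"
    have "sq (\<lambda>i. x i + h i) + sq (\<lambda>i. x i + (- 1) * h i) = 2 * sq x + 2 * sq h"
      unfolding bil_square_add unfolding bil_scale_left bil_scale_right by simp
    then have "sq (\<lambda>i. x i + h i) \<le> 2 * sq x + 2 * form_bound"
      using sq_nonneg[of "\<lambda>i. x i + (- 1) * h i"] sq_cube_le[OF that] by linarith
    then have "t / 2 * sq (\<lambda>i. x i + h i) \<le> t / 2 * (2 * sq x + 2 * form_bound)"
      using t by (intro mult_left_mono) auto
    then have "exp (- t * sq x) \<le> exp (t * form_bound) * exp (- (t / 2) * sq (\<lambda>i. x i + h i))"
      unfolding exp_add[symmetric] by (simp add: algebra_simps)
    moreover have "(\<lambda>i. x i + h i) = (\<lambda>i. y i + shift h v i)" by (simp add: x_def shift_def add_ac)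
    ultimately show ?thesis unfolding F_def x_def by (simp add: ennreal_leI flip: ennreal_mult)
  qed
  have Fs: "(\<lambda>h. F (shift h v)) \<in> borel_measurable (Leb g)" for v
    by (rule measurable_local_fun[OF F]) (auto simp: shift_def)
  have "ennreal (exp (- t * sq (shift y v))) \<le> (\<integral>\<^sup>+h. ennreal (exp (t * form_bound)) * F (shift h v) \<partial>box g)" for v
  proof -
    have "ennreal (exp (- t * sq (shift y v))) = (\<integral>\<^sup>+h. ennreal (exp (- t * sq (shift y v))) * indicator (cube g) h \<partial>Leb g)"
      using nn_integral_box[of "\<lambda>_. ennreal (exp (- t * sq (shift y v)))" g] box.emeasure_space_1 by simp
    also have "\<dots> \<le> (\<integral>\<^sup>+h. (ennreal (exp (t * form_bound)) * F (shift h v)) * indicator (cube g) h \<partial>Leb g)"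
      using pw by (intro nn_integral_mono) (auto simp: indicator_def)
    also have "\<dots> = (\<integral>\<^sup>+h. ennreal (exp (t * form_bound)) * F (shift h v) \<partial>box g)"
      using Fs by (subst nn_integral_box) auto
    finally show ?thesis .
  qed
  then have "(\<integral>\<^sup>+v. ennreal (exp (- t * sq (shift y v))) \<partial>count_space (lat g)) \<le>
    (\<integral>\<^sup>+v. (\<integral>\<^sup>+h. ennreal (exp (t * form_bound)) * F (shift h v) \<partial>box g) \<partial>count_space (lat g))"
    by (intro nn_integral_mono) auto
  also have "\<dots> = ennreal (exp (t * form_bound)) * (\<integral>\<^sup>+v. (\<integral>\<^sup>+h. F (shift h v) \<partial>box g) \<partial>count_space (lat g))"
    using Fs by (simp add: nn_integral_cmult)
  also have "(\<integral>\<^sup>+v. (\<integral>\<^sup>+h. F (shift h v) \<partial>box g) \<partial>count_space (lat g)) = gauss (t / 2)"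
    using nn_integral_Leb_tile[OF F] gauss_translate[of "t / 2" y] by (simp add: F_def)
  finally show ?thesis .
qed

end

section \<open>Theta series\<close>

lemma norm_e2pi: "norm (e2pi w) = exp (- 2 * pi * Im w)"
  by (simp add: e2pi_def)

lemma e2pi_add: "e2pi (a + b) = e2pi a * e2pi b"
  by (simp add: e2pi_def exp_add distrib_left)

lemma e2pi_of_int: "k \<in> \<int> \<Longrightarrow> e2pi (of_real k) = 1"
  by (auto simp: e2pi_def elim!: Ints_cases intro!: exp_eq_1[THEN iffD2])

definition chi :: "nat \<Rightarrow> (nat \<Rightarrow> real) \<Rightarrow> (nat \<Rightarrow> real) \<Rightarrow> complex" where
  "chi g k q = e2pi (of_real (\<Sum>i<g. k i * q i))"

lemma norm_chi [simp]: "norm (chi g k q) = 1"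
  by (simp add: chi_def norm_e2pi)

lemma chi_mult_cnj: "chi g k q * cnj (chi g l q) = chi g (\<lambda>i. k i - l i) q"
proof -
  have "cnj (chi g l q) = chi g (\<lambda>i. - l i) q"
    by (simp add: chi_def e2pi_def exp_cnj sum_negf)
  then show ?thesis
    by (simp add: chi_def flip: e2pi_add) (simp add: sum_subtractf sum_negf left_diff_distrib)
qed

lemma measurable_chi: "chi g k \<in> borel_measurable (box g)"
proof -
  have "(\<lambda>q. \<Sum>i<g. k i * q i) \<in> borel_measurable (box g)" by measurable
  then show ?thesis unfolding chi_def[abs_def] e2pi_def by measurable
qed

lemma integral_chi:
  assumes "\<And>i. i < g \<Longrightarrow> k i \<in> \<int>"
  shows "(\<integral>q. chi g k q \<partial>box g) = (if \<forall>i<g. k i = 0 then 1 else 0)"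
proof (cases "\<forall>i<g. k i = 0")
  case True
  then have "chi g k q = 1" for q by (simp add: chi_def e2pi_def)
  then show ?thesis using True by (simp add: box.prob_space)
next
  case False
  then show ?thesis using integral_character_box[of g k] assms by (auto simp: chi_def)
qed

text \<open>Parseval for absolutely convergent series. There are two families of frequencies because
  \<Theta> is paired both with itself and with its reflection; the inner sum collects all
  \<open>w\<close> that share the frequency of \<open>v\<close>.\<close>

lemma trig_series_inner:
  fixes a b :: "int vec \<Rightarrow> complex"
  assumes a: "(\<lambda>v. norm (a v)) summable_on lat g" and b: "(\<lambda>v. norm (b v)) summable_on lat g"
    and k: "\<And>v i. i < g \<Longrightarrow> k v i \<in> \<int>" and l: "\<And>v i. i < g \<Longrightarrow> l v i \<in> \<int>"
  shows "(\<integral>q. (\<Sum>\<^sub>\<infinity>v\<in>lat g. a v * chi g (k v) q) * cnj (\<Sum>\<^sub>\<infinity>w\<in>lat g. b w * chi g (l w) q) \<partial>box g) =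
    (\<Sum>\<^sub>\<infinity>v\<in>lat g. a v * cnj (\<Sum>\<^sub>\<infinity>w\<in>lat g. if \<forall>i<g. k v i = l w i then b w else 0))"
proof -
  define B where "B q = (\<Sum>\<^sub>\<infinity>w\<in>lat g. b w * chi g (l w) q)" for q
  have B_meas: "B \<in> borel_measurable (box g)"
    unfolding B_def by (rule measurable_infsum[OF countable_lat])
      (auto simp: norm_mult b intro!: borel_measurable_times measurable_chi)
  have B_bound: "norm (B q) \<le> (\<Sum>\<^sub>\<infinity>w\<in>lat g. norm (b w))" for q
    unfolding B_def using norm_infsum_bound[of "\<lambda>w. b w * chi g (l w) q" "lat g"] b by (simp add: norm_mult)
  have cB_meas: "(\<lambda>q. cnj (B q)) \<in> borel_measurable (box g)"
    by (rule measurable_compose[OF B_meas]) (auto intro!: borel_measurable_continuous_onI continuous_intros)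
  have inner: "(\<integral>q. chi g (k v) q * cnj (B q) \<partial>box g) = cnj (\<Sum>\<^sub>\<infinity>w\<in>lat g. if \<forall>i<g. k v i = l w i then b w else 0)" for v
  proof -
    have "(\<integral>q. chi g (k v) q * cnj (B q) \<partial>box g) = (\<integral>q. cnj (B q * cnj (chi g (k v) q)) \<partial>box g)"
      by (simp add: mult.commute)
    also have "\<dots> = cnj (\<integral>q. B q * cnj (chi g (k v) q) \<partial>box g)" by (rule Bochner_Integration.integral_cnj)
    also have "(\<integral>q. B q * cnj (chi g (k v) q) \<partial>box g) =
      (\<integral>q. (\<Sum>\<^sub>\<infinity>w\<in>lat g. b w * chi g (\<lambda>i. l w i - k v i) q) \<partial>box g)"
      unfolding B_def by (simp flip: infsum_cmult_left' chi_mult_cnj add: mult.assoc)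
    also have "\<dots> = (\<Sum>\<^sub>\<infinity>w\<in>lat g. \<integral>q. b w * chi g (\<lambda>i. l w i - k v i) q \<partial>box g)"
      by (rule integral_infsum[OF prob_space_box countable_lat _ _ b])
        (auto simp: norm_mult intro!: borel_measurable_times measurable_chi)
    also have "\<dots> = (\<Sum>\<^sub>\<infinity>w\<in>lat g. if \<forall>i<g. k v i = l w i then b w else 0)"
    proof (rule infsum_cong)
      fix w
      have "(\<integral>q. chi g (\<lambda>i. l w i - k v i) q \<partial>box g) = (if \<forall>i<g. l w i - k v i = 0 then 1 else 0)"
        by (rule integral_chi) (intro Ints_diff k l)
      then show "(\<integral>q. b w * chi g (\<lambda>i. l w i - k v i) q \<partial>box g) = (if \<forall>i<g. k v i = l w i then b w else 0)"
        by auto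
    qed
    finally show ?thesis .
  qed
  have "(\<integral>q. (\<Sum>\<^sub>\<infinity>v\<in>lat g. a v * chi g (k v) q) * cnj (B q) \<partial>box g) =
    (\<integral>q. (\<Sum>\<^sub>\<infinity>v\<in>lat g. a v * (chi g (k v) q * cnj (B q))) \<partial>box g)"
    by (simp flip: infsum_cmult_left' add: mult.assoc)
  also have "\<dots> = (\<Sum>\<^sub>\<infinity>v\<in>lat g. \<integral>q. a v * (chi g (k v) q * cnj (B q)) \<partial>box g)"
  proof (rule integral_infsum[OF prob_space_box countable_lat])
    show "(\<lambda>v. norm (a v) * (\<Sum>\<^sub>\<infinity>w\<in>lat g. norm (b w))) summable_on lat g"
      by (rule summable_on_cmult_left[OF a])
    show "norm (a v * (chi g (k v) q * cnj (B q))) \<le> norm (a v) * (\<Sum>\<^sub>\<infinity>w\<in>lat g. norm (b w))" for v q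
      using B_bound[of q] by (simp add: norm_mult mult_left_mono)
  qed (intro borel_measurable_times measurable_chi cB_meas borel_measurable_const)
  also have "\<dots> = (\<Sum>\<^sub>\<infinity>v\<in>lat g. a v * cnj (\<Sum>\<^sub>\<infinity>w\<in>lat g. if \<forall>i<g. k v i = l w i then b w else 0))"
    by (simp add: inner)
  finally show ?thesis unfolding B_def .
qed

text \<open>\<open>\<rho>\<close> is half of m^(-1) r, and minus \<open>\<rho>\<close> is the centre
  of the quadratic polynomial \<open>R\<close> below. \<open>int2A\<close> and \<open>diagA\<close>
  together say that the matrix is half-integral.\<close>

locale theta_data = positive_form +
  fixes r :: "nat \<Rightarrow> int" and n :: nat and \<rho> :: "nat \<Rightarrow> real"
  assumes int2A: "\<And>i j. i < g \<Longrightarrow> j < g \<Longrightarrow> 2 * A i j \<in> \<int>"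
    and diagA: "\<And>i. i < g \<Longrightarrow> A i i \<in> \<int>"
    and rho: "\<And>i. i < g \<Longrightarrow> 2 * (\<Sum>j<g. A i j * \<rho> j) = of_int (r i)"
begin

definition R :: "(nat \<Rightarrow> real) \<Rightarrow> real" where
  "R x = sq x + (\<Sum>i<g. of_int (r i) * x i) + real n"

text \<open>This is n - m^(-1)[r]/4, the minimum of \<open>R\<close>, and half of the quotient D /
  det (2m).\<close>

definition \<Delta> :: real where "\<Delta> = real n - sq \<rho>"

definition freq :: "int vec \<Rightarrow> nat \<Rightarrow> real" where
  "freq v i = 2 * (\<Sum>j<g. A i j * of_int (v $ j)) + of_int (r i)"

definition coef :: "complex \<Rightarrow> (nat \<Rightarrow> real) \<Rightarrow> int vec \<Rightarrow> complex" where
  "coef t p v = e2pi (t * of_real (R (shift p v)))"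

text \<open>Up to the factor e(-t m[p]) this is the seed e(n\<tau> + rz) acted on by \<lambda> = v,
  at \<tau> = t and z = pt + q. \<open>Theta\<close> therefore collects the cosets with bottom row
  \<open>(0, 1)\<close>.\<close>

definition Phi :: "complex \<Rightarrow> int vec \<Rightarrow> (nat \<Rightarrow> real) \<Rightarrow> (nat \<Rightarrow> real) \<Rightarrow> complex" where
  "Phi t v p q = coef t p v * chi g (freq v) q"

definition Theta :: "complex \<Rightarrow> (nat \<Rightarrow> real) \<Rightarrow> (nat \<Rightarrow> real) \<Rightarrow> complex" where
  "Theta t p q = (\<Sum>\<^sub>\<infinity>v\<in>lat g. Phi t v p q)"

lemma bil_rho: "2 * bil g A \<rho> x = (\<Sum>i<g. of_int (r i) * x i)"
proof -
  have "2 * bil g A \<rho> x = 2 * bil g A x \<rho>" by (simp add: bil_commute)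
  also have "\<dots> = (\<Sum>i<g. (2 * (\<Sum>j<g. A i j * \<rho> j)) * x i)"
    unfolding bil_altdef by (subst sum_distrib_left) (simp add: mult.assoc)
  also have "\<dots> = (\<Sum>i<g. of_int (r i) * x i)" by (intro sum.cong refl) (simp add: rho)
  finally show ?thesis .
qed

lemma R_eq: "R x = sq (\<lambda>i. \<rho> i + x i) + \<Delta>"
  unfolding R_def \<Delta>_def bil_square_add bil_rho by simp

lemma norm_coef: "norm (coef t p v) = exp (- 2 * pi * Im t * R (shift p v))"
  by (simp add: coef_def norm_e2pi)

lemma norm_Phi: "norm (Phi t v p q) = exp (- 2 * pi * Im t * R (shift p v))"
  by (simp add: Phi_def norm_mult norm_coef)

lemma sum_exp_R_bound:
  assumes "y > 0"
  shows "(\<integral>\<^sup>+v. ennreal (exp (- y * R (shift p v))) \<partial>count_space (lat g)) \<le>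
    ennreal (exp (- y * \<Delta>) * exp (y * form_bound)) * gauss (y / 2)"
proof -
  have "exp (- y * R (shift p v)) = exp (- y * \<Delta>) * exp (- y * sq (shift (\<lambda>i. \<rho> i + p i) v))" for v
  proof -
    have "(\<lambda>i. \<rho> i + shift p v i) = shift (\<lambda>i. \<rho> i + p i) v" by (simp add: shift_def add.assoc)
    then show ?thesis by (simp add: R_eq algebra_simps flip: exp_add)
  qed
  then have "(\<integral>\<^sup>+v. ennreal (exp (- y * R (shift p v))) \<partial>count_space (lat g)) =
    ennreal (exp (- y * \<Delta>)) * (\<integral>\<^sup>+v. ennreal (exp (- y * sq (shift (\<lambda>i. \<rho> i + p i) v))) \<partial>count_space (lat g))"
    by (simp add: ennreal_mult nn_integral_cmult)
  also have "\<dots> \<le> ennreal (exp (- y * \<Delta>)) * (ennreal (exp (y * form_bound)) * gauss (y / 2))"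
    by (intro mult_left_mono lattice_gauss_bound assms) simp
  finally show ?thesis by (simp add: ennreal_mult mult.assoc)
qed

lemma sum_norm_Phi_bound:
  assumes "Im t > 0"
  shows "(\<integral>\<^sup>+v. ennreal (norm (Phi t v p q)) \<partial>count_space (lat g)) \<le>
    ennreal (exp (- (2 * pi * Im t) * \<Delta>) * exp (2 * pi * Im t * form_bound)) * gauss (pi * Im t)"
  using sum_exp_R_bound[of "2 * pi * Im t" p] assms by (simp add: norm_Phi)

lemma coef_summable: "Im t > 0 \<Longrightarrow> (\<lambda>v. norm (coef t p v)) summable_on lat g"
proof -
  assume t: "Im t > 0"
  have "(\<integral>\<^sup>+v. ennreal (norm (coef t p v)) \<partial>count_space (lat g)) < \<infinity>"
    using sum_norm_Phi_bound[OF t, of p undefined] gauss_finite[of "pi * Im t"] t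
    by (simp add: norm_Phi norm_coef ennreal_mult_less_top le_less_trans)
  then show ?thesis by (simp only: nn_integral_count_space_finite_iff)
qed

lemma norm_coef_square: "(norm (coef t p v))\<^sup>2 = exp (- (4 * pi * Im t) * R (shift p v))"
  by (simp add: norm_coef flip: exp_double)

lemma coef_square_summable: "Im t > 0 \<Longrightarrow> (\<lambda>v. (norm (coef t p v))\<^sup>2) summable_on lat g"
  unfolding norm_coef_square using coef_summable[of "2 * t" p] by (simp add: norm_coef mult.assoc)

lemma Phi_summable: "Im t > 0 \<Longrightarrow> (\<lambda>v. norm (Phi t v p q)) summable_on lat g"
  using coef_summable[of t p] by (simp add: norm_Phi norm_coef)

lemma freq_pairing:
  "(\<Sum>i<g. freq v i * x i) = 2 * bil g A x (\<lambda>i. of_int (v $ i)) + (\<Sum>i<g. of_int (r i) * x i)"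
proof -
  define S where "S i = (\<Sum>j<g. A i j * of_int (v $ j))" for i
  have "freq v i * x i = 2 * (S i * x i) + of_int (r i) * x i" for i
    by (simp add: freq_def S_def algebra_simps)
  moreover have "bil g A x (\<lambda>i. of_int (v $ i)) = (\<Sum>i<g. S i * x i)" by (simp add: bil_altdef S_def)
  ultimately show ?thesis by (simp only: sum.distrib sum_distrib_left)
qed

lemma freq_int: "i < g \<Longrightarrow> freq v i \<in> \<int>"
proof -
  assume i: "i < g"
  have "2 * (\<Sum>j<g. A i j * of_int (v $ j)) = (\<Sum>j<g. (2 * A i j) * of_int (v $ j))"
    by (simp add: sum_distrib_left mult.assoc)
  also have "\<dots> \<in> \<int>" using i by (intro Ints_sum Ints_mult int2A) auto
  finally show ?thesis by (simp add: freq_def)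
qed

lemma pos_cancel:
  assumes "\<And>i. i < g \<Longrightarrow> (\<Sum>j<g. A i j * x j) = 0" "i < g" shows "x i = 0"
proof (rule ccontr)
  assume "x i \<noteq> 0"
  then have "0 < sq x" using pos assms(2) by blast
  moreover have "sq x = 0" unfolding bil_altdef using assms(1) by simp
  ultimately show False by simp
qed

text \<open>Definiteness makes v -> 2Av injective. Distinct terms of \<Theta> thus carry orthogonal
  characters, and its norm has no cross terms.\<close>

lemma freq_inj:
  assumes v: "v \<in> lat g" "w \<in> lat g" and eq: "\<forall>i<g. freq v i = freq w i"
  shows "v = w"
proof -
  have "(\<Sum>j<g. A i j * (of_int (v $ j) - of_int (w $ j))) = 0" if "i < g" for i
    using eq that by (simp add: freq_def right_diff_distrib sum_subtractf)
  then have "of_int (v $ i) - of_int (w $ i) = (0::real)" if "i < g" for i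
    using pos_cancel[of "\<lambda>j. of_int (v $ j) - of_int (w $ j)"] that by blast
  then show ?thesis using v by (auto simp: vec_eq_iff)
qed

lemma Theta_inner:
  assumes t: "Im t > 0"
  shows "(\<integral>q. Theta t p q * cnj (Theta t p q) \<partial>box g) = of_real (\<Sum>\<^sub>\<infinity>v\<in>lat g. (norm (coef t p v))\<^sup>2)"
proof -
  have "(\<integral>q. Theta t p q * cnj (Theta t p q) \<partial>box g) =
    (\<Sum>\<^sub>\<infinity>v\<in>lat g. coef t p v * cnj (\<Sum>\<^sub>\<infinity>w\<in>lat g. if \<forall>i<g. freq v i = freq w i then coef t p w else 0))"
    unfolding Theta_def Phi_def by (intro trig_series_inner coef_summable t freq_int)
  also have "\<dots> = (\<Sum>\<^sub>\<infinity>v\<in>lat g. of_real ((norm (coef t p v))\<^sup>2))"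
  proof (rule infsum_cong)
    fix v assume v: "v \<in> lat g"
    have "(\<Sum>\<^sub>\<infinity>w\<in>lat g. if \<forall>i<g. freq v i = freq w i then coef t p w else 0) = (\<Sum>\<^sub>\<infinity>w\<in>{v}. coef t p w)"
      using v by (intro infsum_cong_neutral) (auto dest: freq_inj)
    then show "coef t p v * cnj (\<Sum>\<^sub>\<infinity>w\<in>lat g. if \<forall>i<g. freq v i = freq w i then coef t p w else 0) =
      of_real ((norm (coef t p v))\<^sup>2)"
      by (simp add: complex_norm_square[symmetric])
  qed
  also have "\<dots> = of_real (\<Sum>\<^sub>\<infinity>v\<in>lat g. (norm (coef t p v))\<^sup>2)"
    using coef_square_summable[OF t] by (intro infsumI has_sum_of_real has_sum_infsum)
  finally show ?thesis .
qed

text \<open>Coordinate form of the congruence \<open>two_r_cong_0\<close>, stated for the form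
  instead of the matrix.\<close>

definition cong0 :: bool where
  "cong0 \<longleftrightarrow> (\<exists>l\<in>lat g. \<forall>i<g. 2 * of_int (r i) = 2 * (\<Sum>j<g. A i j * of_int (l $ j)))"

text \<open>Reflection negates the frequencies, and an equality - freq v = freq w would read 2r =
  2A(-(v + w)), which is the excluded congruence. So the two series have no character in
  common.\<close>

lemma Theta_neg_inner:
  assumes t: "Im t > 0" and nc: "\<not> cong0"
  shows "(\<integral>q. Theta t (\<lambda>i. - p i) (\<lambda>i. - q i) * cnj (Theta t p q) \<partial>box g) = 0"
proof -
  have neg: "chi g k (\<lambda>i. - q i) = chi g (\<lambda>i. - k i) q" for k q by (simp add: chi_def)
  have "(\<integral>q. Theta t (\<lambda>i. - p i) (\<lambda>i. - q i) * cnj (Theta t p q) \<partial>box g) =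
    (\<Sum>\<^sub>\<infinity>v\<in>lat g. coef t (\<lambda>i. - p i) v * cnj (\<Sum>\<^sub>\<infinity>w\<in>lat g. if \<forall>i<g. - freq v i = freq w i then coef t p w else 0))"
    unfolding Theta_def Phi_def neg by (intro trig_series_inner coef_summable t freq_int Ints_minus)
  also have "\<dots> = 0"
  proof (intro infsum_0)
    fix v assume v: "v \<in> lat g"
    have "\<not> (\<forall>i<g. - freq v i = freq w i)" if w: "w \<in> lat g" for w
    proof
      assume eq: "\<forall>i<g. - freq v i = freq w i"
      have "2 * of_int (r i) = 2 * (\<Sum>j<g. A i j * of_int ((- (v + w)) $ j))" if "i < g" for i
      proof -
        have "(\<Sum>j<g. A i j * of_int ((- (v + w)) $ j)) = - (\<Sum>j<g. A i j * of_int (v $ j)) - (\<Sum>j<g. A i j * of_int (w $ j))"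
          using v w unfolding sum_negf[symmetric] sum_subtractf[symmetric] by (intro sum.cong refl) (simp add: algebra_simps)
        then show ?thesis using eq that by (simp add: freq_def)
      qed
      moreover have "- (v + w) \<in> lat g" using v w by simp
      ultimately show False using nc unfolding cong0_def by blast
    qed
    then have "(\<Sum>\<^sub>\<infinity>w\<in>lat g. if \<forall>i<g. - freq v i = freq w i then coef t p w else 0) = 0"
      by (intro infsum_0) auto
    then show "coef t (\<lambda>i. - p i) v * cnj (\<Sum>\<^sub>\<infinity>w\<in>lat g. if \<forall>i<g. - freq v i = freq w i then coef t p w else 0) = 0"
      by (simp only: complex_cnj_zero mult_zero_right)
  qed
  finally show ?thesis .
qed

end

section \<open>The torus norm of Theta and its invariance\<close>

context theta_data
begin

lemma R_cong: "(\<And>i. i < g \<Longrightarrow> x i = x' i) \<Longrightarrow> R x = R x'"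
  by (auto simp: R_def intro!: bil_cong)

lemma coef_cong: "(\<And>i. i < g \<Longrightarrow> p i = p' i) \<Longrightarrow> coef t p v = coef t p' v"
  by (simp add: coef_def shift_def cong: R_cong)

lemma chi_cong: "(\<And>i. i < g \<Longrightarrow> q i = q' i) \<Longrightarrow> chi g k q = chi g k q'"
  by (simp add: chi_def)

lemma Theta_cong:
  "(\<And>i. i < g \<Longrightarrow> p i = p' i) \<Longrightarrow> (\<And>i. i < g \<Longrightarrow> q i = q' i) \<Longrightarrow> Theta t p q = Theta t p' q'"
  unfolding Theta_def Phi_def by (intro infsum_cong arg_cong2[where f = "(*)"] coef_cong chi_cong)

lemma measurable_R [measurable]:
  assumes "\<And>i. i < g \<Longrightarrow> (\<lambda>w. x w i) \<in> borel_measurable M"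
  shows "(\<lambda>w. R (x w)) \<in> borel_measurable M"
  unfolding R_def using assms by (intro borel_measurable_add borel_measurable_sum borel_measurable_times measurable_bil) auto

lemma measurable_Phi:
  assumes p: "\<And>i. i < g \<Longrightarrow> (\<lambda>w. p w i) \<in> borel_measurable M" and q: "\<And>i. i < g \<Longrightarrow> (\<lambda>w. q w i) \<in> borel_measurable M"
  shows "(\<lambda>w. Phi t v (p w) (q w)) \<in> borel_measurable M"
proof -
  have "(\<lambda>w. R (shift (p w) v)) \<in> borel_measurable M"
    using p by (intro measurable_R) (auto simp: shift_def)
  moreover have "(\<lambda>w. \<Sum>i<g. freq v i * q w i) \<in> borel_measurable M"
    using q by (intro borel_measurable_sum borel_measurable_times) auto
  ultimately show ?thesis unfolding Phi_def coef_def chi_def e2pi_def by measurable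
qed

lemma measurable_Theta:
  assumes "Im t > 0"
    "\<And>i. i < g \<Longrightarrow> (\<lambda>w. p w i) \<in> borel_measurable M" "\<And>i. i < g \<Longrightarrow> (\<lambda>w. q w i) \<in> borel_measurable M"
  shows "(\<lambda>w. Theta t (p w) (q w)) \<in> borel_measurable M"
  unfolding Theta_def using assms by (intro measurable_infsum countable_lat measurable_Phi Phi_summable)

lemma norm_Theta_le: "Im t > 0 \<Longrightarrow> norm (Theta t p q) \<le> (\<Sum>\<^sub>\<infinity>v\<in>lat g. norm (coef t p v))"
  unfolding Theta_def using norm_infsum_bound[OF Phi_summable[of t p q]] by (simp add: norm_Phi norm_coef)

lemma bij_betw_add_lat: "w \<in> lat g \<Longrightarrow> bij_betw (\<lambda>v. v + w) (lat g) (lat g)"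
proof (rule bij_betw_byWitness[where f' = "\<lambda>v. v - w"])
  assume w: "w \<in> lat g"
  show "\<forall>v\<in>lat g. v + w - w = v" "\<forall>v\<in>lat g. v - w + w = v"
    using w by (auto simp: vec_eq_iff)
qed auto

text \<open>Reindexing by \<open>w\<close> absorbs the shift at the cost of a character of
  \<open>q\<close> that does not depend on \<open>v\<close>. Hence it is the modulus that is
  periodic in \<open>p\<close>, and the modulus is what gets integrated.\<close>

lemma norm_Theta_shift_left:
  assumes w: "w \<in> lat g"
  shows "norm (Theta t (shift p w) q) = norm (Theta t p q)"
proof -
  define c where "c = chi g (\<lambda>i. - 2 * (\<Sum>j<g. A i j * of_int (w $ j))) q"
  have "Phi t v (shift p w) q = c * Phi t (v + w) p q" if v: "v \<in> lat g" for v
  proof -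
    have "coef t (shift p w) v = coef t p (v + w)"
      using v w unfolding coef_def by (intro arg_cong[where f = e2pi] arg_cong[where f = "\<lambda>x. t * complex_of_real x"] R_cong)
        (auto simp: shift_def)
    moreover have "chi g (freq v) q = c * chi g (freq (v + w)) q"
    proof -
      have fr: "freq (v + w) i = freq v i + 2 * (\<Sum>j<g. A i j * of_int (w $ j))" if "i < g" for i
        using v w by (simp add: freq_def distrib_left sum.distrib)
      have "c * chi g (freq (v + w)) q = e2pi (of_real (\<Sum>i<g. (- 2 * (\<Sum>j<g. A i j * of_int (w $ j))) * q i + freq (v + w) i * q i))"
        by (simp only: c_def chi_def e2pi_add[symmetric] of_real_add[symmetric] sum.distrib[symmetric])
      also have "\<dots> = chi g (freq v) q"
        unfolding chi_def by (intro arg_cong[where f = e2pi] arg_cong[where f = complex_of_real] sum.cong refl)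
          (simp add: fr algebra_simps)
      finally show ?thesis by simp
    qed
    ultimately show ?thesis by (simp add: Phi_def)
  qed
  then have "Theta t (shift p w) q = (\<Sum>\<^sub>\<infinity>v\<in>lat g. c * Phi t (v + w) p q)"
    unfolding Theta_def by (intro infsum_cong) auto
  also have "\<dots> = c * (\<Sum>\<^sub>\<infinity>v\<in>lat g. Phi t (v + w) p q)" by (rule infsum_cmult_right')
  also have "(\<Sum>\<^sub>\<infinity>v\<in>lat g. Phi t (v + w) p q) = Theta t p q"
    unfolding Theta_def by (rule infsum_reindex_bij_betw[OF bij_betw_add_lat[OF w]])
  finally show ?thesis by (simp add: norm_mult c_def)
qed

text \<open>Integrality of \<open>2m\<close> and \<open>r\<close> makes every frequency pair
  integrally with the shift.\<close>

lemma Theta_shift_right: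
  assumes w: "w \<in> lat g"
  shows "Theta t p (shift q w) = Theta t p q"
proof -
  have "chi g (freq v) (shift q w) = chi g (freq v) q" for v
  proof -
    have "(\<Sum>i<g. freq v i * of_int (w $ i)) \<in> \<int>"
      by (intro Ints_sum Ints_mult freq_int) auto
    then have "e2pi (of_real (\<Sum>i<g. freq v i * of_int (w $ i))) = 1" by (rule e2pi_of_int)
    moreover have "chi g (freq v) (shift q w) = chi g (freq v) q * e2pi (of_real (\<Sum>i<g. freq v i * of_int (w $ i)))"
      unfolding chi_def by (simp flip: e2pi_add add: shift_def distrib_left sum.distrib)
    ultimately show ?thesis by simp
  qed
  then show ?thesis by (simp add: Theta_def Phi_def)
qed

text \<open>Closed form of the squared torus norm. It depends on the point only through its height,
  so at an SL(2,Z)-equivalent point it suffices to replace \<open>y\<close> by y/s.\<close>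

definition theta_norm2 :: "real \<Rightarrow> real" where
  "theta_norm2 y = exp (- (4 * pi * y) * \<Delta>) * (enn2real (gauss 1) * (4 * pi * y) powr (- real g / 2))"

lemma theta_norm2_pos: "y > 0 \<Longrightarrow> theta_norm2 y > 0"
  unfolding theta_norm2_def using gauss_pos gauss_finite[of 1]
  by (auto intro!: mult_pos_pos simp: enn2real_positive_iff)

text \<open>Unfolding: the lattice sum and the integral over the cube combine to a single Gaussian
  integral over the whole space, which scaling evaluates.\<close>

lemma integral_coef_square:
  assumes t: "Im t > 0"
  shows "(\<integral>\<^sup>+p. ennreal (\<Sum>\<^sub>\<infinity>v\<in>lat g. (norm (coef t p v))\<^sup>2) \<partial>box g) = ennreal (theta_norm2 (Im t))"
proof -
  define F where "F x = ennreal (exp (- (4 * pi * Im t) * R x))" for x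
  have F: "F \<in> borel_measurable (Leb g)" "local_fun g F"
    unfolding F_def by measurable (auto simp: local_fun_def intro!: arg_cong[where f = ennreal] R_cong)
  have "ennreal (\<Sum>\<^sub>\<infinity>v\<in>lat g. (norm (coef t p v))\<^sup>2) = (\<integral>\<^sup>+v. F (shift p v) \<partial>count_space (lat g))" for p
  proof -
    have "(\<integral>\<^sup>+v. ennreal ((norm (coef t p v))\<^sup>2) \<partial>count_space (lat g)) < \<infinity>"
      using nn_integral_count_space_finite_iff[where f = "\<lambda>v. complex_of_real ((norm (coef t p v))\<^sup>2)" and A = "lat g"]
        coef_square_summable[OF t, of p] by (simp add: norm_power)
    then show ?thesis
      using nn_integral_count_space_infsum(2)[where f = "\<lambda>v. (norm (coef t p v))\<^sup>2" and A = "lat g"]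
      by (simp add: F_def norm_coef_square)
  qed
  then have "(\<integral>\<^sup>+p. ennreal (\<Sum>\<^sub>\<infinity>v\<in>lat g. (norm (coef t p v))\<^sup>2) \<partial>box g) =
    (\<integral>\<^sup>+p. (\<integral>\<^sup>+v. F (shift p v) \<partial>count_space (lat g)) \<partial>box g)" by simp
  also have "\<dots> = (\<integral>\<^sup>+v. (\<integral>\<^sup>+p. F (shift p v) \<partial>box g) \<partial>count_space (lat g))"
    by (intro nn_integral_count_space_nn_integral countable_lat)
      (auto intro!: measurable_local_fun[OF F] simp: shift_def)
  also have "\<dots> = (\<integral>\<^sup>+x. F x \<partial>Leb g)" using nn_integral_Leb_tile[OF F] by simp
  also have "\<dots> = (\<integral>\<^sup>+x. ennreal (exp (- (4 * pi * Im t) * \<Delta>)) * ennreal (exp (- (4 * pi * Im t) * sq (\<lambda>i. \<rho> i + x i))) \<partial>Leb g)"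
    by (intro nn_integral_cong) (simp add: F_def R_eq algebra_simps flip: ennreal_mult exp_add)
  also have "\<dots> = ennreal (exp (- (4 * pi * Im t) * \<Delta>)) * gauss (4 * pi * Im t)"
    unfolding gauss_translate[of "4 * pi * Im t" \<rho>, symmetric] by (subst nn_integral_cmult) auto
  also have "\<dots> = ennreal (theta_norm2 (Im t))"
    using gauss_scale[of "4 * pi * Im t"] t by (simp add: theta_norm2_def ennreal_mult)
  finally show ?thesis .
qed

lemma integrable_bounded_Theta:
  assumes t: "Im t > 0" and f: "f \<in> borel_measurable (box g)" "\<And>q. norm (f q) \<le> C"
  shows "integrable (box g) (\<lambda>q. f q * cnj (Theta t p q))"
proof (rule box.integrable_const_bound[where B = "C * (\<Sum>\<^sub>\<infinity>v\<in>lat g. norm (coef t p v))"])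
  have "0 \<le> C" using f(2)[of undefined] norm_ge_zero order_trans by blast
  then show "AE q in box g. norm (f q * cnj (Theta t p q)) \<le> C * (\<Sum>\<^sub>\<infinity>v\<in>lat g. norm (coef t p v))"
    using f(2) norm_Theta_le[OF t] by (auto simp: norm_mult intro!: mult_mono)
  have "(\<lambda>q. Theta t p q) \<in> borel_measurable (box g)" by (rule measurable_Theta[OF t]) auto
  then have "(\<lambda>q. cnj (Theta t p q)) \<in> borel_measurable (box g)"
    by (rule measurable_compose) (auto intro!: borel_measurable_continuous_onI continuous_intros)
  then show "(\<lambda>q. f q * cnj (Theta t p q)) \<in> borel_measurable (box g)"
    using f(1) by (rule borel_measurable_times[rotated])
qed

lemma nn_integral_norm_Theta_square:
  assumes t: "Im t > 0"
  shows "(\<integral>\<^sup>+q. ennreal ((norm (Theta t p q))\<^sup>2) \<partial>box g) = ennreal (\<Sum>\<^sub>\<infinity>v\<in>lat g. (norm (coef t p v))\<^sup>2)"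
proof -
  have int: "integrable (box g) (\<lambda>q. Theta t p q * cnj (Theta t p q))"
    by (rule integrable_bounded_Theta[OF t _ norm_Theta_le[OF t]]) (rule measurable_Theta[OF t], auto)
  then have int': "integrable (box g) (\<lambda>q. (norm (Theta t p q))\<^sup>2)"
    by (simp only: complex_norm_square[symmetric] complex_of_real_integrable_eq)
  have "complex_of_real (\<integral>q. (norm (Theta t p q))\<^sup>2 \<partial>box g) = of_real (\<Sum>\<^sub>\<infinity>v\<in>lat g. (norm (coef t p v))\<^sup>2)"
    using Theta_inner[OF t, of p] by (simp only: complex_norm_square[symmetric] integral_complex_of_real)
  then have "(\<integral>q. (norm (Theta t p q))\<^sup>2 \<partial>box g) = (\<Sum>\<^sub>\<infinity>v\<in>lat g. (norm (coef t p v))\<^sup>2)" by simp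
  then show ?thesis using nn_integral_eq_integral[OF int'] by simp
qed

lemma torus_Theta:
  assumes t: "Im t > 0"
  shows "torus_function g (\<lambda>p q. ennreal ((norm (Theta t p q))\<^sup>2))"
proof
  have "(\<lambda>w. Theta t (fst w) (snd w)) \<in> borel_measurable (Leb g \<Otimes>\<^sub>M Leb g)"
    by (rule measurable_Theta[OF t]) auto
  then show "(\<lambda>(p, q). ennreal ((norm (Theta t p q))\<^sup>2)) \<in> borel_measurable (Leb g \<Otimes>\<^sub>M Leb g)"
    unfolding case_prod_unfold by measurable
  show "local_fun g (\<lambda>p. ennreal ((norm (Theta t p q))\<^sup>2))" for q
    unfolding local_fun_def by (intro allI impI arg_cong[where f = "\<lambda>z. ennreal ((cmod z)\<^sup>2)"] Theta_cong) auto
  show "local_fun g (\<lambda>q. ennreal ((norm (Theta t p q))\<^sup>2))" for p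
    unfolding local_fun_def by (intro allI impI arg_cong[where f = "\<lambda>z. ennreal ((cmod z)\<^sup>2)"] Theta_cong) auto
qed (simp_all add: norm_Theta_shift_left Theta_shift_right)

text \<open>The substitution has the matrix rows (d, -c) and (-b, a), again of determinant
  one.\<close>

lemma nn_integral_Theta_twist:
  fixes a b c d :: int
  assumes t: "Im t > 0" and det: "a * d - b * c = 1"
  shows "(\<integral>\<^sup>+p. (\<integral>\<^sup>+q. ennreal ((norm (Theta t (\<lambda>i. of_int d * p i - of_int c * q i) (\<lambda>i. of_int a * q i - of_int b * p i)))\<^sup>2) \<partial>box g) \<partial>box g) =
    ennreal (theta_norm2 (Im t))"
proof -
  interpret torus_function g "\<lambda>p q. ennreal ((norm (Theta t p q))\<^sup>2)" by (rule torus_Theta[OF t])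
  show ?thesis
    using nn_integral_torus_SL2[of d a "- c" "- b"] det
    by (simp add: nn_integral_norm_Theta_square[OF t] integral_coef_square[OF t] algebra_simps)
qed

text \<open>Cauchy-Schwarz on the product torus. Both norms are explicit because the twist leaves
  that of its factor unchanged.\<close>

lemma Theta_twist_Cauchy_Schwarz:
  fixes a b c d :: int
  assumes t: "Im t > 0" "Im t' > 0" and det: "a * d - b * c = 1"
  shows "(\<integral>\<^sup>+p. (\<integral>\<^sup>+q. ennreal (norm (Theta t' (\<lambda>i. of_int d * p i - of_int c * q i) (\<lambda>i. of_int a * q i - of_int b * p i)) * norm (Theta t p q)) \<partial>box g) \<partial>box g)
    \<le> ennreal (sqrt (theta_norm2 (Im t') * theta_norm2 (Im t)))"
proof -
  define f where "f w = ennreal (norm (Theta t' (\<lambda>i. of_int d * fst w i - of_int c * snd w i) (\<lambda>i. of_int a * snd w i - of_int b * fst w i)))" for w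
  define h where "h w = ennreal (norm (Theta t (fst w) (snd w)))" for w
  have "(\<lambda>w. Theta t' (\<lambda>i. of_int d * fst w i - of_int c * snd w i) (\<lambda>i. of_int a * snd w i - of_int b * fst w i)) \<in> borel_measurable (box g \<Otimes>\<^sub>M box g)"
    by (rule measurable_Theta[OF t(2)]) auto
  then have f [measurable]: "f \<in> borel_measurable (box g \<Otimes>\<^sub>M box g)" unfolding f_def by measurable
  have "(\<lambda>w. Theta t (fst w) (snd w)) \<in> borel_measurable (box g \<Otimes>\<^sub>M box g)"
    by (rule measurable_Theta[OF t(1)]) auto
  then have h [measurable]: "h \<in> borel_measurable (box g \<Otimes>\<^sub>M box g)" unfolding h_def by measurable
  define I where "I = (\<integral>\<^sup>+w. f w * h w \<partial>(box g \<Otimes>\<^sub>M box g))"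
  have pair: "(\<integral>\<^sup>+w. F w \<partial>(box g \<Otimes>\<^sub>M box g)) = (\<integral>\<^sup>+p. (\<integral>\<^sup>+q. F (p, q) \<partial>box g) \<partial>box g)"
    if "F \<in> borel_measurable (box g \<Otimes>\<^sub>M box g)" for F :: "_ \<Rightarrow> ennreal"
    using box.nn_integral_fst[OF that] by simp
  have "I\<^sup>2 \<le> (\<integral>\<^sup>+w. (f w)\<^sup>2 \<partial>(box g \<Otimes>\<^sub>M box g)) * (\<integral>\<^sup>+w. (h w)\<^sup>2 \<partial>(box g \<Otimes>\<^sub>M box g))"
    unfolding I_def by (rule Cauchy_Schwarz_nn_integral[OF f h])
  also have "(\<integral>\<^sup>+w. (f w)\<^sup>2 \<partial>(box g \<Otimes>\<^sub>M box g)) = ennreal (theta_norm2 (Im t'))"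
    using nn_integral_Theta_twist[OF t(2) det] by (subst pair, measurable) (simp add: f_def ennreal_power)
  also have "(\<integral>\<^sup>+w. (h w)\<^sup>2 \<partial>(box g \<Otimes>\<^sub>M box g)) = ennreal (theta_norm2 (Im t))"
    by (subst pair, measurable) (simp add: h_def ennreal_power nn_integral_norm_Theta_square[OF t(1)] integral_coef_square[OF t(1)])
  also have "ennreal (theta_norm2 (Im t')) * ennreal (theta_norm2 (Im t)) = ennreal (theta_norm2 (Im t') * theta_norm2 (Im t))"
    using theta_norm2_pos t by (intro ennreal_mult[symmetric]) (auto intro: less_imp_le)
  finally have I2: "I\<^sup>2 \<le> ennreal (theta_norm2 (Im t') * theta_norm2 (Im t))" .
  have "I \<le> ennreal (sqrt (theta_norm2 (Im t') * theta_norm2 (Im t)))"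
  proof (cases I)
    case (real x)
    then have "x\<^sup>2 \<le> theta_norm2 (Im t') * theta_norm2 (Im t)"
      using I2 theta_norm2_pos[OF t(1)] theta_norm2_pos[OF t(2)] by (simp add: ennreal_power ennreal_le_iff)
    then show ?thesis using real by (simp add: ennreal_leI real_le_rsqrt)
  next
    case top
    then show ?thesis using I2 by (simp add: power2_eq_square ennreal_mult_top top_unique)
  qed
  moreover have "I = (\<integral>\<^sup>+p. (\<integral>\<^sup>+q. ennreal (norm (Theta t' (\<lambda>i. of_int d * p i - of_int c * q i) (\<lambda>i. of_int a * q i - of_int b * p i)) * norm (Theta t p q)) \<partial>box g) \<partial>box g)"
    unfolding I_def by (subst pair, measurable) (simp add: f_def h_def ennreal_mult)
  ultimately show ?thesis by simp
qed

text \<open>The congruence says r = A l. Then v -> -v - l is an involution of the lattice that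
  reverses the frequencies and matches the values of \<open>R\<close> at the reflected
  points.\<close>

lemma Theta_neg_eq:
  assumes cong0
  shows "Theta t (\<lambda>i. - p i) (\<lambda>i. - q i) = Theta t p q"
proof -
  obtain l where l: "l \<in> lat g" "\<And>i. i < g \<Longrightarrow> of_int (r i) = (\<Sum>j<g. A i j * of_int (l $ j))"
    using assms unfolding cong0_def by auto
  have bij: "bij_betw (\<lambda>v. - v - l) (lat g) (lat g)"
    using l(1) by (intro bij_betw_byWitness[where f' = "\<lambda>v. - v - l"]) (auto simp: vec_eq_iff)
  have "Phi t v (\<lambda>i. - p i) (\<lambda>i. - q i) = Phi t (- v - l) p q" if v: "v \<in> lat g" for v
  proof -
    define x where "x = shift (\<lambda>i. - p i) v"
    define L where "L i = real_of_int (l $ i)" for i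
    have r_x: "(\<Sum>i<g. of_int (r i) * y i) = bil g A y L" for y
      unfolding bil_altdef by (intro sum.cong refl) (simp add: l(2) L_def)
    have "R (shift p (- v - l)) = R (\<lambda>i. - (x i + L i))"
      using v l(1) by (intro R_cong) (simp add: shift_def x_def L_def)
    also have "\<dots> = R x"
      unfolding R_def r_x
      by (simp only: bil_minus_left bil_minus_right bil_add_left bil_add_right bil_commute[of L x])
    finally have "coef t (\<lambda>i. - p i) v = coef t p (- v - l)" by (simp add: coef_def x_def)
    moreover have "chi g (freq v) (\<lambda>i. - q i) = chi g (freq (- v - l)) q"
    proof -
      have "freq (- v - l) i = - freq v i" if "i < g" for i
        using v l that by (simp add: freq_def sum_negf sum_subtractf right_diff_distrib l(2)[symmetric])
      then show ?thesis by (simp add: chi_def)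
    qed
    ultimately show ?thesis by (simp add: Phi_def)
  qed
  then have "Theta t (\<lambda>i. - p i) (\<lambda>i. - q i) = (\<Sum>\<^sub>\<infinity>v\<in>lat g. Phi t (- v - l) p q)"
    unfolding Theta_def by (intro infsum_cong) auto
  also have "\<dots> = Theta t p q" unfolding Theta_def by (rule infsum_reindex_bij_betw[OF bij])
  finally show ?thesis .
qed

text \<open>\<open>e\<close> will be the sign (-1)^(-k) of the row \<open>(0, -1)\<close>. There is
  a dichotomy: without the congruence the reflected series is orthogonal to \<Theta>; with it the
  two coincide and \<open>e = 1\<close> doubles the pairing. The lower bound holds either
  way.\<close>

lemma main_term_lower:
  assumes t: "Im t > 0" and e: "cong0 \<Longrightarrow> e = 1" "norm e = 1"
  shows "ennreal (\<Sum>\<^sub>\<infinity>v\<in>lat g. (norm (coef t p v))\<^sup>2) \<le>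
    (\<integral>\<^sup>+q. ennreal (norm (Theta t p q + e * Theta t (\<lambda>i. - p i) (\<lambda>i. - q i)) * norm (Theta t p q)) \<partial>box g)"
proof -
  define S where "S = (\<Sum>\<^sub>\<infinity>v\<in>lat g. (norm (coef t p v))\<^sup>2)"
  define f where "f q = Theta t p q" for q
  define f' where "f' q = Theta t (\<lambda>i. - p i) (\<lambda>i. - q i)" for q
  have S: "0 \<le> S" unfolding S_def by (rule infsum_nonneg) simp
  have fm: "f \<in> borel_measurable (box g)" "f' \<in> borel_measurable (box g)"
    unfolding f_def f'_def by (rule measurable_Theta[OF t]; auto)+
  have int1: "integrable (box g) (\<lambda>q. f q * cnj (Theta t p q))"
    by (rule integrable_bounded_Theta[OF t fm(1)]) (unfold f_def, rule norm_Theta_le[OF t])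
  have int2: "integrable (box g) (\<lambda>q. f' q * cnj (Theta t p q))"
    by (rule integrable_bounded_Theta[OF t fm(2)]) (unfold f'_def, rule norm_Theta_le[OF t])
  have "(\<integral>q. (f q + e * f' q) * cnj (Theta t p q) \<partial>box g) =
    (\<integral>q. f q * cnj (Theta t p q) \<partial>box g) + e * (\<integral>q. f' q * cnj (Theta t p q) \<partial>box g)"
    using int1 int2 by (simp add: distrib_right mult.assoc)
  also have "(\<integral>q. f q * cnj (Theta t p q) \<partial>box g) = of_real S"
    unfolding f_def S_def by (rule Theta_inner[OF t])
  also have "(\<integral>q. f' q * cnj (Theta t p q) \<partial>box g) = (if cong0 then of_real S else 0)"
    using Theta_neg_inner[OF t] Theta_inner[OF t] by (simp add: f'_def S_def Theta_neg_eq)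
  also have "of_real S + e * (if cong0 then of_real S else 0) = of_real (if cong0 then 2 * S else S)"
    using e(1) by simp
  finally have eq: "(\<integral>q. (f q + e * f' q) * cnj (Theta t p q) \<partial>box g) = of_real (if cong0 then 2 * S else S)" .
  have "ennreal S \<le> ennreal (norm (\<integral>q. (f q + e * f' q) * cnj (Theta t p q) \<partial>box g))"
    unfolding eq using S by (intro ennreal_leI) simp
  also have "\<dots> \<le> (\<integral>\<^sup>+q. ennreal (norm ((f q + e * f' q) * cnj (Theta t p q))) \<partial>box g)"
    using int1 int2 by (intro integral_norm_bound_ennreal) (simp add: distrib_right mult.assoc)
  finally show ?thesis by (simp add: S_def f_def f'_def norm_mult)
qed

end

section \<open>Cosets of the Jacobi group\<close>

lemma det_mat2:
  fixes M :: "'a::comm_ring_1 mat"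
  assumes M: "M \<in> carrier_mat 2 2"
  shows "det M = M $$ (0,0) * M $$ (1,1) - M $$ (0,1) * M $$ (1,0)"
proof -
  have dim: "mat_delete M 0 j \<in> carrier_mat 1 1" for j
    using M by (auto simp: mat_delete_def)
  have c: "cofactor M 0 0 = M $$ (1,1)" "cofactor M 0 1 = - M $$ (1,0)"
    using M by (simp_all add: cofactor_def det_single[OF dim]) (simp_all add: mat_delete_def)
  have "det M = (\<Sum>j<2. M $$ (0,j) * cofactor M 0 j)"
    by (rule laplace_expansion_row[OF M]) simp
  also have "\<dots> = M $$ (0,0) * cofactor M 0 0 + M $$ (0,1) * cofactor M 0 1"
    by (simp add: numeral_2_eq_2)
  finally show ?thesis unfolding c by simp
qed

lemma mat2_eqI:
  assumes "M \<in> carrier_mat 2 2" "N \<in> carrier_mat 2 2"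
    "M $$ (0,0) = N $$ (0,0)" "M $$ (0,1) = N $$ (0,1)" "M $$ (1,0) = N $$ (1,0)" "M $$ (1,1) = N $$ (1,1)"
  shows "M = N"
  using assms by (intro eq_matI) (auto simp: less_Suc_eq numeral_2_eq_2)

lemma mat2_mult:
  fixes M N :: "'a::comm_ring_1 mat"
  assumes "M \<in> carrier_mat 2 2" "N \<in> carrier_mat 2 2" "i < 2" "j < 2"
  shows "(M * N) $$ (i, j) = M $$ (i,0) * N $$ (0,j) + M $$ (i,1) * N $$ (1,j)"
  using assms by (simp add: scalar_prod_def numeral_2_eq_2)

lemma upper_unipotent_mat:
  "mat_of_rows_list 2 [[1, b], [0, 1 :: int]] \<in> carrier_mat 2 2"
  "mat_of_rows_list 2 [[1, b], [0, 1]] $$ (0,0) = (1::int)"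
  "mat_of_rows_list 2 [[1, b], [0, 1]] $$ (0,1) = (b::int)"
  "mat_of_rows_list 2 [[1, b], [0, 1]] $$ (1,0) = (0::int)"
  "mat_of_rows_list 2 [[1, b], [0, 1]] $$ (1,1) = (1::int)"
  by (auto simp: mat_of_rows_list_def)

text \<open>The bottom row of M together with the first component of (\<lambda>, \<mu>) M^(-1). Left
  multiplication by \<open>jacobi_group_inf\<close> changes only the top row and the second
  component.\<close>

definition coset_inv :: "jacobi \<Rightarrow> (int \<times> int) \<times> int vec" where
  "coset_inv = (\<lambda>(M, l, u). ((M $$ (1,0), M $$ (1,1)), M $$ (1,1) \<cdot>\<^sub>v l - M $$ (1,0) \<cdot>\<^sub>v u))"

text \<open>Two completions of the bottom row \<open>(c, d)\<close> differ by a multiple of it, and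
  the multiple is the determinant formed by the two top rows.\<close>

lemma sl2_row_relation:
  fixes a b c d a' b' :: int
  assumes "a * d - b * c = 1" "a' * d - b' * c = 1"
  shows "a' = a + (a * b' - a' * b) * c" "b' = b + (a * b' - a' * b) * d"
proof -
  have "a + (a * b' - a' * b) * c = a * (1 - (a' * d - b' * c)) + a' * (a * d - b * c)"
    "b + (a * b' - a' * b) * d = b * (1 - (a' * d - b' * c)) + b' * (a * d - b * c)"
    by (simp_all add: algebra_simps)
  then show "a' = a + (a * b' - a' * b) * c" "b' = b + (a * b' - a' * b) * d"
    unfolding assms by simp_all
qed

text \<open>A pair \<open>(y, x)\<close> proportional to \<open>(c, d)\<close> is an integral
  multiple of it, and the Bezout relation computes the multiple.\<close>

lemma sl2_row_solve:
  fixes a b c d x y :: int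
  assumes "a * d - b * c = 1" "d * y = c * x"
  shows "c * (a * x - b * y) = y" "d * (a * x - b * y) = x"
proof -
  have "c * (a * x - b * y) = a * (c * x - d * y) + (a * d - b * c) * y"
    "d * (a * x - b * y) = (a * d - b * c) * x + b * (c * x - d * y)"
    by (simp_all add: algebra_simps)
  then show "c * (a * x - b * y) = y" "d * (a * x - b * y) = x"
    unfolding assms by simp_all
qed

text \<open>One inclusion is the invariance of \<open>coset_inv\<close>. For the other, the element
  of the stabiliser is reconstructed from the two top rows and from the proportionality of the
  vector differences to the bottom row.\<close>

lemma jacobi_coset_eq:
  assumes x: "x \<in> carrier (jacobi_group g)"
  shows "jacobi_group_inf g #>\<^bsub>jacobi_group g\<^esub> x = {y \<in> carrier (jacobi_group g). coset_inv y = coset_inv x}"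
proof -
  obtain M l u where x_eq: "x = (M, l, u)" by (cases x)
  have M: "M \<in> carrier_mat 2 2" "det M = 1" and lu: "l \<in> lat g" "u \<in> lat g"
    using x by (auto simp: x_eq jacobi_group_def)
  define a b c d where "a = M $$ (0,0)" "b = M $$ (0,1)" "c = M $$ (1,0)" "d = M $$ (1,1)"
  note abcd = this
  have det: "a * d - b * c = 1" using det_mat2[OF M(1)] M(2) by (simp add: abcd)
  define T :: "int \<Rightarrow> int mat" where "T j = mat_of_rows_list 2 [[1, j], [0, 1]]" for j
  have T: "T j \<in> carrier_mat 2 2" for j by (simp add: T_def upper_unipotent_mat)
  have TM: "(T j * M) $$ (0,0) = a + j * c" "(T j * M) $$ (0,1) = b + j * d"
    "(T j * M) $$ (1,0) = c" "(T j * M) $$ (1,1) = d" for j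
    by (simp_all add: mat2_mult[OF T M(1)]) (simp_all add: T_def upper_unipotent_mat[unfolded One_nat_def] abcd)
  have TMc: "T j * M \<in> carrier_mat 2 2" for j using T M(1) by (rule mult_carrier_mat)
  have TMdet: "det (T j * M) = 1" for j
    unfolding det_mat2[OF TMc] TM using det by (simp add: algebra_simps)
  have coset: "jacobi_group_inf g #>\<^bsub>jacobi_group g\<^esub> x =
    {(T j * M, (a \<cdot>\<^sub>v 0\<^sub>v g + c \<cdot>\<^sub>v w) + l, (b \<cdot>\<^sub>v 0\<^sub>v g + d \<cdot>\<^sub>v w) + u) | j w. w \<in> lat g}"
  proof -
    have "jacobi_group_inf g = {(T j, 0\<^sub>v g, w) | j w. w \<in> lat g}"
      by (simp add: jacobi_group_inf_def T_def)
    moreover have "(T j, 0\<^sub>v g, w) \<otimes>\<^bsub>jacobi_group g\<^esub> x =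
      (T j * M, (a \<cdot>\<^sub>v 0\<^sub>v g + c \<cdot>\<^sub>v w) + l, (b \<cdot>\<^sub>v 0\<^sub>v g + d \<cdot>\<^sub>v w) + u)" for j w
      by (simp add: jacobi_group_def x_eq abcd)
    ultimately show ?thesis unfolding r_coset_def by force
  qed
  show ?thesis
  proof (intro equalityI subsetI)
    fix y assume "y \<in> jacobi_group_inf g #>\<^bsub>jacobi_group g\<^esub> x"
    then obtain j w where w: "w \<in> lat g"
      and y: "y = (T j * M, (a \<cdot>\<^sub>v 0\<^sub>v g + c \<cdot>\<^sub>v w) + l, (b \<cdot>\<^sub>v 0\<^sub>v g + d \<cdot>\<^sub>v w) + u)"
      unfolding coset by blast
    have "coset_inv y = coset_inv x"
      unfolding y coset_inv_def x_eq using w lu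
      by (auto simp: TM[unfolded One_nat_def] abcd[symmetric, unfolded One_nat_def] vec_eq_iff algebra_simps)
    moreover have "y \<in> carrier (jacobi_group g)"
      unfolding y using w lu TMc TMdet by (auto simp: jacobi_group_def)
    ultimately show "y \<in> {y \<in> carrier (jacobi_group g). coset_inv y = coset_inv x}" by simp
  next
    fix y assume "y \<in> {y \<in> carrier (jacobi_group g). coset_inv y = coset_inv x}"
    then have yc: "y \<in> carrier (jacobi_group g)" and inv: "coset_inv y = coset_inv x" by auto
    obtain M' l' u' where y: "y = (M', l', u')" by (cases y)
    have M': "M' \<in> carrier_mat 2 2" "det M' = 1" and lu': "l' \<in> lat g" "u' \<in> lat g"
      using yc by (auto simp: y jacobi_group_def)
    have cd: "M' $$ (1,0) = c" "M' $$ (1,1) = d"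
      using inv by (simp_all add: coset_inv_def y x_eq abcd)
    define a' b' where "a' = M' $$ (0,0)" "b' = M' $$ (0,1)"
    note ab' = this
    have det': "a' * d - b' * c = 1" using det_mat2[OF M'(1)] M'(2) cd by (simp add: ab')
    \<comment> \<open>\<open>j\<close> and the vector \<open>w\<close> below are the coordinates of
      the element of \<open>jacobi_group_inf\<close> that carries \<open>x\<close> to
      \<open>y\<close>.\<close>
    define j where "j = a * b' - a' * b"
    have j: "a' = a + j * c" "b' = b + j * d"
    proof -
      show "a' = a + j * c" unfolding j_def by (rule sl2_row_relation(1)[OF det det'])
      show "b' = b + j * d" unfolding j_def by (rule sl2_row_relation(2)[OF det det'])
    qed
    have M'_eq: "M' = T j * M"
      by (rule mat2_eqI[OF M'(1) TMc]) (simp_all only: TM cd j ab'[symmetric])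
    define w where "w = a \<cdot>\<^sub>v (u' - u) - b \<cdot>\<^sub>v (l' - l)"
    have w: "w \<in> lat g" using lu lu' by (simp add: w_def)
    have rel: "d * (l' $ i - l $ i) = c * (u' $ i - u $ i)" if "i < g" for i
    proof -
      have "d \<cdot>\<^sub>v l' - c \<cdot>\<^sub>v u' = d \<cdot>\<^sub>v l - c \<cdot>\<^sub>v u"
        using inv by (simp add: coset_inv_def y x_eq cd[unfolded One_nat_def] abcd)
      from arg_cong[OF this, of "\<lambda>v. v $ i"] show ?thesis using that lu lu' by (simp add: algebra_simps)
    qed
    have lw: "l' = (a \<cdot>\<^sub>v 0\<^sub>v g + c \<cdot>\<^sub>v w) + l"
    proof (rule eq_vecI)
      show "dim_vec l' = dim_vec ((a \<cdot>\<^sub>v 0\<^sub>v g + c \<cdot>\<^sub>v w) + l)" using lu lu' w by simp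
      fix i assume "i < dim_vec ((a \<cdot>\<^sub>v 0\<^sub>v g + c \<cdot>\<^sub>v w) + l)"
      then have i: "i < g" using lu by simp
      have "c * (a * (u' $ i - u $ i) - b * (l' $ i - l $ i)) = l' $ i - l $ i"
        by (rule sl2_row_solve(1)[OF det rel[OF i]])
      then show "l' $ i = ((a \<cdot>\<^sub>v 0\<^sub>v g + c \<cdot>\<^sub>v w) + l) $ i"
        using i lu lu' by (simp add: w_def)
    qed
    have uw: "u' = (b \<cdot>\<^sub>v 0\<^sub>v g + d \<cdot>\<^sub>v w) + u"
    proof (rule eq_vecI)
      show "dim_vec u' = dim_vec ((b \<cdot>\<^sub>v 0\<^sub>v g + d \<cdot>\<^sub>v w) + u)" using lu lu' w by simp
      fix i assume "i < dim_vec ((b \<cdot>\<^sub>v 0\<^sub>v g + d \<cdot>\<^sub>v w) + u)"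
      then have i: "i < g" using lu by simp
      have "d * (a * (u' $ i - u $ i) - b * (l' $ i - l $ i)) = u' $ i - u $ i"
        by (rule sl2_row_solve(2)[OF det rel[OF i]])
      then show "u' $ i = ((b \<cdot>\<^sub>v 0\<^sub>v g + d \<cdot>\<^sub>v w) + u) $ i"
        using i lu lu' by (simp add: w_def)
    qed
    show "y \<in> jacobi_group_inf g #>\<^bsub>jacobi_group g\<^esub> x"
      unfolding coset y M'_eq using lw uw w by blast
  qed
qed

definition bottom_rows :: "(int \<times> int) set" where
  "bottom_rows = {(c, d). coprime c d}"

abbreviation (input) jacobi_cosets :: "nat \<Rightarrow> jacobi set set" where
  "jacobi_cosets g \<equiv> rcosets\<^bsub>jacobi_group g\<^esub> (jacobi_group_inf g)"

lemma some_in_rcoset_carrier: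
  "C \<in> jacobi_cosets g \<Longrightarrow> (SOME \<gamma>. \<gamma> \<in> C) \<in> carrier (jacobi_group g)"
proof -
  assume "C \<in> jacobi_cosets g"
  then obtain x where x: "x \<in> carrier (jacobi_group g)" "C = jacobi_group_inf g #>\<^bsub>jacobi_group g\<^esub> x"
    unfolding RCOSETS_def by blast
  have "(SOME \<gamma>. \<gamma> \<in> C) \<in> C" by (rule someI[of _ x]) (simp add: jacobi_coset_eq x)
  then show ?thesis using jacobi_coset_eq[OF x(1)] x(2) by simp
qed

text \<open>Turns the coset sum into a sum over coprime rows and lattice vectors. Whatever
  \<open>SOME\<close> picks, its invariant is that of the coset.\<close>

lemma bij_betw_coset_inv:
  "bij_betw (\<lambda>C. coset_inv (SOME \<gamma>. \<gamma> \<in> C)) (jacobi_cosets g) (bottom_rows \<times> lat g)"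
proof -
  let ?G = "jacobi_group g" and ?H = "jacobi_group_inf g"
  have some: "(SOME \<gamma>. \<gamma> \<in> C) \<in> C" "C = {y \<in> carrier ?G. coset_inv y = coset_inv (SOME \<gamma>. \<gamma> \<in> C)}"
    if CR: "C \<in> jacobi_cosets g" for C
  proof -
    obtain x where x: "x \<in> carrier ?G" "C = ?H #>\<^bsub>?G\<^esub> x" using CR unfolding RCOSETS_def by blast
    have C: "C = {y \<in> carrier ?G. coset_inv y = coset_inv x}" using jacobi_coset_eq[OF x(1)] x(2) by simp
    show "(SOME \<gamma>. \<gamma> \<in> C) \<in> C" by (rule someI[of _ x]) (simp add: C x)
    then show "C = {y \<in> carrier ?G. coset_inv y = coset_inv (SOME \<gamma>. \<gamma> \<in> C)}" using C by auto
  qed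
  show ?thesis
    unfolding bij_betw_def
  proof (intro conjI equalityI subsetI)
    show "inj_on (\<lambda>C. coset_inv (SOME \<gamma>. \<gamma> \<in> C)) (jacobi_cosets g)"
    proof (rule inj_onI)
      fix C D assume CD: "C \<in> jacobi_cosets g" "D \<in> jacobi_cosets g"
        and eq: "coset_inv (SOME \<gamma>. \<gamma> \<in> C) = coset_inv (SOME \<gamma>. \<gamma> \<in> D)"
      have "C = {y \<in> carrier ?G. coset_inv y = coset_inv (SOME \<gamma>. \<gamma> \<in> D)}"
        using some(2)[OF CD(1)] unfolding eq .
      also have "\<dots> = D" by (rule some(2)[OF CD(2), symmetric])
      finally show "C = D" .
    qed
  next
    fix y assume "y \<in> (\<lambda>C. coset_inv (SOME \<gamma>. \<gamma> \<in> C)) ` (jacobi_cosets g)"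
    then obtain C where C: "C \<in> jacobi_cosets g" "y = coset_inv (SOME \<gamma>. \<gamma> \<in> C)" by auto
    obtain M l u where Mlu: "(SOME \<gamma>. \<gamma> \<in> C) = (M, l, u)" by (cases "SOME \<gamma>. \<gamma> \<in> C")
    have "(M, l, u) \<in> carrier ?G" using some_in_rcoset_carrier[OF C(1)] by (simp only: Mlu)
    then have M: "M \<in> carrier_mat 2 2" "det M = 1" "l \<in> lat g" "u \<in> lat g" by (auto simp: jacobi_group_def)
    then have "M $$ (0,0) * M $$ (1,1) - M $$ (0,1) * M $$ (1,0) = 1" by (simp add: det_mat2)
    then have "coprime (M $$ (1,0)) (M $$ (1,1))"
      by (intro coprimeI) (metis dvd_diff dvd_mult)
    then show "y \<in> bottom_rows \<times> lat g"
      using M by (auto simp: C(2) Mlu coset_inv_def bottom_rows_def)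
  next
    fix y assume "y \<in> bottom_rows \<times> lat g"
    then obtain c d v where y: "y = ((c, d), v)" and cd: "coprime c d" and v: "v \<in> lat g" by (auto simp: bottom_rows_def)
    obtain a' b' where "a' * c + b' * d = 1" using bezout_int[of c d] cd by (metis coprime_imp_gcd_eq_1)
    then have "b' * d - (- a') * c = 1" by (simp add: algebra_simps)
    then obtain a b where ab: "a * d - b * c = 1" by blast
    define M where "M = mat_of_rows_list 2 [[a, b], [c, d]]"
    have M: "M \<in> carrier_mat 2 2" "M $$ (0,0) = a" "M $$ (0,1) = b" "M $$ (1,0) = c" "M $$ (1,1) = d"
      by (auto simp: M_def mat_of_rows_list_def)
    \<comment> \<open>The pair (a v, b v) is (v, 0) M, whose invariant is \<open>v\<close>.\<close>
    define x where "x = (M, a \<cdot>\<^sub>v v, b \<cdot>\<^sub>v v)"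
    have x: "x \<in> carrier ?G"
      using M v ab by (auto simp: x_def jacobi_group_def det_mat2[OF M(1)] mult.commute)
    have inv: "coset_inv x = y"
    proof -
      have "d * (a * k) - c * (b * k) = k" for k
      proof -
        have "d * (a * k) - c * (b * k) = (a * d - b * c) * k" by (simp add: algebra_simps)
        then show ?thesis using ab by simp
      qed
      then show ?thesis using M v by (auto simp: coset_inv_def x_def y vec_eq_iff)
    qed
    have C: "?H #>\<^bsub>?G\<^esub> x \<in> jacobi_cosets g" using x by (auto simp: RCOSETS_def)
    have "coset_inv (SOME \<gamma>. \<gamma> \<in> ?H #>\<^bsub>?G\<^esub> x) = y"
      using some(1)[OF C] unfolding jacobi_coset_eq[OF x] by (simp add: inv)
    then show "y \<in> (\<lambda>C. coset_inv (SOME \<gamma>. \<gamma> \<in> C)) ` (jacobi_cosets g)" using C by (metis image_eqI)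
  qed
qed

section \<open>The slash action in theta coordinates\<close>

text \<open>Here \<open>i\<close> stands for 1/J, not for the imaginary unit; the double capitals
  are values of the bilinear form and \<open>rP\<close>, \<open>rQ\<close>, \<open>rL\<close>,
  \<open>rN\<close> those of the linear form \<open>r\<close>. In terms of the transformed point x =
  T i one has i = a - c x and i t = d x - b, and these relations make the coefficient of every form
  value vanish separately. The last line of the right side will be an integer.\<close>

lemma jacobi_exponent_identity:
  fixes a b c d t J T i PP PQ QQ PL QL PN QN LL LN NN rP rQ rL rN n :: complex
  assumes J: "J = c * t + d" and T: "T = a * t + b" and i: "J * i = 1" and det: "a * d - b * c = 1"
  shows "- c * i * (t * t * PP + 2 * t * PQ + QQ + T * T * LL + J * J * NN + 2 * T * J * LN
        + 2 * t * T * PL + 2 * t * J * PN + 2 * T * QL + 2 * J * QN)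
      + (a * a * LL + 2 * a * c * LN + c * c * NN) * t + 2 * (a * t * PL + a * QL + c * t * PN + c * QN)
      + n * (T * i) + (t * rP + rQ + T * rL + J * rN) * i
    = (- t * PP - (b * d * PP - 2 * b * c * PQ + a * c * QQ))
      + (T * i) * (LL + 2 * (d * PL - c * QL) + (d * d * PP - 2 * c * d * PQ + c * c * QQ) + (rL + d * rP - c * rQ) + n)
      + (2 * (a * QL - b * PL) + (a * rQ - b * rP))
      + (rN - c * d * NN - 2 * c * b * LN - a * b * LL)" (is "?lhs = ?rhs")
proof -
  define x where "x = T * i"
  have aJ: "a * J - c * T = 1" using det by (simp add: J T algebra_simps)
  have dT: "d * T - b * J = t"
  proof -
    have "d * T - b * J = (a * d - b * c) * t" by (simp add: J T algebra_simps)
    then show ?thesis by (simp add: det)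
  qed
  have A1: "i = a - c * x"
  proof -
    have "a - c * x = (a * J - c * T) * i" using i by (simp add: x_def algebra_simps)
    then show ?thesis by (simp add: aJ)
  qed
  have A2: "i * t = d * x - b"
  proof -
    have "d * x - b = (d * T - b * J) * i" using i by (simp add: x_def algebra_simps)
    then show ?thesis unfolding dT by (simp add: mult.commute)
  qed
  have xJ: "x * J = T" using i by (simp add: x_def mult_ac)
  have kPP: "- c * i * t * t + t + b * d - x * d * d = 0"
  proof -
    have "- c * i * t * t + t + b * d - x * d * d = - c * i * t * t + t - d * (d * x - b)" by (simp add: algebra_simps)
    also have "\<dots> = - c * i * t * t + t - d * (i * t)" by (simp add: A2)
    also have "\<dots> = t * (1 - J * i)" by (simp add: J algebra_simps)
    finally show ?thesis by (simp add: i)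
  qed
  have kPQ: "- c * i * t - b * c + x * c * d = 0"
  proof -
    have "- c * i * t - b * c + x * c * d = c * (d * x - b - i * t)" by (simp add: algebra_simps)
    then show ?thesis by (simp add: A2)
  qed
  have kQQ: "- c * i + a * c - x * c * c = 0"
  proof -
    have "- c * i + a * c - x * c * c = c * ((a - c * x) - i)" by (simp add: algebra_simps)
    then show ?thesis by (simp add: A1[symmetric])
  qed
  have kLL: "- c * i * T * T + a * a * t - x + a * b = 0"
  proof -
    have "- c * i * T * T + a * a * t - x + a * b = T * (a - c * x) - x" by (simp add: T x_def algebra_simps)
    then show ?thesis unfolding A1[symmetric] by (simp add: x_def)
  qed
  have kNN: "- c * i * J * J + c * c * t + c * d = 0"
  proof -
    have "- c * i * J * J + c * c * t + c * d = c * J * (1 - J * i)" by (simp add: J algebra_simps)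
    then show ?thesis by (simp add: i)
  qed
  have kLN: "- c * i * T * J + a * c * t + c * b = 0"
  proof -
    have "- c * i * T * J + a * c * t + c * b = c * T * (1 - J * i)" by (simp add: T algebra_simps)
    then show ?thesis by (simp add: i)
  qed
  have kPL: "- c * i * t * T + a * t - x * d + b = 0"
  proof -
    have "- c * i * t * T + a * t - x * d + b = t * (a - c * x) - (d * x - b)" by (simp add: x_def algebra_simps)
    then show ?thesis by (simp add: A1[symmetric] A2[symmetric] mult.commute)
  qed
  have kPN: "- c * i * t * J + c * t = 0"
  proof -
    have "- c * i * t * J + c * t = c * t * (1 - J * i)" by (simp add: algebra_simps)
    then show ?thesis by (simp add: i)
  qed
  have kQN: "- c * i * J + c = 0"
  proof -
    have "- c * i * J + c = c * (1 - J * i)" by (simp add: algebra_simps)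
    then show ?thesis by (simp add: i)
  qed
  have kQL: "- c * i * T + x * c = 0" by (simp add: x_def mult_ac)
  have krP: "i * t - d * x + b = 0" by (simp add: A2)
  have krQ: "i + c * x - a = 0" using A1 by simp
  have krN: "J * i - 1 = 0" by (simp add: i)
  have "?lhs - ?rhs =
    (- c * i * t * t + t + b * d - x * d * d) * PP + 2 * (- c * i * t - b * c + x * c * d) * PQ
    + (- c * i + a * c - x * c * c) * QQ + (- c * i * T * T + a * a * t - x + a * b) * LL
    + (- c * i * J * J + c * c * t + c * d) * NN + 2 * (- c * i * T * J + a * c * t + c * b) * LN
    + 2 * (- c * i * t * T + a * t - x * d + b) * PL + 2 * (- c * i * t * J + c * t) * PN
    + 2 * (- c * i * J + c) * QN + 2 * (- c * i * T + x * c) * QL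
    + (i * t - d * x + b) * rP + (i + c * x - a) * rQ + (J * i - 1) * rN"
    unfolding x_def by (simp add: algebra_simps)
  also have "\<dots> = 0"
    unfolding kPP kPQ kQQ kLL kNN kLN kPL kPN kQN kQL krP krQ krN by simp
  finally show ?thesis by (rule eq_iff_diff_eq_0[THEN iffD2])
qed


lemma e2pi_add_Ints: "k \<in> \<int> \<Longrightarrow> e2pi (w + of_real k) = e2pi w"
  by (simp add: e2pi_add e2pi_of_int)

lemma qform_eq_bil:
  assumes "m \<in> carrier_mat g g" "v \<in> carrier_vec g"
  shows "qform (cmat_of_real m) v = bil g (\<lambda>i j. m $$ (i, j)) (\<lambda>i. v $ i) (\<lambda>i. v $ i)"
  using assms by (simp add: qform_def scalar_prod_def bil_def sum_distrib_left atLeast0LessThan mult_ac)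

lemma scalar_prod_eq_bil:
  assumes "m \<in> carrier_mat g g" "v \<in> carrier_vec g" "w \<in> carrier_vec g"
  shows "v \<bullet> (cmat_of_real m *\<^sub>v w) = bil g (\<lambda>i j. m $$ (i, j)) (\<lambda>i. v $ i) (\<lambda>i. w $ i)"
  using assms by (simp add: scalar_prod_def bil_def sum_distrib_left atLeast0LessThan mult_ac)

locale jacobi_data = theta_data g "\<lambda>i j. m $$ (i, j)" "\<lambda>i. r $ i" n \<rho>
  for g :: nat and m :: "real mat" and r :: "int vec" and n :: nat and \<rho> :: "nat \<Rightarrow> real" +
  assumes m: "m \<in> carrier_mat g g" and r: "r \<in> carrier_vec g"
begin

abbreviation A :: "nat \<Rightarrow> nat \<Rightarrow> real" where "A \<equiv> \<lambda>i j. m $$ (i, j)"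

definition point :: "complex \<Rightarrow> (nat \<Rightarrow> real) \<Rightarrow> (nat \<Rightarrow> real) \<Rightarrow> complex vec" where
  "point t p q = vec g (\<lambda>i. of_real (p i) * t + of_real (q i))"

lemma bil_int:
  fixes x y :: "nat \<Rightarrow> int"
  shows "2 * bil g A (\<lambda>i. of_int (x i)) (\<lambda>i. of_int (y i)) \<in> (\<int> :: real set)"
proof -
  have "2 * bil g A (\<lambda>i. of_int (x i)) (\<lambda>i. of_int (y i)) = (\<Sum>i<g. \<Sum>j<g. (2 * A i j) * (of_int (x i) * of_int (y j)))"
    by (simp add: bil_def sum_distrib_left mult.assoc)
  also have "\<dots> \<in> \<int>" by (intro Ints_sum Ints_mult int2A Ints_of_int) auto
  finally show ?thesis .
qed

text \<open>Off the diagonal the entries of the symmetric matrix come in equal pairs, so \<open>2m\<close> integral suffices.\<close>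

lemma bil_int_self: "bil g A (\<lambda>i. of_int (x i)) (\<lambda>i. of_int (x i)) \<in> (\<int> :: real set)"
proof -
  define f where "f i j = A i j * (of_int (x i) * of_int (x j))" for i j
  have "(\<Sum>i<k. \<Sum>j<k. f i j) \<in> \<int>" if "k \<le> g" for k
    using that
  proof (induction k)
    case (Suc k)
    have "(\<Sum>i<k. f i k) + (\<Sum>j<k. f k j) = (\<Sum>i<k. (2 * A i k) * (of_int (x i) * of_int (x k)))"
      unfolding sum.distrib[symmetric]
      by (intro sum.cong refl) (use Suc.prems sym in \<open>simp add: f_def mult_ac\<close>)
    then have "(\<Sum>i<Suc k. \<Sum>j<Suc k. f i j) =
      (\<Sum>i<k. \<Sum>j<k. f i j) + (\<Sum>i<k. (2 * A i k) * (of_int (x i) * of_int (x k))) + f k k"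
      by (simp add: sum.distrib)
    moreover have "(\<Sum>i<k. (2 * A i k) * (of_int (x i) * of_int (x k))) \<in> \<int>"
      using Suc.prems by (intro Ints_sum Ints_mult int2A Ints_of_int) auto
    moreover have "f k k \<in> \<int>"
      unfolding f_def using Suc.prems by (intro Ints_mult diagA Ints_of_int) auto
    moreover have "(\<Sum>i<k. \<Sum>j<k. f i j) \<in> \<int>" using Suc by simp
    ultimately show ?case by (simp only:) (intro Ints_add)
  qed simp
  from this[of g] show ?thesis by (simp add: bil_def f_def)
qed

text \<open>Writing (\<lambda>, \<mu>) = (V, W) M turns the shifted argument into p\<tau> + q + V
  (a\<tau> + b) + W (c\<tau> + d). The vector \<open>V\<close> labels the theta term at the
  transformed point, while all terms with \<open>W\<close> end up in the integer
  \<open>K\<close>.\<close>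

lemma slash_eq_Phi:
  assumes \<gamma>: "(M, l, u) \<in> carrier (jacobi_group g)" and t: "Im t > 0"
    and abcd: "a = M $$ (0,0)" "b = M $$ (0,1)" "c = M $$ (1,0)" "d = M $$ (1,1)"
  shows "jacobi_slash k m (jacobi_seed n r) (M, l, u) (t, point t p q) =
    (of_int c * t + of_int d) powi (- k)
    * e2pi (- t * of_real (sq p) - of_real (of_int b * of_int d * sq p - 2 * of_int b * of_int c * bil g A p q + of_int a * of_int c * sq q))
    * Phi ((of_int a * t + of_int b) / (of_int c * t + of_int d)) (d \<cdot>\<^sub>v l - c \<cdot>\<^sub>v u)
        (\<lambda>i. of_int d * p i - of_int c * q i) (\<lambda>i. of_int a * q i - of_int b * p i)"
proof -
  have M: "M \<in> carrier_mat 2 2" "det M = 1" and lu: "l \<in> lat g" "u \<in> lat g"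
    using \<gamma> by (auto simp: jacobi_group_def)
  have det: "a * d - b * c = 1" using det_mat2[OF M(1)] M(2) by (simp add: abcd)
  define J where "J = of_int c * t + of_int d"
  define T where "T = of_int a * t + of_int b"
  have J0: "J \<noteq> 0"
  proof
    assume "J = 0"
    then have "Im J = 0" "Re J = 0" by simp_all
    then have "c = 0" "d = 0" using t by (simp_all add: J_def)
    then show False using det by simp
  qed
  define V where "V = d \<cdot>\<^sub>v l - c \<cdot>\<^sub>v u"
  define W where "W = a \<cdot>\<^sub>v u - b \<cdot>\<^sub>v l"
  have VW: "V \<in> lat g" "W \<in> lat g" using lu by (auto simp: V_def W_def)
  have l_eq: "l $ i = a * V $ i + c * W $ i" and u_eq: "u $ i = b * V $ i + d * W $ i" if "i < g" for i
  proof -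
    have "a * V $ i + c * W $ i = (a * d - b * c) * l $ i" "b * V $ i + d * W $ i = (a * d - b * c) * u $ i"
      using that lu by (simp_all add: V_def W_def algebra_simps)
    then show "l $ i = a * V $ i + c * W $ i" "u $ i = b * V $ i + d * W $ i" by (simp_all add: det)
  qed
  define L where "L i = real_of_int (V $ i)" for i
  define N where "N i = real_of_int (W $ i)" for i
  define cx :: "(nat \<Rightarrow> real) \<Rightarrow> nat \<Rightarrow> complex" where "cx x i = of_real (x i)" for x i
  define rr where "rr x = (\<Sum>i<g. of_int (r $ i) * x i)" for x :: "nat \<Rightarrow> real"
  have z_i: "point t p q $ i = t * cx p i + cx q i" if "i < g" for i
    using that by (simp add: point_def cx_def mult.commute)
  have z: "point t p q \<in> carrier_vec g" by (simp add: point_def)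
  define \<zeta> where "\<zeta> = point t p q + t \<cdot>\<^sub>v cvec_of_int l + cvec_of_int u"
  have \<zeta>_c: "\<zeta> \<in> carrier_vec g" using z lu by (simp add: \<zeta>_def)
  have \<zeta>_i: "\<zeta> $ i = ((t * cx p i + cx q i) + T * cx L i) + J * cx N i" if "i < g" for i
    using that lu z by (simp add: \<zeta>_def z_i l_eq u_eq cx_def L_def N_def T_def J_def algebra_simps)
  have lc_i: "cvec_of_int l $ i = of_int a * cx L i + of_int c * cx N i" if "i < g" for i
    using that lu by (simp add: l_eq cx_def L_def N_def)
  have cx_bil: "bil g A (cx x) (cx y) = of_real (bil g A x y)" for x y
    unfolding cx_def by (rule bil_of_real)
  have rl: "cvec_of_int r \<bullet> (inverse J \<cdot>\<^sub>v \<zeta>) = (t * rr p + rr q + T * rr L + J * rr N) * inverse J"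
  proof -
    have "cvec_of_int r \<bullet> (inverse J \<cdot>\<^sub>v \<zeta>) = (\<Sum>i<g. of_int (r $ i) * (inverse J * \<zeta> $ i))"
      using r \<zeta>_c by (simp add: scalar_prod_def atLeast0LessThan)
    also have "\<dots> = (\<Sum>i<g. of_int (r $ i) * (inverse J * (((t * cx p i + cx q i) + T * cx L i) + J * cx N i)))"
      by (intro sum.cong refl) (simp add: \<zeta>_i)
    also have "\<dots> = (t * rr p + rr q + T * rr L + J * rr N) * inverse J"
      unfolding rr_def of_real_sum sum_distrib_left sum.distrib[symmetric] sum_distrib_right
      by (intro sum.cong refl) (simp add: cx_def algebra_simps)
    finally show ?thesis .
  qed
  define E where "E = (- of_int c * inverse J * qform (cmat_of_real m) \<zeta>
      + qform (cmat_of_real m) (cvec_of_int l) * t + 2 * (cvec_of_int l \<bullet> (cmat_of_real m *\<^sub>v point t p q)))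
    + (of_nat n * (T / J) + cvec_of_int r \<bullet> (inverse J \<cdot>\<^sub>v \<zeta>))"
  have slash: "jacobi_slash k m (jacobi_seed n r) (M, l, u) (t, point t p q) = J powi (- k) * e2pi E"
    by (simp add: jacobi_slash_def jacobi_seed_def jacobi_act_def Let_def abcd J_def
        T_def \<zeta>_def[symmetric] E_def e2pi_add mult.assoc)
  have q\<zeta>: "qform (cmat_of_real m) \<zeta> = bil g A (\<lambda>i. ((t * cx p i + cx q i) + T * cx L i) + J * cx N i)
      (\<lambda>i. ((t * cx p i + cx q i) + T * cx L i) + J * cx N i)"
    unfolding qform_eq_bil[OF m \<zeta>_c] by (intro bil_cong \<zeta>_i)
  have lc_c: "cvec_of_int l \<in> carrier_vec g" using lu by simp
  have ql: "qform (cmat_of_real m) (cvec_of_int l) = bil g A (\<lambda>i. of_int a * cx L i + of_int c * cx N i) (\<lambda>i. of_int a * cx L i + of_int c * cx N i)"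
    unfolding qform_eq_bil[OF m lc_c] by (intro bil_cong lc_i)
  have lz: "cvec_of_int l \<bullet> (cmat_of_real m *\<^sub>v point t p q) = bil g A (\<lambda>i. of_int a * cx L i + of_int c * cx N i) (\<lambda>i. t * cx p i + cx q i)"
    unfolding scalar_prod_eq_bil[OF m lc_c z] by (intro bil_cong lc_i z_i)
  define p' where "p' = (\<lambda>i. of_int d * p i - of_int c * q i)"
  define q' where "q' = (\<lambda>i. of_int a * q i - of_int b * p i)"
  \<comment> \<open>Integral by half-integrality: \<open>m\<close> takes integral values on integer
    vectors, and \<open>2m\<close> is integral as a bilinear form. So \<open>K\<close> disappears
    under \<open>e2pi\<close>.\<close>
  define K where "K = rr N - c * d * sq N - 2 * c * b * bil g A L N - a * b * sq L"
  have K: "K \<in> \<int>"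
  proof -
    have 1: "rr N \<in> \<int>" unfolding rr_def N_def by (intro Ints_sum Ints_mult) auto
    have sq: "sq N \<in> \<int>" "sq L \<in> \<int>" unfolding N_def[abs_def] L_def[abs_def] by (rule bil_int_self)+
    have "2 * bil g A L N \<in> \<int>" unfolding N_def[abs_def] L_def[abs_def] by (rule bil_int)
    then have "of_int (c * b) * (2 * bil g A L N) \<in> \<int>" by (rule Ints_mult[OF Ints_of_int])
    moreover have eq: "2 * c * b * bil g A L N = of_int (c * b) * (2 * bil g A L N)" by simp
    ultimately have 2: "2 * c * b * bil g A L N \<in> \<int>" unfolding eq by blast
    have 3: "c * d * sq N \<in> \<int>" "a * b * sq L \<in> \<int>" by (intro Ints_mult Ints_of_int sq)+
    show ?thesis unfolding K_def by (rule Ints_diff[OF Ints_diff[OF Ints_diff[OF 1 3(1)] 2] 3(2)])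
  qed
  have Rp: "R (shift p' V) = (sq L + 2 * (d * bil g A p L - c * bil g A q L)
      + (d * d * sq p - 2 * c * d * bil g A p q + c * c * sq q)) + (rr L + d * rr p - c * rr q) + n"
  proof -
    have "R (shift p' V) = R (\<lambda>i. L i + (of_int d * p i + (- of_int c) * q i))"
      by (intro R_cong) (simp add: shift_def p'_def L_def)
    also have "\<dots> = sq L + 2 * bil g A L (\<lambda>i. of_int d * p i + (- of_int c) * q i)
        + sq (\<lambda>i. of_int d * p i + (- of_int c) * q i) + rr (\<lambda>i. L i + (of_int d * p i + (- of_int c) * q i)) + n"
      unfolding R_def by (simp only: bil_square_add rr_def)
    also have "rr (\<lambda>i. L i + (of_int d * p i + (- of_int c) * q i)) = rr L + d * rr p - c * rr q"
      by (simp add: rr_def sum_distrib_left sum.distrib sum_subtractf algebra_simps)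
    finally show ?thesis
      unfolding bil_square_add unfolding bil_add_right bil_scale_left bil_scale_right bil_commute[of L p] bil_commute[of L q]
      by (simp add: algebra_simps)
  qed
  have freq_q: "(\<Sum>i<g. freq V i * q' i) = 2 * (a * bil g A q L - b * bil g A p L) + (a * rr q - b * rr p)"
  proof -
    have "(\<Sum>i<g. freq V i * q' i) = 2 * bil g A q' L + rr q'"
      unfolding freq_pairing rr_def L_def ..
    also have "bil g A q' L = bil g A (\<lambda>i. of_int a * q i + (- of_int b) * p i) L" by (simp add: q'_def)
    also have "\<dots> = a * bil g A q L - b * bil g A p L" unfolding bil_add_left bil_scale_left by simp
    also have "rr q' = a * rr q - b * rr p"
      by (simp add: rr_def q'_def sum_distrib_left sum_subtractf algebra_simps)
    finally show ?thesis .
  qed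
  have "E = (- t * of_real (sq p) - of_real (of_int b * of_int d * sq p - 2 * of_int b * of_int c * bil g A p q + of_int a * of_int c * sq q))
      + (T / J) * of_real (R (shift p' V)) + of_real (\<Sum>i<g. freq V i * q' i) + of_real K"
  proof -
    have T1: "J = of_int c * t + of_int d" "T = of_int a * t + of_int b" "J * inverse J = 1"
      "complex_of_int a * of_int d - of_int b * of_int c = 1"
      using J0 det by (simp_all add: J_def T_def flip: of_int_mult of_int_diff)
    have sq\<zeta>: "bil g A (\<lambda>i. ((t * cx p i + cx q i) + T * cx L i) + J * cx N i)
      (\<lambda>i. ((t * cx p i + cx q i) + T * cx L i) + J * cx N i) =
      t * t * of_real (sq p) + 2 * t * of_real (bil g A p q) + of_real (sq q) + T * T * of_real (sq L) + J * J * of_real (sq N)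
      + 2 * T * J * of_real (bil g A L N) + 2 * t * T * of_real (bil g A p L) + 2 * t * J * of_real (bil g A p N)
      + 2 * T * of_real (bil g A q L) + 2 * J * of_real (bil g A q N)"
      unfolding bil_square_add unfolding bil_add_left unfolding bil_scale_left bil_scale_right cx_bil by (simp add: algebra_simps)
    have sql: "bil g A (\<lambda>i. of_int a * cx L i + of_int c * cx N i) (\<lambda>i. of_int a * cx L i + of_int c * cx N i) =
      of_int a * of_int a * of_real (sq L) + 2 * of_int a * of_int c * of_real (bil g A L N) + of_int c * of_int c * of_real (sq N)"
      unfolding bil_square_add unfolding bil_scale_left bil_scale_right cx_bil by (simp add: algebra_simps)
    have blz: "bil g A (\<lambda>i. of_int a * cx L i + of_int c * cx N i) (\<lambda>i. t * cx p i + cx q i) =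
      of_int a * t * of_real (bil g A p L) + of_int a * of_real (bil g A q L) + of_int c * t * of_real (bil g A p N) + of_int c * of_real (bil g A q N)"
      unfolding bil_add_left bil_add_right bil_scale_left bil_scale_right cx_bil bil_commute[of L p] bil_commute[of L q] bil_commute[of N p] bil_commute[of N q]
      by (simp add: algebra_simps)
    have "E = - of_int c * inverse J * (t * t * of_real (sq p) + 2 * t * of_real (bil g A p q) + of_real (sq q) + T * T * of_real (sq L) + J * J * of_real (sq N)
      + 2 * T * J * of_real (bil g A L N) + 2 * t * T * of_real (bil g A p L) + 2 * t * J * of_real (bil g A p N)
      + 2 * T * of_real (bil g A q L) + 2 * J * of_real (bil g A q N))
      + (of_int a * of_int a * of_real (sq L) + 2 * of_int a * of_int c * of_real (bil g A L N) + of_int c * of_int c * of_real (sq N)) * t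
      + 2 * (of_int a * t * of_real (bil g A p L) + of_int a * of_real (bil g A q L) + of_int c * t * of_real (bil g A p N) + of_int c * of_real (bil g A q N))
      + of_nat n * (T * inverse J) + (t * of_real (rr p) + of_real (rr q) + T * of_real (rr L) + J * of_real (rr N)) * inverse J"
      unfolding E_def q\<zeta> ql lz rl sq\<zeta> sql blz divide_inverse by (simp only: add.assoc)
    also note jacobi_exponent_identity[OF T1]
    finally show ?thesis
      unfolding Rp freq_q K_def by (simp add: divide_inverse algebra_simps)
  qed
  then have "e2pi E = e2pi (- t * of_real (sq p) - of_real (of_int b * of_int d * sq p - 2 * of_int b * of_int c * bil g A p q + of_int a * of_int c * sq q))
      * e2pi ((T / J) * of_real (R (shift p' V))) * e2pi (of_real (\<Sum>i<g. freq V i * q' i))"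
    using K by (simp only: e2pi_add_Ints) (simp only: e2pi_add)
  then show ?thesis
    unfolding slash by (simp only: Phi_def coef_def chi_def J_def T_def V_def p'_def q'_def mult.assoc[of "_ powi _"] mult.assoc[of "e2pi _"])
qed

end

section \<open>Summands indexed by bottom row and lattice vector\<close>

lemma nn_integral_count_space_Times:
  assumes "countable A" "countable B"
  shows "(\<integral>\<^sup>+z. f z \<partial>count_space (A \<times> B)) = (\<integral>\<^sup>+x. (\<integral>\<^sup>+y. f (x, y) \<partial>count_space B) \<partial>count_space A)"
proof -
  interpret B: sigma_finite_measure "count_space B" by (rule sigma_finite_measure_count_space_countable) fact
  show ?thesis
    using B.nn_integral_fst[of f "count_space A"] by (simp add: pair_measure_countable assms)
qed

text \<open>For c = 0 the completed matrix is fixed to be plus or minus the identity, so that the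
  rows \<open>(0, 1)\<close> and \<open>(0, -1)\<close> produce exactly \<Theta> and its reflection,
  without a phase.\<close>

definition top_row :: "int \<times> int \<Rightarrow> int \<times> int" where
  "top_row = (\<lambda>(c, d). if c = 0 then (d, 0) else (SOME (a, b). a * d - b * c = 1))"

lemma top_row_det:
  assumes "(c, d) \<in> bottom_rows"
  shows "fst (top_row (c, d)) * d - snd (top_row (c, d)) * c = 1"
proof (cases "c = 0")
  case True
  then have "d = 1 \<or> d = -1" using assms by (auto simp: bottom_rows_def)
  then show ?thesis using True by (auto simp: top_row_def)
next
  case False
  obtain a' b' where "a' * c + b' * d = 1" using bezout_int[of c d] assms by (auto simp: bottom_rows_def)
  then have "b' * d - (- a') * c = 1" by (simp add: algebra_simps)
  then have "case (b', - a') of (a, b) \<Rightarrow> a * d - b * c = 1" by simp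
  then have "case (SOME (a, b). a * d - b * c = 1) of (a, b) \<Rightarrow> a * d - b * c = 1"
    by (rule someI[of "\<lambda>(a, b). a * d - b * c = 1"])
  then show ?thesis using False by (simp add: top_row_def case_prod_unfold)
qed

definition rowfac :: "complex \<Rightarrow> int \<times> int \<Rightarrow> complex" where
  "rowfac t = (\<lambda>(c, d). of_int c * t + of_int d)"

abbreviation (input) row_sq :: "complex \<Rightarrow> int \<times> int \<Rightarrow> real" where
  "row_sq t \<equiv> height_sq (Re t) (Im t)"

definition mtau :: "complex \<Rightarrow> int \<times> int \<Rightarrow> complex" where
  "mtau t x = (of_int (fst (top_row x)) * t + of_int (snd (top_row x))) / rowfac t x"

lemma norm_rowfac: "(norm (rowfac t x))\<^sup>2 = height_sq (Re t) (Im t) x"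
  by (cases x) (simp add: rowfac_def height_sq_def cmod_power2 add.commute)

lemma height_sq_pos: "y > 0 \<Longrightarrow> x \<in> bottom_rows \<Longrightarrow> height_sq u y x > 0"
proof (cases x)
  case (Pair c d)
  assume y: "y > 0" and x: "x \<in> bottom_rows"
  show ?thesis
  proof (cases "c = 0")
    case True
    then show ?thesis using x Pair by (auto simp: bottom_rows_def height_sq_def)
  next
    case False
    then have "0 < (of_int c * y)\<^sup>2" using y by simp
    then show ?thesis by (simp add: Pair height_sq_def add_pos_nonneg)
  qed
qed

lemma rowfac_nonzero: "Im t > 0 \<Longrightarrow> x \<in> bottom_rows \<Longrightarrow> rowfac t x \<noteq> 0"
  using height_sq_pos[of "Im t" x "Re t"] norm_rowfac[of t x] by auto

lemma Im_mobius:
  assumes "a * d - b * c = (1::int)"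
  shows "Im ((of_int a * t + of_int b) / (of_int c * t + of_int d)) = Im t / (norm (of_int c * t + of_int d))\<^sup>2"
proof -
  have "Im ((of_int a * t + of_int b) / (of_int c * t + of_int d)) =
    ((real_of_int a * d - b * c) * Im t) / (norm (of_int c * t + of_int d))\<^sup>2"
    by (simp add: Im_divide cmod_power2 algebra_simps)
  also have "real_of_int a * d - b * c = 1" using assms by (metis of_int_1 of_int_diff of_int_mult)
  finally show ?thesis by simp
qed

lemma Im_mtau: "x \<in> bottom_rows \<Longrightarrow> Im (mtau t x) = Im t / height_sq (Re t) (Im t) x"
  using Im_mobius[of "fst (top_row x)" "snd x" "snd (top_row x)" "fst x" t] top_row_det[of "fst x" "snd x"]
    norm_rowfac[of t x]
  by (simp add: mtau_def rowfac_def case_prod_unfold)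

context jacobi_data
begin

text \<open>Real-valued, hence invisible to all estimates by absolute values.\<close>

definition phase :: "int \<Rightarrow> int \<Rightarrow> int \<Rightarrow> int \<Rightarrow> (nat \<Rightarrow> real) \<Rightarrow> (nat \<Rightarrow> real) \<Rightarrow> real" where
  "phase a b c d p q = of_int b * of_int d * sq p - 2 * of_int b * of_int c * bil g A p q + of_int a * of_int c * sq q"

definition lft :: "int \<times> int \<Rightarrow> (nat \<Rightarrow> real) \<Rightarrow> (nat \<Rightarrow> real) \<Rightarrow> nat \<Rightarrow> real" where
  "lft x p q = (\<lambda>i. of_int (snd x) * p i - of_int (fst x) * q i)"

definition rgt :: "int \<times> int \<Rightarrow> (nat \<Rightarrow> real) \<Rightarrow> (nat \<Rightarrow> real) \<Rightarrow> nat \<Rightarrow> real" where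
  "rgt x p q = (\<lambda>i. of_int (fst (top_row x)) * q i - of_int (snd (top_row x)) * p i)"

definition factor :: "int \<Rightarrow> complex \<Rightarrow> (nat \<Rightarrow> real) \<Rightarrow> (nat \<Rightarrow> real) \<Rightarrow> int \<times> int \<Rightarrow> complex" where
  "factor k t p q x = rowfac t x powi (- k) * e2pi (- t * of_real (sq p) -
    of_real (phase (fst (top_row x)) (snd (top_row x)) (fst x) (snd x) p q))"

definition summand :: "int \<Rightarrow> complex \<Rightarrow> (nat \<Rightarrow> real) \<Rightarrow> (nat \<Rightarrow> real) \<Rightarrow> (int \<times> int) \<times> int vec \<Rightarrow> complex" where
  "summand k t p q = (\<lambda>(x, v). factor k t p q x * Phi (mtau t x) v (lft x p q) (rgt x p q))"

text \<open>Adding \<open>j\<close> times the bottom row to the top row moves the transformed point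
  by \<open>j\<close>, the phase by \<open>j * sq p'\<close> and the right argument by
  \<open>-j p'\<close>. In the exponent these changes add up to the integer \<open>K\<close>, so the
  choice made in \<open>top_row\<close> is immaterial.\<close>

lemma Phi_translate:
  assumes V: "V \<in> lat g" and J: "of_int c * t + of_int d \<noteq> 0"
  shows "e2pi (- t * of_real (sq p) - of_real (phase (a + j * c) (b + j * d) c d p q))
    * Phi ((of_int (a + j * c) * t + of_int (b + j * d)) / (of_int c * t + of_int d)) V
        (\<lambda>i. of_int d * p i - of_int c * q i) (\<lambda>i. of_int (a + j * c) * q i - of_int (b + j * d) * p i) =
    e2pi (- t * of_real (sq p) - of_real (phase a b c d p q))
    * Phi ((of_int a * t + of_int b) / (of_int c * t + of_int d)) V
        (\<lambda>i. of_int d * p i - of_int c * q i) (\<lambda>i. of_int a * q i - of_int b * p i)"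
proof -
  define p' where "p' = (\<lambda>i. of_int d * p i - of_int c * q i)"
  define q' where "q' = (\<lambda>i. of_int a * q i - of_int b * p i)"
  define L where "L i = real_of_int (V $ i)" for i
  define T where "T = (of_int a * t + of_int b) / (of_int c * t + of_int d)"
  define rr where "rr x = (\<Sum>i<g. of_int (r $ i) * x i)" for x :: "nat \<Rightarrow> real"
  have T': "(of_int (a + j * c) * t + of_int (b + j * d)) / (of_int c * t + of_int d) = T + of_int j"
    using J by (simp add: T_def field_simps)
  have q'': "(\<lambda>i. of_int (a + j * c) * q i - of_int (b + j * d) * p i) = (\<lambda>i. q' i + (- of_int j) * p' i)"
    by (simp add: q'_def p'_def algebra_simps fun_eq_iff)
  have ph: "phase (a + j * c) (b + j * d) c d p q = phase a b c d p q + of_int j * sq p'"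
  proof -
    have "p' = (\<lambda>i. of_int d * p i + (- of_int c) * q i)" by (simp add: p'_def)
    then have sqp': "sq p' = of_int d * (of_int d * sq p) + 2 * (of_int d * (- of_int c * bil g A p q)) + of_int c * (of_int c * sq q)"
      by (simp only: bil_square_add) (simp add: bil_scale_left bil_scale_right bil_minus_left bil_minus_right)
    show ?thesis unfolding phase_def sqp' by (simp add: algebra_simps)
  qed
  have fr: "(\<Sum>i<g. freq V i * (q' i + (- of_int j) * p' i)) = (\<Sum>i<g. freq V i * q' i) - of_int j * (2 * bil g A p' L + rr p')"
  proof -
    have "(\<Sum>i<g. freq V i * p' i) = 2 * bil g A p' L + rr p'"
      unfolding freq_pairing rr_def L_def ..
    moreover have "(\<Sum>i<g. freq V i * (q' i + (- of_int j) * p' i)) = (\<Sum>i<g. freq V i * q' i) - of_int j * (\<Sum>i<g. freq V i * p' i)"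
      by (simp add: sum_distrib_left sum_subtractf algebra_simps)
    ultimately show ?thesis by simp
  qed
  have Rp: "R (shift p' V) = sq p' + 2 * bil g A p' L + sq L + rr p' + rr L + n"
  proof -
    have "shift p' V = (\<lambda>i. p' i + L i)" by (simp add: shift_def L_def)
    then show ?thesis unfolding R_def rr_def by (simp add: bil_square_add sum.distrib distrib_left)
  qed
  define K where "K = of_int j * (sq L + rr L + n)"
  have K: "K \<in> \<int>"
  proof -
    have "sq L \<in> \<int>" unfolding L_def[abs_def] by (rule bil_int_self)
    moreover have "rr L \<in> \<int>" unfolding rr_def L_def by (intro Ints_sum Ints_mult) auto
    ultimately show ?thesis unfolding K_def by (intro Ints_mult Ints_add) auto
  qed
  have "e2pi (- t * of_real (sq p) - of_real (phase (a + j * c) (b + j * d) c d p q))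
    * Phi (T + of_int j) V p' (\<lambda>i. q' i + (- of_int j) * p' i) =
    e2pi ((- t * of_real (sq p) - of_real (phase a b c d p q)) + T * of_real (R (shift p' V))
      + of_real (\<Sum>i<g. freq V i * q' i) + of_real K)"
    unfolding Phi_def coef_def chi_def e2pi_add[symmetric] ph fr K_def
    by (rule arg_cong[where f = e2pi]) (simp add: Rp algebra_simps)
  also have "\<dots> = e2pi (- t * of_real (sq p) - of_real (phase a b c d p q)) * Phi T V p' q'"
    unfolding e2pi_add_Ints[OF K] unfolding e2pi_add[symmetric] Phi_def coef_def chi_def by (simp add: add.assoc)
  finally show ?thesis unfolding T' q'' by (simp only: T_def p'_def q'_def)
qed

lemma slash_eq_summand:
  assumes \<gamma>: "\<gamma> \<in> carrier (jacobi_group g)" and t: "Im t > 0"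
  shows "jacobi_slash k m (jacobi_seed n r) \<gamma> (t, point t p q) = summand k t p q (coset_inv \<gamma>)"
proof -
  obtain M l u where \<gamma>_eq: "\<gamma> = (M, l, u)" by (cases \<gamma>)
  have M: "M \<in> carrier_mat 2 2" "det M = 1" and lu: "l \<in> lat g" "u \<in> lat g"
    using \<gamma> by (auto simp: \<gamma>_eq jacobi_group_def)
  define a' b' c d where "a' = M $$ (0,0)" "b' = M $$ (0,1)" "c = M $$ (1,0)" "d = M $$ (1,1)"
  note abcd = this
  have det': "a' * d - b' * c = 1" using det_mat2[OF M(1)] M(2) by (simp add: abcd)
  then have "coprime c d" by (intro coprimeI) (metis dvd_diff dvd_mult)
  then have x: "(c, d) \<in> bottom_rows" by (simp add: bottom_rows_def)
  define a b where "a = fst (top_row (c, d))" "b = snd (top_row (c, d))"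
  note ab = this
  have det: "a * d - b * c = 1" using top_row_det[OF x] by (simp add: ab)
  obtain j where j: "a' = a + j * c" "b' = b + j * d"
    using sl2_row_relation[OF det det'] by blast
  define V where "V = d \<cdot>\<^sub>v l - c \<cdot>\<^sub>v u"
  have V: "V \<in> lat g" using lu by (simp add: V_def)
  have J: "of_int c * t + of_int d \<noteq> 0" using rowfac_nonzero[OF t x] by (simp add: rowfac_def)
  have inv: "coset_inv \<gamma> = ((c, d), V)" by (simp add: coset_inv_def \<gamma>_eq abcd V_def)
  have "jacobi_slash k m (jacobi_seed n r) \<gamma> (t, point t p q) =
    (of_int c * t + of_int d) powi (- k) * (e2pi (- t * of_real (sq p) - of_real (phase a' b' c d p q))
    * Phi ((of_int a' * t + of_int b') / (of_int c * t + of_int d)) V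
        (\<lambda>i. of_int d * p i - of_int c * q i) (\<lambda>i. of_int a' * q i - of_int b' * p i))"
    using slash_eq_Phi[OF \<gamma>[unfolded \<gamma>_eq] t abcd(1) abcd(2) abcd(3) abcd(4), of k p q]
    unfolding phase_def V_def \<gamma>_eq by (simp only: mult.assoc[of "_ powi _"])
  also have "\<dots> = summand k t p q ((c, d), V)"
    unfolding j Phi_translate[OF V J]
    by (simp add: summand_def factor_def mtau_def lft_def rgt_def rowfac_def ab mult.assoc)
  finally show ?thesis by (simp only: inv)
qed

lemma poincare_eq_infsum:
  assumes t: "Im t > 0"
  shows "jacobi_poincare g k m n r t (point t p q) = (\<Sum>\<^sub>\<infinity>z\<in>bottom_rows \<times> lat g. summand k t p q z)"
proof -
  have "jacobi_poincare g k m n r t (point t p q) =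
    (\<Sum>\<^sub>\<infinity>C \<in> jacobi_cosets g. summand k t p q (coset_inv (SOME \<gamma>. \<gamma> \<in> C)))"
    unfolding jacobi_poincare_def by (intro infsum_cong slash_eq_summand some_in_rcoset_carrier t)
  also have "\<dots> = (\<Sum>\<^sub>\<infinity>z\<in>bottom_rows \<times> lat g. summand k t p q z)"
    by (rule infsum_reindex_bij_betw[OF bij_betw_coset_inv])
  finally show ?thesis .
qed

end

section \<open>The contribution of the cosets with nonzero lower left entry\<close>

lemma norm_powi_neg:
  fixes z :: complex
  assumes "z \<noteq> 0"
  shows "norm (z powi (- k)) = ((norm z)\<^sup>2) powr (- real_of_int k / 2)"
proof -
  have "norm (z powi (- k)) = norm z powr of_int (- k)"
    using assms powr_real_of_int'[of "norm z" "- k"] by (simp add: norm_power_int)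
  also have "\<dots> = ((norm z)\<^sup>2) powr (- real_of_int k / 2)"
    using assms by (simp add: powr_powr flip: powr_numeral)
  finally show ?thesis .
qed

lemma powr_divide_neg:
  fixes a s b :: real
  assumes "a > 0" "s > 0"
  shows "(a / s) powr (- b) = a powr (- b) * s powr b"
proof -
  have "(a / s) powr (- b) = a powr (- b) / s powr (- b)"
    by (rule powr_divide)
  also have "\<dots> = a powr (- b) * s powr b"
    by (simp only: powr_minus[of s b] divide_inverse inverse_inverse_eq)
  finally show ?thesis .
qed

lemma borel_measurable_nn_integral_count_space:
  assumes A: "countable A" and f: "\<And>x. x \<in> A \<Longrightarrow> f x \<in> borel_measurable M"
  shows "(\<lambda>z. \<integral>\<^sup>+x. f x z \<partial>count_space A) \<in> borel_measurable M"
proof -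
  interpret C: sigma_finite_measure "count_space A" by (rule sigma_finite_measure_count_space_countable[OF A])
  have "(\<lambda>(z, x). f x z) \<in> borel_measurable (M \<Otimes>\<^sub>M count_space A)"
    by (rule measurable_pair_count_space[OF A f])
  then show ?thesis by (rule C.borel_measurable_nn_integral)
qed

abbreviation (input) row_weight :: "int \<Rightarrow> complex \<Rightarrow> int \<times> int \<Rightarrow> real" where
  "row_weight k t x \<equiv> row_sq t x powr (- real_of_int k / 2)"

abbreviation (input) lower_rows :: "(int \<times> int) set" where
  "lower_rows \<equiv> bottom_rows \<inter> nonzero_row"

context jacobi_data
begin

abbreviation (input) row_theta :: "complex \<Rightarrow> int \<times> int \<Rightarrow> (nat \<Rightarrow> real) \<Rightarrow> (nat \<Rightarrow> real) \<Rightarrow> complex" where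
  "row_theta t x p q \<equiv> Theta (mtau t x) (lft x p q) (rgt x p q)"

abbreviation (input) central :: "int \<Rightarrow> complex \<Rightarrow> (nat \<Rightarrow> real) \<Rightarrow> (nat \<Rightarrow> real) \<Rightarrow> complex" where
  "central k t p q \<equiv> Theta t p q + (-1) powi (- k) * Theta t (\<lambda>i. - p i) (\<lambda>i. - q i)"

lemma norm_factor:
  assumes "Im t > 0" "x \<in> bottom_rows"
  shows "norm (factor k t p q x) = row_weight k t x * exp (2 * pi * Im t * sq p)"
  using norm_powi_neg[OF rowfac_nonzero[OF assms], of k] norm_rowfac[of t x]
  by (simp add: factor_def norm_mult norm_e2pi)

definition row_sum :: "int \<Rightarrow> complex \<Rightarrow> (nat \<Rightarrow> real) \<Rightarrow> (nat \<Rightarrow> real) \<Rightarrow> int \<times> int \<Rightarrow> complex" where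
  "row_sum k t p q x = factor k t p q x * row_theta t x p q"

lemma row_sum_eq: "(\<Sum>\<^sub>\<infinity>v\<in>lat g. summand k t p q (x, v)) = row_sum k t p q x"
  by (simp add: summand_def row_sum_def Theta_def infsum_cmult_right')

lemma Im_mtau_pos: "Im t > 0 \<Longrightarrow> x \<in> bottom_rows \<Longrightarrow> Im (mtau t x) > 0"
  by (simp add: Im_mtau height_sq_pos)

text \<open>A majorant for the sum of absolute values in one row, free of \<open>q\<close>; it
  serves absolute convergence.\<close>

definition row_bound :: "int \<Rightarrow> complex \<Rightarrow> (nat \<Rightarrow> real) \<Rightarrow> int \<times> int \<Rightarrow> ennreal" where
  "row_bound k t p x = ennreal (row_weight k t x * exp (2 * pi * Im t * sq p)) *
    (ennreal (exp (- (2 * pi * Im (mtau t x)) * \<Delta>) * exp (2 * pi * Im (mtau t x) * form_bound)) * gauss (pi * Im (mtau t x)))"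

lemma sum_norm_summand_le:
  assumes "Im t > 0" "x \<in> bottom_rows"
  shows "(\<integral>\<^sup>+v. ennreal (norm (summand k t p q (x, v))) \<partial>count_space (lat g)) \<le> row_bound k t p x"
proof -
  have "(\<integral>\<^sup>+v. ennreal (norm (summand k t p q (x, v))) \<partial>count_space (lat g)) =
    ennreal (norm (factor k t p q x)) * (\<integral>\<^sup>+v. ennreal (norm (Phi (mtau t x) v (lft x p q) (rgt x p q))) \<partial>count_space (lat g))"
    by (simp add: summand_def norm_mult ennreal_mult nn_integral_cmult)
  also have "\<dots> \<le> row_bound k t p x"
    unfolding norm_factor[OF assms] row_bound_def
    by (intro mult_left_mono sum_norm_Phi_bound Im_mtau_pos assms) simp
  finally show ?thesis .
qed

lemma row_bound_finite: "Im t > 0 \<Longrightarrow> x \<in> bottom_rows \<Longrightarrow> row_bound k t p x < \<infinity>"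
  unfolding row_bound_def using gauss_finite[of "pi * Im (mtau t x)"] Im_mtau_pos[of t x]
  by (auto intro!: ennreal_mult_less_top[THEN iffD2] simp: ennreal_mult_less_top)

lemma form_bound_nonneg: "0 \<le> form_bound"
  unfolding form_bound_def by (intro sum_nonneg) auto

text \<open>At height y/s the Gaussian contributes a factor s^(g/2). The condition k >= g + 4 leaves
  s^(-2), and the surplus power of \<open>s\<close> is bounded through s >= y^2, valid because
  \<open>c\<close> is nonzero. Only convergence is at stake, so \<open>C\<close> may depend on
  everything but the row.\<close>

lemma row_bound_nonzero_row:
  assumes t: "0 < Im t" "Im t \<le> 1" and k: "real_of_int k \<ge> real g + 4" and \<Delta>: "\<Delta> \<ge> 0"
  shows "\<exists>C\<ge>0. \<forall>x\<in>lower_rows. row_bound k t p x \<le> ennreal (C / (row_sq t x)\<^sup>2)"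
proof -
  define y where "y = Im t"
  define G where "G = enn2real (gauss 1)"
  define e where "e = (real_of_int k - real g) / 2 - 2"
  define C where "C = exp (2 * pi * y * sq p) * exp (2 * pi / y * form_bound) * G * (pi * y) powr (- real g / 2) * (y\<^sup>2) powr (- e)"
  have y: "0 < y" "y \<le> 1" using t by (auto simp: y_def)
  have e: "e \<ge> 0" using k by (simp add: e_def)
  have G: "0 \<le> G" by (simp add: G_def)
  have "row_bound k t p x \<le> ennreal (C / (row_sq t x)\<^sup>2)" if x: "x \<in> lower_rows" for x
  proof -
    obtain c d where cd: "x = (c, d)" "c \<noteq> 0" using x by auto
    define s where "s = row_sq t x"
    have s_pos: "s > 0" unfolding s_def using x t by (intro height_sq_pos) auto
    have s_ge: "y\<^sup>2 \<le> s"
    proof -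
      have "1 \<le> \<bar>real_of_int c\<bar>" using cd(2) by linarith
      then have "1 \<le> (real_of_int c)\<^sup>2" using abs_le_square_iff[of 1 "real_of_int c"] by simp
      then have "1 * y\<^sup>2 \<le> (real_of_int c)\<^sup>2 * y\<^sup>2" by (intro mult_right_mono) auto
      then have "y\<^sup>2 \<le> (real_of_int c * y)\<^sup>2" by (simp add: power_mult_distrib)
      then show ?thesis unfolding s_def cd height_sq_def y_def by (simp add: add_increasing2)
    qed
    have Im: "Im (mtau t x) = y / s" using x by (simp add: Im_mtau s_def y_def)
    have ys: "0 < y / s" "y / s \<le> 1 / y"
      using y s_pos s_ge by (simp_all add: field_simps power2_eq_square)
    have ga: "gauss (pi * (y / s)) = ennreal (G * (pi * y / s) powr (- real g / 2))"
      using gauss_scale[OF mult_pos_pos[OF pi_gt_zero ys(1)]] by (simp add: G_def)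
    have "exp (- (2 * pi * (y / s)) * \<Delta>) \<le> 1"
    proof -
      have "0 \<le> 2 * pi * (y / s) * \<Delta>"
        by (intro mult_nonneg_nonneg) (use ys \<Delta> in auto)
      then show ?thesis by (simp only: mult_minus_left exp_le_one_iff neg_le_0_iff_le)
    qed
    moreover have "exp (2 * pi * (y / s) * form_bound) \<le> exp (2 * pi / y * form_bound)"
    proof -
      have "2 * pi * (y / s) * form_bound \<le> 2 * pi * (1 / y) * form_bound"
        by (intro mult_right_mono mult_left_mono ys form_bound_nonneg) simp
      then show ?thesis by simp
    qed
    ultimately have ex: "exp (- (2 * pi * (y / s)) * \<Delta>) * exp (2 * pi * (y / s) * form_bound) \<le> 1 * exp (2 * pi / y * form_bound)"
      by (intro mult_mono) auto
    have pw: "(pi * y / s) powr (- real g / 2) = (pi * y) powr (- real g / 2) * s powr (real g / 2)"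
      using powr_divide_neg[of "pi * y" s "real g / 2"] y s_pos by simp
    have sp: "s powr (- real_of_int k / 2) * s powr (real g / 2) \<le> (y\<^sup>2) powr (- e) / s\<^sup>2"
    proof -
      have "s powr (- real_of_int k / 2) * s powr (real g / 2) = s powr (- e + - 2)"
        unfolding powr_add[symmetric] e_def by (simp add: field_simps)
      also have "\<dots> = s powr (- e) / s\<^sup>2"
        unfolding powr_add using s_pos by (simp add: powr_minus_divide)
      also have "\<dots> \<le> (y\<^sup>2) powr (- e) / s\<^sup>2"
        using e y s_ge by (intro divide_right_mono powr_mono2') auto
      finally show ?thesis .
    qed
    have "row_bound k t p x = ennreal (s powr (- real_of_int k / 2) * exp (2 * pi * y * sq p) *
      ((exp (- (2 * pi * (y / s)) * \<Delta>) * exp (2 * pi * (y / s) * form_bound)) * (G * (pi * y / s) powr (- real g / 2))))"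
      unfolding row_bound_def s_def[symmetric] unfolding Im ga y_def[symmetric] using G by (simp add: ennreal_mult)
    also have "\<dots> \<le> ennreal (s powr (- real_of_int k / 2) * exp (2 * pi * y * sq p) *
      ((1 * exp (2 * pi / y * form_bound)) * (G * (pi * y / s) powr (- real g / 2))))"
      using G by (intro ennreal_leI mult_left_mono mult_right_mono ex) auto
    also have "\<dots> = ennreal (exp (2 * pi * y * sq p) * exp (2 * pi / y * form_bound) * G * (pi * y) powr (- real g / 2) *
      (s powr (- real_of_int k / 2) * s powr (real g / 2)))"
      unfolding pw by (simp add: mult_ac)
    also have "\<dots> \<le> ennreal (exp (2 * pi * y * sq p) * exp (2 * pi / y * form_bound) * G * (pi * y) powr (- real g / 2) *
      ((y\<^sup>2) powr (- e) / s\<^sup>2))"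
      using G by (intro ennreal_leI mult_left_mono sp) auto
    finally show ?thesis by (simp add: C_def s_def)
  qed
  moreover have "0 \<le> C" using G by (simp add: C_def)
  ultimately show ?thesis by blast
qed

lemma bottom_rows_split: "bottom_rows = {(0, 1), (0, -1)} \<union> (lower_rows)"
proof -
  have "d = 1 \<or> d = -1" if "coprime 0 d" for d :: int using that by auto
  then show ?thesis by (auto simp: bottom_rows_def)
qed

lemma sum_row_bound_finite:
  assumes t: "0 < Im t" "Im t \<le> 1" and k: "real_of_int k \<ge> real g + 4" and \<Delta>: "\<Delta> \<ge> 0"
  shows "(\<integral>\<^sup>+x. row_bound k t p x \<partial>count_space bottom_rows) < \<infinity>"
proof -
  obtain C where C: "C \<ge> 0" "\<And>x. x \<in> lower_rows \<Longrightarrow> row_bound k t p x \<le> ennreal (C / (row_sq t x)\<^sup>2)"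
    using row_bound_nonzero_row[OF assms] by blast
  obtain C' where C': "C' \<ge> 0" "(\<integral>\<^sup>+x. ennreal (1 / (row_sq t x)\<^sup>2) \<partial>count_space nonzero_row) \<le> ennreal (C' / Im t ^ 4)"
    using sum_height_sq_bound t by meson
  define f where "f x = row_bound k t p x * indicator {(0, 1), (0, -1)} x" for x
  define h where "h x = (ennreal C * ennreal (1 / (row_sq t x)\<^sup>2)) * indicator nonzero_row x" for x
  have "(\<integral>\<^sup>+x. row_bound k t p x \<partial>count_space bottom_rows) \<le> (\<integral>\<^sup>+x. f x + h x \<partial>count_space bottom_rows)"
  proof (rule nn_integral_mono)
    fix x assume "x \<in> space (count_space bottom_rows)"
    then have "x \<in> {(0, 1), (0, -1)} \<union> (lower_rows)"
      by (subst bottom_rows_split[symmetric]) simp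
    then consider "x \<in> {(0, 1), (0, -1)}" | "x \<in> lower_rows" by blast
    then show "row_bound k t p x \<le> f x + h x"
    proof cases
      case 1 then show ?thesis by (simp add: f_def)
    next
      case 2
      then have "row_bound k t p x \<le> ennreal C * ennreal (1 / (row_sq t x)\<^sup>2)"
        using C by (simp flip: ennreal_mult)
      also have "\<dots> = h x" using 2 by (simp add: h_def)
      finally show ?thesis by (simp add: add_increasing)
    qed
  qed
  also have "\<dots> = (\<integral>\<^sup>+x. f x \<partial>count_space bottom_rows) + (\<integral>\<^sup>+x. h x \<partial>count_space bottom_rows)"
    by (rule nn_integral_add) auto
  also have "\<dots> < \<infinity>"
  proof -
    have "(\<integral>\<^sup>+x. f x \<partial>count_space bottom_rows) = (\<Sum>x\<in>{(0, 1), (0, -1)}. f x)"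
      by (rule nn_integral_count_space'[of "{(0, 1), (0, -1)}"]) (auto simp: f_def bottom_rows_def)
    also have "\<dots> < \<infinity>"
      using row_bound_finite[of t "(0, 1)" k p] row_bound_finite[of t "(0, -1)" k p] t by (simp add: f_def bottom_rows_def)
    finally have 1: "(\<integral>\<^sup>+x. f x \<partial>count_space bottom_rows) < \<infinity>" .
    have "(\<integral>\<^sup>+x. h x \<partial>count_space bottom_rows) \<le> (\<integral>\<^sup>+x. h x \<partial>count_space UNIV)"
      by (subst nn_integral_count_space_indicator) (auto intro!: nn_integral_mono simp: indicator_def)
    also have "\<dots> = (\<integral>\<^sup>+x. ennreal C * ennreal (1 / (row_sq t x)\<^sup>2) \<partial>count_space nonzero_row)"
      unfolding h_def by (subst nn_integral_count_space_indicator) auto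
    also have "\<dots> \<le> ennreal C * ennreal (C' / Im t ^ 4)"
      using C' by (simp add: nn_integral_cmult mult_left_mono)
    also have "\<dots> < \<infinity>" by (simp add: ennreal_mult_less_top)
    finally show ?thesis using 1 by simp
  qed
  finally show ?thesis .
qed

lemma summand_summable:
  assumes t: "0 < Im t" "Im t \<le> 1" and k: "real_of_int k \<ge> real g + 4" and \<Delta>: "\<Delta> \<ge> 0"
  shows "summand k t p q summable_on bottom_rows \<times> lat g" "(\<integral>\<^sup>+x. ennreal (norm (row_sum k t p q x)) \<partial>count_space bottom_rows) < \<infinity>"
proof -
  have b: "(\<integral>\<^sup>+x. (\<integral>\<^sup>+v. ennreal (norm (summand k t p q (x, v))) \<partial>count_space (lat g)) \<partial>count_space bottom_rows) < \<infinity>"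
    by (rule le_less_trans[OF nn_integral_mono sum_row_bound_finite[OF assms]])
      (auto intro!: sum_norm_summand_le t)
  have "(\<integral>\<^sup>+z. ennreal (norm (summand k t p q z)) \<partial>count_space (bottom_rows \<times> lat g)) < \<infinity>"
    using b by (subst nn_integral_count_space_Times) (auto intro: countable_lat)
  then have "(\<lambda>z. norm (summand k t p q z)) summable_on bottom_rows \<times> lat g" by (rule abs_summable_on_nn_integral(1))
  then show "summand k t p q summable_on bottom_rows \<times> lat g" by (rule abs_summable_summable)
  have "ennreal (norm (row_sum k t p q x)) \<le> (\<integral>\<^sup>+v. ennreal (norm (summand k t p q (x, v))) \<partial>count_space (lat g))"
    if x: "x \<in> bottom_rows" for x
  proof -
    have "(\<integral>\<^sup>+v. ennreal (norm (summand k t p q (x, v))) \<partial>count_space (lat g)) < \<infinity>"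
      using sum_norm_summand_le[OF t(1) x] row_bound_finite[OF t(1) x] le_less_trans by blast
    then show ?thesis unfolding row_sum_eq[symmetric] by (rule abs_summable_on_nn_integral(2))
  qed
  then show "(\<integral>\<^sup>+x. ennreal (norm (row_sum k t p q x)) \<partial>count_space bottom_rows) < \<infinity>"
    by (intro le_less_trans[OF nn_integral_mono b]) auto
qed

text \<open>Vanishing expresses the two rows with c = 0 through all others. The factor exp (2 pi y
  sq p) common to all rows cancels, and what remains can be paired with \<Theta>.\<close>

lemma main_le_tail:
  assumes t: "0 < Im t" "Im t \<le> 1" and k: "real_of_int k \<ge> real g + 4" and \<Delta>: "\<Delta> \<ge> 0"
    and zero: "jacobi_poincare g k m n r t (point t p q) = 0"
  shows "ennreal (norm (central k t p q)) \<le>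
    (\<integral>\<^sup>+x. ennreal (row_weight k t x * norm (row_theta t x p q))
      \<partial>count_space lower_rows)"
proof -
  let ?F = "row_sum k t p q"
  define E where "E = exp (2 * pi * Im t * sq p)"
  have E: "E > 0" by (simp add: E_def)
  have fin: "(\<integral>\<^sup>+x. ennreal (norm (?F x)) \<partial>count_space bottom_rows) < \<infinity>"
    by (rule summand_summable(2)[OF t k \<Delta>])
  have summ: "?F summable_on B" if "B \<subseteq> bottom_rows" for B
    by (rule summable_on_subset_banach[OF abs_summable_summable[OF abs_summable_on_nn_integral(1)[OF fin]] that])
  have "0 = (\<Sum>\<^sub>\<infinity>z\<in>bottom_rows \<times> lat g. summand k t p q z)"
    using zero poincare_eq_infsum[OF t(1)] by simp
  also have "\<dots> = infsum ?F bottom_rows"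
    using infsum_Sigma_banach[OF summand_summable(1)[OF t k \<Delta>]] by (simp add: row_sum_eq)
  also have "\<dots> = infsum ?F {(0, 1), (0, -1)} + infsum ?F (lower_rows)"
    by (subst bottom_rows_split, rule infsum_Un_disjoint) (auto intro!: summ simp: bottom_rows_def)
  also have "infsum ?F {(0, 1), (0, -1)} = ?F (0, 1) + ?F (0, -1)" by simp
  finally have eq: "?F (0, 1) + ?F (0, -1) = - infsum ?F (lower_rows)"
    by (simp add: eq_neg_iff_add_eq_0)
  have F: "?F (0, 1) = e2pi (- t * of_real (sq p)) * Theta t p q"
    "?F (0, -1) = e2pi (- t * of_real (sq p)) * ((-1) powi (- k) * Theta t (\<lambda>i. - p i) (\<lambda>i. - q i))"
    by (simp_all add: row_sum_def factor_def rowfac_def mtau_def top_row_def lft_def rgt_def phase_def)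
  have nE: "norm (e2pi (- t * of_real (sq p))) = E" by (simp add: norm_e2pi E_def)
  have "ennreal (E * norm (central k t p q)) = ennreal (norm (?F (0, 1) + ?F (0, -1)))"
    unfolding F distrib_left[symmetric] norm_mult nE ..
  also have "\<dots> = ennreal (norm (infsum ?F (lower_rows)))" unfolding eq by simp
  also have "\<dots> \<le> (\<integral>\<^sup>+x. ennreal (norm (?F x)) \<partial>count_space lower_rows)"
  proof (rule abs_summable_on_nn_integral(2))
    have "(\<integral>\<^sup>+x. ennreal (norm (?F x)) \<partial>count_space lower_rows) \<le> (\<integral>\<^sup>+x. ennreal (norm (?F x)) \<partial>count_space bottom_rows)"
      by (subst (1 2) nn_integral_count_space_indicator) (auto intro!: nn_integral_mono simp: indicator_def)
    then show "(\<integral>\<^sup>+x. ennreal (norm (?F x)) \<partial>count_space lower_rows) < \<infinity>" using fin by (rule le_less_trans)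
  qed
  also have "\<dots> = (\<integral>\<^sup>+x. ennreal E * ennreal (row_weight k t x * norm (row_theta t x p q))
      \<partial>count_space lower_rows)"
    by (intro nn_integral_cong) (simp add: row_sum_def norm_mult norm_factor[OF t(1)] E_def mult_ac flip: ennreal_mult)
  also have "\<dots> = ennreal E * (\<integral>\<^sup>+x. ennreal (row_weight k t x * norm (row_theta t x p q))
      \<partial>count_space lower_rows)"
    by (rule nn_integral_cmult) auto
  finally show ?thesis
    using E by (simp add: ennreal_mult ennreal_mult_le_mult_iff)
qed

text \<open>Integrating the pointwise inequality against the modulus of \<Theta> lets Tonelli
  separate the rows; after Cauchy-Schwarz each row enters only through |c\<tau> + d|.\<close>

lemma tail_lower_bound:
  assumes t: "0 < Im t" "Im t \<le> 1" and k: "real_of_int k \<ge> real g + 4" and \<Delta>: "\<Delta> \<ge> 0"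
    and parity: "cong0 \<Longrightarrow> even k"
    and zero: "\<And>p q. jacobi_poincare g k m n r t (point t p q) = 0"
  shows "ennreal (theta_norm2 (Im t)) \<le> (\<integral>\<^sup>+x. ennreal (row_weight k t x *
      sqrt (theta_norm2 (Im (mtau t x)) * theta_norm2 (Im t))) \<partial>count_space lower_rows)"
proof -
  define w where "w x = row_weight k t x" for x
  define T where "T x p q = norm (row_theta t x p q) * norm (Theta t p q)" for x p q
  let ?B = "lower_rows"
  let ?I = "\<lambda>x. \<integral>\<^sup>+z. ennreal (w x * T x (fst z) (snd z)) \<partial>(box g \<Otimes>\<^sub>M box g)"
  \<comment> \<open>The parity hypothesis enters here: under the congruence the row
    \<open>(0, -1)\<close> repeats \<Theta>, and with sign -1 it would cancel the main term.\<close>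
  have e: "(-1) powi (- k) = (1::complex)" if cong0 using parity[OF that] by (simp add: power_int_minus_left)
  have e': "norm ((-1) powi (- k) :: complex) = 1" by (simp add: norm_power_int)
  have measT: "(\<lambda>z. ennreal (T x (fst z) (snd z))) \<in> borel_measurable (box g \<Otimes>\<^sub>M box g)" if "x \<in> ?B" for x
  proof -
    have "(\<lambda>z. row_theta t x (fst z) (snd z)) \<in> borel_measurable (box g \<Otimes>\<^sub>M box g)"
      using that by (intro measurable_Theta Im_mtau_pos t) (auto simp: lft_def rgt_def)
    moreover have "(\<lambda>z. Theta t (fst z) (snd z)) \<in> borel_measurable (box g \<Otimes>\<^sub>M box g)"
      by (rule measurable_Theta[OF t(1)]) auto
    ultimately show ?thesis unfolding T_def by measurable
  qed
  have meas: "(\<lambda>z. ennreal (w x * T x (fst z) (snd z))) \<in> borel_measurable (box g \<Otimes>\<^sub>M box g)" if "x \<in> ?B" for x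
    using measT[OF that] by (simp add: w_def T_def ennreal_mult)
  have "ennreal (theta_norm2 (Im t)) = (\<integral>\<^sup>+p. ennreal (\<Sum>\<^sub>\<infinity>v\<in>lat g. (norm (coef t p v))\<^sup>2) \<partial>box g)"
    by (rule integral_coef_square[OF t(1), symmetric])
  also have "\<dots> \<le> (\<integral>\<^sup>+p. (\<integral>\<^sup>+q. ennreal (norm (central k t p q) * norm (Theta t p q)) \<partial>box g) \<partial>box g)"
    by (intro nn_integral_mono main_term_lower[OF t(1) e e'])
  also have "\<dots> \<le> (\<integral>\<^sup>+p. (\<integral>\<^sup>+q. (\<integral>\<^sup>+x. ennreal (w x * T x p q) \<partial>count_space ?B) \<partial>box g) \<partial>box g)"
  proof (intro nn_integral_mono)
    fix p q
    have "ennreal (norm (central k t p q) * norm (Theta t p q)) \<le>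
      (\<integral>\<^sup>+x. ennreal (w x * norm (row_theta t x p q)) \<partial>count_space ?B) * ennreal (norm (Theta t p q))"
      using main_le_tail[OF t k \<Delta> zero, of p q] unfolding w_def by (simp add: ennreal_mult mult_right_mono)
    also have "\<dots> = (\<integral>\<^sup>+x. ennreal (w x * T x p q) \<partial>count_space ?B)"
      by (simp add: T_def ennreal_mult w_def mult.assoc flip: nn_integral_multc)
    finally show "ennreal (norm (central k t p q) * norm (Theta t p q)) \<le>
      (\<integral>\<^sup>+x. ennreal (w x * T x p q) \<partial>count_space ?B)" .
  qed
  also have "\<dots> = (\<integral>\<^sup>+z. (\<integral>\<^sup>+x. ennreal (w x * T x (fst z) (snd z)) \<partial>count_space ?B) \<partial>(box g \<Otimes>\<^sub>M box g))"
    using box.nn_integral_fst[OF borel_measurable_nn_integral_count_space[of ?B, OF countableI_type meas]] by simp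
  also have "\<dots> = (\<integral>\<^sup>+x. ?I x \<partial>count_space ?B)"
    by (intro nn_integral_count_space_nn_integral) (auto intro: meas)
  also have "\<dots> \<le> (\<integral>\<^sup>+x. ennreal (w x * sqrt (theta_norm2 (Im (mtau t x)) * theta_norm2 (Im t))) \<partial>count_space ?B)"
  proof (rule nn_integral_mono)
    fix x assume "x \<in> space (count_space ?B)"
    then have x: "x \<in> ?B" by simp
    then have det: "fst (top_row x) * snd x - snd (top_row x) * fst x = 1"
      using top_row_det[of "fst x" "snd x"] by simp
    have "?I x =
      (\<integral>\<^sup>+z. ennreal (w x) * ennreal (T x (fst z) (snd z)) \<partial>(box g \<Otimes>\<^sub>M box g))"
      by (intro nn_integral_cong ennreal_mult) (auto simp: w_def T_def)
    also have "\<dots> = ennreal (w x) * (\<integral>\<^sup>+p. (\<integral>\<^sup>+q. ennreal (T x p q) \<partial>box g) \<partial>box g)"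
      using box.nn_integral_fst[OF measT[OF x]] by (simp add: nn_integral_cmult[OF measT[OF x]])
    also have "\<dots> \<le> ennreal (w x) * ennreal (sqrt (theta_norm2 (Im (mtau t x)) * theta_norm2 (Im t)))"
      unfolding T_def lft_def rgt_def
      using x by (intro mult_left_mono Theta_twist_Cauchy_Schwarz[OF t(1) Im_mtau_pos[OF t(1)] det]) auto
    also have "\<dots> = ennreal (w x * sqrt (theta_norm2 (Im (mtau t x)) * theta_norm2 (Im t)))"
      by (rule ennreal_mult'[symmetric]) (simp add: w_def)
    finally show "?I x \<le>
      ennreal (w x * sqrt (theta_norm2 (Im (mtau t x)) * theta_norm2 (Im t)))" .
  qed
  finally show ?thesis by (simp add: w_def)
qed

text \<open>The squared norms at the heights y/s and y have the quotient exp (\<nu> (1 - 1/s))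
  s^(g/2). Its square root, multiplied by s^(-k/2), is exactly \<open>weight\<close>, so dividing
  the Cauchy-Schwarz bound by the squared norm at height y contradicts \<open>small\<close>.\<close>

lemma poincare_nonzero:
  assumes y: "0 < y" "y \<le> 1" and k: "real_of_int k \<ge> real g + 4" and \<Delta>: "\<Delta> \<ge> 0"
    and parity: "cong0 \<Longrightarrow> even k"
    and \<nu>: "\<nu> = real_of_int k - real g / 2 - 1" "4 * pi * \<Delta> * y = \<nu>"
    and small: "(\<integral>\<^sup>+x. ennreal (weight \<nu> (height_sq u y x)) \<partial>count_space nonzero_row) < 1"
  shows "\<exists>p q. jacobi_poincare g k m n r (Complex u y) (point (Complex u y) p q) \<noteq> 0"
proof (rule ccontr)
  assume "\<not> ?thesis"
  then have zero: "jacobi_poincare g k m n r (Complex u y) (point (Complex u y) p q) = 0" for p q by blast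
  define N where "N = theta_norm2 y"
  have N: "N > 0" unfolding N_def by (rule theta_norm2_pos[OF y(1)])
  have w: "height_sq u y x powr (- real_of_int k / 2) * sqrt (theta_norm2 (Im (mtau (Complex u y) x)) * N) = N * weight \<nu> (height_sq u y x)"
    if x: "x \<in> lower_rows" for x
  proof -
    define s where "s = height_sq u y x"
    have s: "s > 0" unfolding s_def using x y by (intro height_sq_pos) auto
    have Im: "Im (mtau (Complex u y) x) = y / s" using x by (simp add: Im_mtau s_def)
    have "theta_norm2 (y / s) = N * (exp (\<nu> * (1 - 1 / s)) * s powr (real g / 2))"
    proof -
      have "exp (- (4 * pi * (y / s)) * \<Delta>) = exp (- (4 * pi * y) * \<Delta>) * exp (\<nu> * (1 - 1 / s))"
        unfolding exp_add[symmetric] \<nu>(2)[symmetric] using s by (simp add: field_simps)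
      moreover have "(4 * pi * (y / s)) powr (- real g / 2) = (4 * pi * y) powr (- real g / 2) * s powr (real g / 2)"
        using powr_divide_neg[of "4 * pi * y" s "real g / 2"] y s by simp
      ultimately show ?thesis by (simp add: theta_norm2_def N_def mult_ac)
    qed
    then have "theta_norm2 (y / s) * N = (N * (exp (\<nu> / 2 * (1 - 1 / s)) * s powr (real g / 4)))\<^sup>2"
      using s by (simp add: power_mult_distrib power2_eq_square powr_add[symmetric] exp_add[symmetric] mult_ac)
    then have "sqrt (theta_norm2 (y / s) * N) = N * (exp (\<nu> / 2 * (1 - 1 / s)) * s powr (real g / 4))"
      using N by simp
    moreover have "s powr (- real_of_int k / 2) * s powr (real g / 4) = s powr (- (\<nu> + 1) / 2)"
    proof -
      have "- real_of_int k / 2 + real g / 4 = - (\<nu> + 1) / 2" by (simp add: \<nu>(1) field_simps)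
      then show ?thesis by (simp only: powr_add[symmetric])
    qed
    ultimately show ?thesis unfolding Im s_def[symmetric] weight_def by (simp add: mult_ac)
  qed
  have "ennreal N \<le> (\<integral>\<^sup>+x. ennreal (height_sq u y x powr (- real_of_int k / 2) * sqrt (theta_norm2 (Im (mtau (Complex u y) x)) * N)) \<partial>count_space lower_rows)"
    using tail_lower_bound[of "Complex u y" k] y k \<Delta> parity zero by (simp add: N_def)
  also have "\<dots> = (\<integral>\<^sup>+x. ennreal N * ennreal (weight \<nu> (height_sq u y x)) \<partial>count_space lower_rows)"
  proof (rule nn_integral_cong)
    fix x assume "x \<in> space (count_space lower_rows)"
    then have x: "x \<in> lower_rows" by simp
    show "ennreal (height_sq u y x powr (- real_of_int k / 2) * sqrt (theta_norm2 (Im (mtau (Complex u y) x)) * N)) =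
      ennreal N * ennreal (weight \<nu> (height_sq u y x))"
      unfolding w[OF x] using N by (intro ennreal_mult') simp
  qed
  \<comment> \<open>Coprimality is dropped here, so that the bound over all rows with nonzero
    \<open>c\<close> applies.\<close>
  also have "\<dots> \<le> (\<integral>\<^sup>+x. ennreal N * ennreal (weight \<nu> (height_sq u y x)) \<partial>count_space nonzero_row)"
    by (subst (1 2) nn_integral_count_space_indicator) (auto intro!: nn_integral_mono simp: indicator_def)
  also have "\<dots> = ennreal N * (\<integral>\<^sup>+x. ennreal (weight \<nu> (height_sq u y x)) \<partial>count_space nonzero_row)"
    by (rule nn_integral_cmult) auto
  also have "\<dots> < ennreal N * 1"
    using N small by (intro ennreal_mult_strict_left_mono) auto
  finally show False by simp
qed

end

section \<open>Half-integral matrices and the theorem\<close>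

lemma qform_real_eq_bil:
  assumes "m \<in> carrier_mat g g"
  shows "qform m (vec g x) = bil g (\<lambda>i j. m $$ (i, j)) x x"
  using assms by (simp add: qform_def scalar_prod_def bil_def sum_distrib_left atLeast0LessThan mult_ac)

lemma positive_definite_det_nonzero:
  assumes m: "m \<in> carrier_mat g g" and pd: "positive_definite_mat g m"
  shows "det m \<noteq> 0"
proof
  assume "det m = 0"
  then obtain v where v: "v \<in> carrier_vec g" "v \<noteq> 0\<^sub>v g" "m *\<^sub>v v = 0\<^sub>v g"
    using det_0_iff_vec_prod_zero_field[OF m] by blast
  then have "qform m v = 0" by (simp add: qform_def)
  then show False using pd v by (auto simp: positive_definite_mat_def)
qed

lemma mult_mat_vec_sum:
  assumes "m \<in> carrier_mat g g" "v \<in> carrier_vec g" "i < g"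
  shows "(m *\<^sub>v v) $ i = (\<Sum>j<g. m $$ (i, j) * v $ j)"
  using assms by (simp add: scalar_prod_def atLeast0LessThan)

lemma det_nonzero_solve:
  fixes m :: "real mat"
  assumes m: "m \<in> carrier_mat g g" and d: "det m \<noteq> 0"
  shows "\<exists>w. \<forall>i<g. (\<Sum>j<g. m $$ (i, j) * w j) = b i"
proof -
  have "m \<in> Units (ring_mat TYPE(real) g ())" by (rule det_non_zero_imp_unit[OF m d])
  then obtain B where B: "B \<in> carrier_mat g g" "m * B = 1\<^sub>m g"
    by (auto simp: Units_def ring_mat_def)
  have "m *\<^sub>v (B *\<^sub>v vec g b) = vec g b"
    using assoc_mult_mat_vec[OF m B(1), of "vec g b"] B(2) by simp
  then have "(m *\<^sub>v (B *\<^sub>v vec g b)) $ i = b i" if "i < g" for i using that by simp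
  then have "\<forall>i<g. (\<Sum>j<g. m $$ (i, j) * (B *\<^sub>v vec g b) $ j) = b i"
    using mult_mat_vec_sum[OF m, of "B *\<^sub>v vec g b"] B(1) by auto
  then show ?thesis by blast
qed

text \<open>Clearing the lower left block by a column operation gives the Schur complement.\<close>

lemma discriminant_det_quotient:
  fixes \<rho> :: "nat \<Rightarrow> real"
  assumes m: "m \<in> carrier_mat g g" and d: "det m \<noteq> 0" and r: "r \<in> carrier_vec g"
    and \<rho>: "\<And>i. i < g \<Longrightarrow> 2 * (\<Sum>j<g. m $$ (i, j) * \<rho> j) = of_int (r $ i)"
  shows "discriminant_det m n r / index_det m = 2 * real n - (\<Sum>i<g. of_int (r $ i) * \<rho> i)"
proof -
  define D where "D = 2 \<cdot>\<^sub>m m"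
  define Q where "Q = mat 1 1 (\<lambda>_. 2 * real n)"
  define U where "U = mat_of_rows g [rvec_of_int r]"
  define V where "V = mat_of_cols g [rvec_of_int r]"
  define X where "X = mat g 1 (\<lambda>(i, _). - \<rho> i)"
  define E where "E = four_block_mat (1\<^sub>m 1) (0\<^sub>m 1 g) X (1\<^sub>m g)"
  have rv: "rvec_of_int r \<in> carrier_vec g" using r by simp
  have dims: "D \<in> carrier_mat g g" "Q \<in> carrier_mat 1 1" "U \<in> carrier_mat 1 g" "V \<in> carrier_mat g 1" "X \<in> carrier_mat g 1"
    using m by (auto simp: D_def Q_def U_def V_def X_def)
  have E: "E \<in> carrier_mat (1 + g) (1 + g)" unfolding E_def using dims by auto
  have F: "four_block_mat Q U V D \<in> carrier_mat (1 + g) (1 + g)" using dims by auto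
  have detE: "det E = 1"
    unfolding E_def by (subst det_four_block_mat_upper_right_zero[of _ 1 _ g]) (use dims in auto)
  have VX: "V + D * X = 0\<^sub>m g 1"
  proof (rule eq_matI)
    fix i j assume "i < dim_row (0\<^sub>m g 1 :: real mat)" "j < dim_col (0\<^sub>m g 1 :: real mat)"
    then have ij: "i < g" "j = 0" by auto
    have "(D * X) $$ (i, 0) = (\<Sum>k<g. (2 * m $$ (i, k)) * (- \<rho> k))"
      using ij m by (simp add: D_def X_def scalar_prod_def atLeast0LessThan)
    also have "\<dots> = - of_int (r $ i)"
      using \<rho>[OF ij(1)] by (simp add: sum_negf sum_distrib_left mult.assoc)
    finally show "(V + D * X) $$ (i, j) = 0\<^sub>m g 1 $$ (i, j)"
      using ij dims r by (simp add: V_def mat_of_cols_def)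
  qed (use dims in auto)
  have Q': "Q + U * X = mat 1 1 (\<lambda>_. 2 * real n - (\<Sum>i<g. of_int (r $ i) * \<rho> i))"
  proof (rule eq_matI)
    fix i j assume "i < dim_row (mat 1 1 (\<lambda>_. 2 * real n - (\<Sum>i<g. of_int (r $ i) * \<rho> i)))"
      "j < dim_col (mat 1 1 (\<lambda>_. 2 * real n - (\<Sum>i<g. of_int (r $ i) * \<rho> i)))"
    then have ij: "i = 0" "j = 0" by auto
    have "(U * X) $$ (0, 0) = (\<Sum>k<g. of_int (r $ k) * (- \<rho> k))"
      using dims r by (simp add: U_def X_def scalar_prod_def atLeast0LessThan mat_of_rows_def)
    then show "(Q + U * X) $$ (i, j) = mat 1 1 (\<lambda>_. 2 * real n - (\<Sum>i<g. of_int (r $ i) * \<rho> i)) $$ (i, j)"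
      using ij dims by (simp add: Q_def sum_negf)
  qed (use dims in auto)
  have "discriminant_det m n r = det (four_block_mat Q U V D)"
    using r by (simp add: discriminant_det_def Q_def U_def V_def D_def)
  also have "\<dots> = det (four_block_mat Q U V D * E)"
    by (simp add: det_mult[OF F E] detE)
  also have "four_block_mat Q U V D * E = four_block_mat (Q + U * X) U (0\<^sub>m g 1) D"
    unfolding E_def
    by (subst mult_four_block_mat[of _ 1 1 _ g _ g _ _ 1 _ g]) (use dims VX in \<open>auto simp: VX\<close>)
  also have "det \<dots> = det (Q + U * X) * det D"
    by (rule det_four_block_mat_lower_left_zero[of _ 1 _ g]) (use dims in auto)
  also have "det (Q + U * X) = 2 * real n - (\<Sum>i<g. of_int (r $ i) * \<rho> i)"
    unfolding Q' by (subst det_single) auto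
  finally have "discriminant_det m n r = (2 * real n - (\<Sum>i<g. of_int (r $ i) * \<rho> i)) * det D" .
  moreover have "det D \<noteq> 0" using d by (simp add: D_def)
  ultimately show ?thesis by (simp add: index_det_def D_def)
qed

lemma jacobi_data_exists:
  assumes sm: "symmetric_mat g m" and pd: "positive_definite_mat g m" and hi: "half_integral_mat g m"
    and r: "r \<in> carrier_vec g"
  shows "\<exists>\<rho>. jacobi_data g m r \<rho> \<and> discriminant_det m n r / index_det m = 2 * theta_data.\<Delta> g (\<lambda>i j. m $$ (i, j)) n \<rho>"
proof -
  have m: "m \<in> carrier_mat g g" and tm: "transpose_mat m = m" using sm by (auto simp: symmetric_mat_def)
  have d: "det m \<noteq> 0" by (rule positive_definite_det_nonzero[OF m pd])
  \<comment> \<open>\<open>\<rho>\<close> is m^(-1) r / 2. Pairing it with \<open>r\<close> gives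
    \<open>2 * sq \<rho>\<close>, which turns the Schur complement into 2 \<Delta> at the
    end.\<close>
  obtain \<rho> where \<rho>: "\<And>i. i < g \<Longrightarrow> (\<Sum>j<g. m $$ (i, j) * \<rho> j) = of_int (r $ i) / 2"
    using det_nonzero_solve[OF m d, of "\<lambda>i. of_int (r $ i) / 2"] by blast
  have jd: "jacobi_data g m r \<rho>"
  proof
    show "m $$ (i, j) = m $$ (j, i)" if "i < g" "j < g" for i j
      using that m tm by (metis carrier_matD index_transpose_mat(1))
    show "0 < bil g (\<lambda>i j. m $$ (i, j)) x x" if "\<exists>i<g. x i \<noteq> 0" for x :: "nat \<Rightarrow> real"
    proof -
      have "vec g x \<noteq> 0\<^sub>v g" using that by (metis index_vec index_zero_vec(1))
      then show ?thesis using pd qform_real_eq_bil[OF m, of x] by (auto simp: positive_definite_mat_def)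
    qed
    show "\<exists>w. \<forall>j<g. (\<Sum>k<g. m $$ (j, k) * w k) = (if j = i then 1 else 0)" for i
      by (rule det_nonzero_solve[OF m d])
    show "2 * m $$ (i, j) \<in> \<int>" if "i < g" "j < g" for i j using hi that by (auto simp: half_integral_mat_def)
    show "m $$ (i, i) \<in> \<int>" if "i < g" for i
    proof -
      obtain l :: int where "even l" "2 * m $$ (i, i) = of_int l" using hi \<open>i < g\<close> by (auto simp: half_integral_mat_def)
      then have "m $$ (i, i) = of_int (l div 2)" by (auto elim!: evenE)
      then show ?thesis by simp
    qed
    show "2 * (\<Sum>j<g. m $$ (i, j) * \<rho> j) = of_int (r $ i)" if "i < g" for i using \<rho>[OF that] by simp
  qed (fact m r)+
  interpret jacobi_data g m r n \<rho> by (rule jd)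
  have "discriminant_det m n r / index_det m = 2 * real n - (\<Sum>i<g. of_int (r $ i) * \<rho> i)"
    by (rule discriminant_det_quotient[OF m d r]) (simp add: \<rho>)
  also have "\<dots> = 2 * \<Delta>" by (simp add: \<Delta>_def bil_rho[symmetric])
  finally show ?thesis using jd by blast
qed

lemma (in jacobi_data) cong0_imp:
  assumes cong0
  shows "two_r_cong_0 g m r"
proof -
  obtain l where l: "l \<in> lat g" "\<And>i. i < g \<Longrightarrow> 2 * real_of_int (r $ i) = 2 * (\<Sum>j<g. m $$ (i, j) * of_int (l $ j))"
    using assms unfolding cong0_def by blast
  have "2 \<cdot>\<^sub>v rvec_of_int r = transpose_mat (2 \<cdot>\<^sub>m m) *\<^sub>v rvec_of_int l"
  proof (rule eq_vecI)
    fix i assume "i < dim_vec (transpose_mat (2 \<cdot>\<^sub>m m) *\<^sub>v rvec_of_int l)"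
    then have i: "i < g" using m by simp
    have "(transpose_mat (2 \<cdot>\<^sub>m m) *\<^sub>v rvec_of_int l) $ i = (\<Sum>j<g. 2 * m $$ (j, i) * of_int (l $ j))"
      using i m l(1) by (simp add: scalar_prod_def atLeast0LessThan)
    also have "\<dots> = 2 * (\<Sum>j<g. m $$ (i, j) * of_int (l $ j))"
      unfolding sum_distrib_left using i by (intro sum.cong refl) (simp add: sym[of i])
    finally show "(2 \<cdot>\<^sub>v rvec_of_int r) $ i = (transpose_mat (2 \<cdot>\<^sub>m m) *\<^sub>v rvec_of_int l) $ i"
      using i r l(2)[OF i] by simp
  qed (use m r in auto)
  then show ?thesis using l(1) by (auto simp: two_r_cong_0_def)
qed

text \<open>The maximum occurs at g = 1; for g >= 5 the second formula is at most 2/15.\<close>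

lemma alpha_exp_le: "g \<ge> 1 \<Longrightarrow> alpha_exp g \<le> 2 / 9"
proof -
  assume g: "g \<ge> 1"
  then have "real g \<ge> 1" by simp
  then show ?thesis by (auto simp: alpha_exp_def field_simps)
qed

theorem theorem1p1:
  shows "\<exists>B::real. B > 3 * ln 2 \<and>
    (\<forall>g::nat. g \<ge> 1 \<longrightarrow> (\<exists>k0::int. \<forall>(m::real mat) (n::nat) (r::int vec) (k::int).
       symmetric_mat g m \<longrightarrow> positive_definite_mat g m \<longrightarrow> half_integral_mat g m \<longrightarrow>
       r \<in> carrier_vec g \<longrightarrow> 4 * real n > qform (inverse_mat m) (rvec_of_int r) \<longrightarrow>
       k \<ge> k0 \<longrightarrow>
       (two_r_cong_0 g m r \<longrightarrow> even k) \<longrightarrow>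
       (let k' = real_of_int k - real g / 2 - 1;
            X = pi * discriminant_det m n r / index_det m
        in k' \<le> X \<and> X \<le> k' powr (1 + alpha_exp g) * exp (- (B * ln k' / ln (ln k')))) \<longrightarrow>
       (\<exists>(t::complex) (z::complex vec).
          Im t > 0 \<and> z \<in> carrier_vec g \<and> jacobi_poincare g k m n r t z \<noteq> 0)))"
proof -
  obtain \<nu>\<^sub>0 where \<nu>\<^sub>0: "\<And>\<nu> v. \<nu> \<ge> \<nu>\<^sub>0 \<Longrightarrow> 0 < v \<Longrightarrow> v \<le> 1 \<Longrightarrow> 1 / v \<le> 2 * \<nu> powr (2 / 9) \<Longrightarrow>
    \<exists>u. (\<integral>\<^sup>+x. ennreal (weight \<nu> (height_sq u v x)) \<partial>count_space nonzero_row) < 1"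
    using eventually_weight_sum_small by blast
  \<comment> \<open>The witness B = 4 rests on the crude bound ln 2 <= 1.\<close>
  have B: "(4::real) > 3 * ln 2" using ln_le_minus_one[of "2::real"] by simp
  have "\<exists>t z. Im t > 0 \<and> z \<in> carrier_vec g \<and> jacobi_poincare g k m n r t z \<noteq> 0"
    if g: "g \<ge> 1" and m: "symmetric_mat g m" "positive_definite_mat g m" "half_integral_mat g m"
      and r: "r \<in> carrier_vec g" and k: "k \<ge> \<lceil>max \<nu>\<^sub>0 3\<rceil> + int g + 5"
      and parity: "two_r_cong_0 g m r \<longrightarrow> even k"
      and X: "k' = real_of_int k - real g / 2 - 1" "X = pi * discriminant_det m n r / index_det m"
        "k' \<le> X" "X \<le> k' powr (1 + alpha_exp g) * exp (- (4 * ln k' / ln (ln k')))"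
    for g :: nat and m :: "real mat" and n :: nat and r :: "int vec" and k :: int and k' X :: real
  proof -
    obtain \<rho> where jd: "jacobi_data g m r \<rho>"
      and quot: "discriminant_det m n r / index_det m = 2 * theta_data.\<Delta> g (\<lambda>i j. m $$ (i, j)) n \<rho>"
      using jacobi_data_exists[OF m r] by blast
    interpret jacobi_data g m r n \<rho> by (rule jd)
    \<comment> \<open>The threshold for \<open>k\<close> gives
      \<open>k' \<ge> max \<nu>\<^sub>0 3 + g / 2 + 4\<close>. The 3 exceeds e, so that ln (ln k')
      is nonnegative and the exponential factor in the upper bound for \<open>X\<close> is at most
      1.\<close>
    have "real_of_int k \<ge> real_of_int (\<lceil>max \<nu>\<^sub>0 3\<rceil> + int g + 5)" using k by (simp only: of_int_le_iff)
    then have "real_of_int k \<ge> max \<nu>\<^sub>0 3 + real g + 5" using le_of_int_ceiling[of "max \<nu>\<^sub>0 3"] by linarith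
    then have k'_ge: "k' \<ge> \<nu>\<^sub>0" "k' \<ge> 3" and k4: "real_of_int k \<ge> real g + 4"
      unfolding X(1) by auto
    have X\<Delta>: "X = 2 * pi * \<Delta>" unfolding X(2) times_divide_eq_right[symmetric] quot by simp
    have X0: "X > 0" using X(3) k'_ge by simp
    then have \<Delta>0: "\<Delta> > 0" by (simp add: X\<Delta> zero_less_mult_iff)
    \<comment> \<open>The lower bound on \<open>X\<close> gives y <= 1/2, and the upper bound will
      give 1/y <= 2 k'^(2/9).\<close>
    define y where "y = k' / (2 * X)"
    have y: "0 < y" "y \<le> 1" using X0 X(3) k'_ge by (simp_all add: y_def)
    have X_le: "X \<le> k' * k' powr (2 / 9)"
    proof -
      have "exp 1 \<le> k'" using exp_le k'_ge by linarith
      then have "1 \<le> ln k'" using k'_ge by (simp add: ln_ge_iff)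
      then have "0 \<le> 4 * ln k' / ln (ln k')" by (intro divide_nonneg_nonneg) auto
      then have "k' powr (1 + alpha_exp g) * exp (- (4 * ln k' / ln (ln k'))) \<le> k' powr (1 + alpha_exp g) * 1"
        by (intro mult_left_mono) auto
      with X(4) have "X \<le> k' powr (1 + alpha_exp g) * 1" by (rule order_trans)
      also have "\<dots> \<le> k' powr (1 + 2 / 9)"
        using alpha_exp_le[OF g] k'_ge by (simp add: powr_mono)
      also have "\<dots> = k' * k' powr (2 / 9)" using k'_ge by (simp only: powr_add) simp
      finally show ?thesis .
    qed
    have "1 / y \<le> 2 * k' powr (2 / 9)"
      using X_le k'_ge by (simp add: y_def divide_le_eq mult_ac)
    from \<nu>\<^sub>0[OF k'_ge(1) y this] obtain u
      where u: "(\<integral>\<^sup>+x. ennreal (weight k' (height_sq u y x)) \<partial>count_space nonzero_row) < 1" by blast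
    have "4 * pi * \<Delta> * y = k'" using \<Delta>0 by (simp add: y_def X\<Delta>)
    from poincare_nonzero[OF y k4 less_imp_le[OF \<Delta>0] _ X(1) this u] parity cong0_imp
    obtain p q where "jacobi_poincare g k m n r (Complex u y) (point (Complex u y) p q) \<noteq> 0" by blast
    then show ?thesis using y by (intro exI[of _ "Complex u y"] exI[of _ "point (Complex u y) p q"]) (simp add: point_def)
  qed
  then show ?thesis
    unfolding Let_def
    by (intro exI[of _ "4::real"] conjI B allI impI exI[of _ "\<lceil>max \<nu>\<^sub>0 3\<rceil> + int _ + 5"]) blast
qed

end
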